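(* Let $(X,\mathcal{J}_0,\psi)$ be a (compact, real $2n$-dimensional) generalized Kähler manifold with one pure spinor, and let $i_M:M\to X$ be a submanifold of dimension $2m$ whose conormal bundle $N^*\subset T^*X|_M$ is $\mathcal{J}_0$-invariant, i.e. $\mathcal{J}_0(N^* )=N^*$. Then the pull back $i_M^*\psi$ is a $d$-closed, non-degenerate, pure spinor on $M$, and the induced pair $(\mathcal{J}_{0,M},i_M^*\psi)$ is a generalized Kähler structure with one pure spinor on $M$.
   Context: Generalized complex structures: $\langle\,,\,\rangle$ is the natural symmetric pairing on $TX\oplus T^*X$. An almost generalized complex structure is a section $\mathcal{J}$ of $SO(TX\oplus T^*X)$ with $\mathcal{J}^2=-\mathrm{id}$; $L_{\mathcal{J}}\subset(TX\oplus T^*X)^{\mathbb{C}}$ is its $(-\sqrt{-1})$-eigenbundle. It is a generalized complex structure if $L_{\mathcal{J}}$ is involutive for the Courant bracket $[v_1+\theta^1,v_2+\theta^2]_c=[v_1,v_2]+\frac12\{\mathcal{L}_{v_1}\theta^2-\mathcal{L}_{v_2}\theta^1-i_{v_2}d\theta^1+i_{v_1}d\theta^2\}$. Generalized Kähler structures: a generalized metric is a section $\hat G$ of $SO(TX\oplus T^*X)$ with $\hat G^2=\mathrm{id}$ such that $\langle\hat G\,\cdot,\cdot\rangle$ is positive-definite. A generalized Kähler structure is a pair $(\mathcal{J}_0,\mathcal{J}_1)$ of commuting generalized complex structures such that $-\mathcal{J}_0\mathcal{J}_1$ is a generalized metric. Pure spinors: $TX\oplus T^*X$ acts on differential forms by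 $(v+\eta)\cdot\psi=i_v\psi+\eta\wedge\psi$. A pure spinor on a real $2n$-dimensional manifold is a complex differential form $\psi$ with $\ker\psi=\{E\in(TX\oplus T^*X)^{\mathbb{C}}: E\cdot\psi=0\}$ of complex rank $2n$ (at every point). It is non-degenerate if $(TX\oplus T^*X)^{\mathbb{C}}=\ker\psi\oplus\overline{\ker\psi}$; then $\mathcal{J}_\psi$ denotes the almost generalized complex structure with $(-\sqrt{-1})$-eigenbundle $\ker\psi$, which is integrable if $d\psi=0$. A generalized Kähler structure with one pure spinor is a pair $(\mathcal{J}_0,\psi)$ of a generalized complex structure and a $d$-closed non-degenerate complex pure spinor such that $(\mathcal{J}_0,\mathcal{J}_\psi)$ is a generalized Kähler structure. Induced structure: $N^*$ is the kernel of $p=\mathrm{id}_{TM}\oplus i_M^*:TM\oplus T^*X|_M\to TM\oplus T^*M$. If $\mathcal{J}_0(N^* )=N^*$, then $TM\oplus T^*X|_M$ is $\mathcal{J}_0$-invariant, and $\mathcal{J}_{0,M}$ is the generalized complex structure on $M$ induced by $\mathcal{J}_0$ on the quotient $(TM\oplus T^*X|_M)/N^*\cong TM\oplus T^*M$. *)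

theory Defs
  imports "HOL-Analysis.Analysis"
begin

section \<open>Smooth manifolds\<close>

text \<open>\<open>C\<^sup>k\<close> maps on an open subset of a finite-dimensional space. Since the domain is
  finite-dimensional, being differentiable with all directional derivatives of class \<open>C\<^sup>k\<close> is the
  same as being of class \<open>C\<^sup>k\<^sup>+\<^sup>1\<close>.\<close>

primrec Ck_on :: "nat \<Rightarrow> 'a::euclidean_space set \<Rightarrow> ('a \<Rightarrow> 'b::real_normed_vector) \<Rightarrow> bool" where
  "Ck_on 0 S f \<longleftrightarrow> continuous_on S f"
| "Ck_on (Suc k) S f \<longleftrightarrow> (\<forall>x\<in>S. f differentiable (at x)) \<and>
     (\<forall>v. Ck_on k S (\<lambda>x. frechet_derivative f (at x) v))"

definition smooth_on :: "'a::euclidean_space set \<Rightarrow> ('a \<Rightarrow> 'b::real_normed_vector) \<Rightarrow> bool" where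
  "smooth_on S f \<longleftrightarrow> (\<forall>k. Ck_on k S f)"

text \<open>A chart is a pair of its domain and its coordinate map. The dimension of a manifold is
  \<open>CARD('n)\<close>.\<close>

type_synonym ('x, 'n) chart = "'x set \<times> ('x \<Rightarrow> real ^ 'n)"

record ('x, 'n::finite) manifold =
  topo :: "'x topology"
  atlas :: "('x, 'n) chart set"

definition smooth_in :: "('x, 'n::finite) chart \<Rightarrow> 'x set \<Rightarrow> ('x \<Rightarrow> 'b::real_normed_vector) \<Rightarrow> bool" where
  "smooth_in c W g \<longleftrightarrow> smooth_on (snd c ` (fst c \<inter> W)) (g \<circ> inv_into (fst c) (snd c))"

definition cderiv :: "('x, 'n::finite) chart \<Rightarrow> ('x \<Rightarrow> 'b::real_normed_vector) \<Rightarrow> 'x \<Rightarrow> real ^ 'n \<Rightarrow> 'b" where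
  "cderiv c g p v = frechet_derivative (g \<circ> inv_into (fst c) (snd c)) (at (snd c p)) v"

definition partial :: "('x, 'n::finite) chart \<Rightarrow> ('x \<Rightarrow> 'b::real_normed_vector) \<Rightarrow> 'x \<Rightarrow> 'n \<Rightarrow> 'b" where
  "partial c g p i = cderiv c g p (axis i 1)"

definition smooth_manifold :: "('x, 'n::finite) manifold \<Rightarrow> bool" where
  "smooth_manifold X \<longleftrightarrow>
     Hausdorff_space (topo X) \<and> second_countable (topo X) \<and>
     topspace (topo X) = \<Union> (fst ` atlas X) \<and>
     (\<forall>c\<in>atlas X. openin (topo X) (fst c) \<and> open (snd c ` fst c) \<and>
        homeomorphic_map (subtopology (topo X) (fst c)) (top_of_set (snd c ` fst c)) (snd c)) \<and>
     (\<forall>c\<in>atlas X. \<forall>c'\<in>atlas X. smooth_in c (fst c') (snd c'))"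

definition jacobian :: "('y, 'm::finite) chart \<Rightarrow> ('x, 'n::finite) chart \<Rightarrow> ('y \<Rightarrow> 'x) \<Rightarrow> 'y \<Rightarrow> real ^ 'm ^ 'n" where
  "jacobian c c' f p = matrix (cderiv c (snd c' \<circ> f) p)"

definition smooth_map :: "('y, 'm::finite) manifold \<Rightarrow> ('x, 'n::finite) manifold \<Rightarrow> ('y \<Rightarrow> 'x) \<Rightarrow> bool" where
  "smooth_map M X f \<longleftrightarrow> continuous_map (topo M) (topo X) f \<and>
     (\<forall>c\<in>atlas M. \<forall>c'\<in>atlas X. smooth_in c (f -` fst c') (snd c' \<circ> f))"

definition smooth_embedding :: "('y, 'm::finite) manifold \<Rightarrow> ('x, 'n::finite) manifold \<Rightarrow> ('y \<Rightarrow> 'x) \<Rightarrow> bool" where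
  "smooth_embedding M X f \<longleftrightarrow> smooth_map M X f \<and> embedding_map (topo M) (topo X) f \<and>
     (\<forall>c\<in>atlas M. \<forall>c'\<in>atlas X. \<forall>p\<in>fst c. f p \<in> fst c' \<longrightarrow> inj (\<lambda>w. jacobian c c' f p *v w))"

definition chart_at :: "('x, 'n::finite) manifold \<Rightarrow> 'x \<Rightarrow> ('x, 'n) chart" where
  "chart_at X x = (SOME c. c \<in> atlas X \<and> x \<in> fst c)"


section \<open>The generalized tangent bundle\<close>

text \<open>In a chart, an element of \<open>TX \<oplus> T\<^sup>*X\<close> (or of its complexification) is given by its
  components with respect to the frame of the coordinate vector fields (indices \<open>Inl i\<close>) and the
  coordinate differentials (indices \<open>Inr i\<close>). All tensor fields below are families of component
  functions, one for each chart of the atlas, obeying the transformation law of the tensor type;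
  values at a chart \<open>c\<close> and a point outside of \<open>fst c\<close> are irrelevant.\<close>

definition vpart :: "'a ^ ('m::finite + 'n::finite) \<Rightarrow> 'a ^ 'm" where
  "vpart E = (\<chi> i. E $ Inl i)"

definition cpart :: "'a ^ ('m::finite + 'n::finite) \<Rightarrow> 'a ^ 'n" where
  "cpart E = (\<chi> i. E $ Inr i)"

definition gjoin :: "'a ^ 'm::finite \<Rightarrow> 'a ^ 'n::finite \<Rightarrow> 'a ^ ('m + 'n)" where
  "gjoin v \<eta> = (\<chi> k. case k of Inl i \<Rightarrow> v $ i | Inr i \<Rightarrow> \<eta> $ i)"

abbreviation cmat :: "real ^ 'm::finite ^ 'n::finite \<Rightarrow> complex ^ 'm ^ 'n" where
  "cmat \<equiv> map_matrix complex_of_real"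

definition cnj_vec :: "complex ^ 'n::finite \<Rightarrow> complex ^ 'n" where
  "cnj_vec E = (\<chi> i. cnj (E $ i))"

text \<open>Change of coordinates: vectors are pushed forward by the Jacobian \<open>A\<close>, covectors are pulled
  back by the Jacobian \<open>B\<close> of the inverse coordinate change.\<close>

definition gtrans :: "'a::comm_semiring_1 ^ 'n::finite ^ 'n \<Rightarrow> 'a ^ 'n ^ 'n \<Rightarrow> 'a ^ ('n + 'n) \<Rightarrow> 'a ^ ('n + 'n)" where
  "gtrans A B E = gjoin (A *v vpart E) (transpose B *v cpart E)"

definition gpair :: "real ^ ('n::finite + 'n) \<Rightarrow> real ^ ('n + 'n) \<Rightarrow> real" where
  "gpair E F = (cpart E \<bullet> vpart F + cpart F \<bullet> vpart E) / 2"

definition SO_gen :: "(real ^ ('n::finite + 'n) ^ ('n + 'n)) set" where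
  "SO_gen = {J. det J = 1 \<and> (\<forall>E F. gpair (J *v E) (J *v F) = gpair E F)}"

type_synonym ('x, 'n) gend = "('x, 'n) chart \<Rightarrow> 'x \<Rightarrow> real ^ ('n + 'n) ^ ('n + 'n)"

type_synonym ('x, 'n) gsec = "('x, 'n) chart \<Rightarrow> 'x \<Rightarrow> complex ^ ('n + 'n)"

definition smooth_SO_section :: "('x, 'n::finite) manifold \<Rightarrow> ('x, 'n) gend \<Rightarrow> bool" where
  "smooth_SO_section X J \<longleftrightarrow>
     (\<forall>c\<in>atlas X. smooth_in c UNIV (J c) \<and> (\<forall>p\<in>fst c. J c p \<in> SO_gen)) \<and>
     (\<forall>c\<in>atlas X. \<forall>c'\<in>atlas X. \<forall>p\<in>fst c \<inter> fst c'. \<forall>E.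
        J c' p *v gtrans (jacobian c c' id p) (jacobian c' c id p) E
          = gtrans (jacobian c c' id p) (jacobian c' c id p) (J c p *v E))"

text \<open>Smooth sections of \<open>(TX \<oplus> T\<^sup>*X)\<^sup>\<complex>\<close> over the open set \<open>W\<close>.\<close>

definition smooth_gsec :: "('x, 'n::finite) manifold \<Rightarrow> 'x set \<Rightarrow> ('x, 'n) gsec \<Rightarrow> bool" where
  "smooth_gsec X W E \<longleftrightarrow>
     (\<forall>c\<in>atlas X. smooth_in c W (E c)) \<and>
     (\<forall>c\<in>atlas X. \<forall>c'\<in>atlas X. \<forall>p\<in>fst c \<inter> fst c' \<inter> W.
        E c' p = gtrans (cmat (jacobian c c' id p)) (cmat (jacobian c' c id p)) (E c p))"

text \<open>The classical coordinate expressions, for complex vector fields \<open>v, w\<close> and complex 1-forms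
  \<open>\<theta>\<close> given by components: \<open>[v,w]\<close>, \<open>\<L>\<^sub>v \<theta>\<close> and \<open>i\<^sub>v d\<theta>\<close>.\<close>

definition lie_bracket ::
    "('x, 'n::finite) chart \<Rightarrow> ('x \<Rightarrow> complex ^ 'n) \<Rightarrow> ('x \<Rightarrow> complex ^ 'n) \<Rightarrow> 'x \<Rightarrow> complex ^ 'n" where
  "lie_bracket c v w p =
     (\<chi> j. \<Sum>i\<in>UNIV. v p $ i * partial c (\<lambda>q. w q $ j) p i - w p $ i * partial c (\<lambda>q. v q $ j) p i)"

definition lie_derivative ::
    "('x, 'n::finite) chart \<Rightarrow> ('x \<Rightarrow> complex ^ 'n) \<Rightarrow> ('x \<Rightarrow> complex ^ 'n) \<Rightarrow> 'x \<Rightarrow> complex ^ 'n" where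
  "lie_derivative c v \<theta> p =
     (\<chi> j. \<Sum>i\<in>UNIV. v p $ i * partial c (\<lambda>q. \<theta> q $ j) p i + \<theta> p $ i * partial c (\<lambda>q. v q $ i) p j)"

definition interior_d ::
    "('x, 'n::finite) chart \<Rightarrow> ('x \<Rightarrow> complex ^ 'n) \<Rightarrow> ('x \<Rightarrow> complex ^ 'n) \<Rightarrow> 'x \<Rightarrow> complex ^ 'n" where
  "interior_d c v \<theta> p =
     (\<chi> j. \<Sum>i\<in>UNIV. v p $ i * (partial c (\<lambda>q. \<theta> q $ j) p i - partial c (\<lambda>q. \<theta> q $ i) p j))"

definition courant :: "('x, 'n::finite) gsec \<Rightarrow> ('x, 'n) gsec \<Rightarrow> ('x, 'n) gsec" where
  "courant E F = (\<lambda>c p.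
     let v1 = \<lambda>q. vpart (E c q); \<theta>1 = \<lambda>q. cpart (E c q);
         v2 = \<lambda>q. vpart (F c q); \<theta>2 = \<lambda>q. cpart (F c q)
     in gjoin (lie_bracket c v1 v2 p)
          ((1 / 2) *s (lie_derivative c v1 \<theta>2 p - lie_derivative c v2 \<theta>1 p
                        - interior_d c v2 \<theta>1 p + interior_d c v1 \<theta>2 p)))"


section \<open>Generalized complex and generalized Kaehler structures\<close>

definition eigenspace_minus_i :: "real ^ ('n::finite + 'n) ^ ('n + 'n) \<Rightarrow> (complex ^ ('n + 'n)) set" where
  "eigenspace_minus_i J = {E. cmat J *v E = (- \<i>) *s E}"

definition almost_gc_structure :: "('x, 'n::finite) manifold \<Rightarrow> ('x, 'n) gend \<Rightarrow> bool" where
  "almost_gc_structure X J \<longleftrightarrow> smooth_SO_section X J \<and>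
     (\<forall>c\<in>atlas X. \<forall>p\<in>fst c. J c p ** J c p = - mat 1)"

text \<open>A subbundle \<open>L\<close> is involutive if the sheaf of its smooth local sections is closed under the
  Courant bracket.\<close>

definition section_of ::
    "('x, 'n::finite) manifold \<Rightarrow> 'x set \<Rightarrow> (('x, 'n) chart \<Rightarrow> 'x \<Rightarrow> (complex ^ ('n + 'n)) set) \<Rightarrow> ('x, 'n) gsec \<Rightarrow> bool" where
  "section_of X W L E \<longleftrightarrow> (\<forall>c\<in>atlas X. \<forall>p\<in>fst c \<inter> W. E c p \<in> L c p)"

definition involutive ::
    "('x, 'n::finite) manifold \<Rightarrow> (('x, 'n) chart \<Rightarrow> 'x \<Rightarrow> (complex ^ ('n + 'n)) set) \<Rightarrow> bool" where
  "involutive X L \<longleftrightarrow> (\<forall>W E F. openin (topo X) W \<longrightarrow>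
     smooth_gsec X W E \<longrightarrow> section_of X W L E \<longrightarrow>
     smooth_gsec X W F \<longrightarrow> section_of X W L F \<longrightarrow> section_of X W L (courant E F))"

definition gc_structure :: "('x, 'n::finite) manifold \<Rightarrow> ('x, 'n) gend \<Rightarrow> bool" where
  "gc_structure X J \<longleftrightarrow> almost_gc_structure X J \<and> involutive X (\<lambda>c p. eigenspace_minus_i (J c p))"

definition generalized_metric :: "('x, 'n::finite) manifold \<Rightarrow> ('x, 'n) gend \<Rightarrow> bool" where
  "generalized_metric X G \<longleftrightarrow> smooth_SO_section X G \<and>
     (\<forall>c\<in>atlas X. \<forall>p\<in>fst c. G c p ** G c p = mat 1 \<and> (\<forall>E. E \<noteq> 0 \<longrightarrow> gpair (G c p *v E) E > 0))"

definition generalized_kaehler :: "('x, 'n::finite) manifold \<Rightarrow> ('x, 'n) gend \<Rightarrow> ('x, 'n) gend \<Rightarrow> bool" where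
  "generalized_kaehler X J0 J1 \<longleftrightarrow> gc_structure X J0 \<and> gc_structure X J1 \<and>
     (\<forall>c\<in>atlas X. \<forall>p\<in>fst c. J0 c p ** J1 c p = J1 c p ** J0 c p) \<and>
     generalized_metric X (\<lambda>c p. - (J0 c p ** J1 c p))"


section \<open>Differential forms and pure spinors\<close>

text \<open>A complex form of mixed degree at a point is a function on lists of real tangent vectors: its
  restriction to lists of length \<open>k\<close> is the component of degree \<open>k\<close>, an alternating real-multilinear
  form with complex values.\<close>

type_synonym 'n cform = "(real ^ 'n) list \<Rightarrow> complex"

definition alternating_form :: "'n::finite cform \<Rightarrow> bool" where
  "alternating_form \<phi> \<longleftrightarrow> (\<forall>us ws. linear (\<lambda>v. \<phi> (us @ v # ws))) \<and> (\<forall>vs. \<not> distinct vs \<longrightarrow> \<phi> vs = 0)"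

definition drop_nth :: "nat \<Rightarrow> 'a list \<Rightarrow> 'a list" where
  "drop_nth i vs = take i vs @ drop (Suc i) vs"

text \<open>The action \<open>(v + \<eta>) \<cdot> \<phi> = i\<^sub>v \<phi> + \<eta> \<and> \<phi>\<close> of a complex \<open>v + \<eta>\<close>; the interior product is extended
  complex-linearly in \<open>v\<close>.\<close>

definition clifford :: "complex ^ ('n::finite + 'n) \<Rightarrow> 'n cform \<Rightarrow> 'n cform" where
  "clifford E \<phi> vs =
     \<phi> ((\<chi> i. Re (vpart E $ i)) # vs) + \<i> * \<phi> ((\<chi> i. Im (vpart E $ i)) # vs)
     + (\<Sum>i<length vs. (- 1) ^ i * (\<Sum>j\<in>UNIV. cpart E $ j * complex_of_real (vs ! i $ j)) * \<phi> (drop_nth i vs))"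

definition spinor_ker :: "'n::finite cform \<Rightarrow> (complex ^ ('n + 'n)) set" where
  "spinor_ker \<phi> = {E. \<forall>vs. clifford E \<phi> vs = 0}"

type_synonym ('x, 'n) cform_field = "('x, 'n) chart \<Rightarrow> 'x \<Rightarrow> 'n cform"

definition differential_form :: "('x, 'n::finite) manifold \<Rightarrow> ('x, 'n) cform_field \<Rightarrow> bool" where
  "differential_form X \<psi> \<longleftrightarrow>
     (\<forall>c\<in>atlas X. (\<forall>p\<in>fst c. alternating_form (\<psi> c p)) \<and> (\<forall>vs. smooth_in c UNIV (\<lambda>p. \<psi> c p vs))) \<and>
     (\<forall>c\<in>atlas X. \<forall>c'\<in>atlas X. \<forall>p\<in>fst c \<inter> fst c'. \<forall>vs.
        \<psi> c p vs = \<psi> c' p (map (\<lambda>v. jacobian c c' id p *v v) vs))"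

definition exterior_d :: "('x, 'n::finite) cform_field \<Rightarrow> ('x, 'n) cform_field" where
  "exterior_d \<psi> = (\<lambda>c p vs.
     \<Sum>i<length vs. (- 1) ^ i * cderiv c (\<lambda>q. \<psi> c q (drop_nth i vs)) p (vs ! i))"

definition d_closed :: "('x, 'n::finite) manifold \<Rightarrow> ('x, 'n) cform_field \<Rightarrow> bool" where
  "d_closed X \<psi> \<longleftrightarrow> (\<forall>c\<in>atlas X. \<forall>p\<in>fst c. \<forall>vs. exterior_d \<psi> c p vs = 0)"

definition form_pullback ::
    "('x, 'n::finite) manifold \<Rightarrow> ('y \<Rightarrow> 'x) \<Rightarrow> ('x, 'n) cform_field \<Rightarrow> ('y, 'm::finite) cform_field" where
  "form_pullback X f \<psi> = (\<lambda>c p ws.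
     let c' = chart_at X (f p) in \<psi> c' (f p) (map (\<lambda>w. jacobian c c' f p *v w) ws))"

definition pure_spinor :: "('x, 'n::finite) manifold \<Rightarrow> ('x, 'n) cform_field \<Rightarrow> bool" where
  "pure_spinor X \<psi> \<longleftrightarrow> differential_form X \<psi> \<and>
     (\<forall>c\<in>atlas X. \<forall>p\<in>fst c. vec.dim (spinor_ker (\<psi> c p)) = CARD('n))"

definition nondegenerate_spinor :: "('x, 'n::finite) manifold \<Rightarrow> ('x, 'n) cform_field \<Rightarrow> bool" where
  "nondegenerate_spinor X \<psi> \<longleftrightarrow> (\<forall>c\<in>atlas X. \<forall>p\<in>fst c. let K = spinor_ker (\<psi> c p) in
     K \<inter> cnj_vec ` K = {0} \<and> {E + F | E F. E \<in> K \<and> F \<in> cnj_vec ` K} = UNIV)"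

text \<open>\<open>\<J>\<^sub>\<psi>\<close>; it is uniquely determined at each point, as \<open>\<psi>\<close> is pure and non-degenerate.\<close>

definition spinor_structure :: "('x, 'n::finite) cform_field \<Rightarrow> ('x, 'n) gend" where
  "spinor_structure \<psi> = (\<lambda>c p.
     THE J. J \<in> SO_gen \<and> J ** J = - mat 1 \<and> eigenspace_minus_i J = spinor_ker (\<psi> c p))"

definition generalized_kaehler_one_spinor ::
    "('x, 'n::finite) manifold \<Rightarrow> ('x, 'n) gend \<Rightarrow> ('x, 'n) cform_field \<Rightarrow> bool" where
  "generalized_kaehler_one_spinor X J0 \<psi> \<longleftrightarrow> gc_structure X J0 \<and>
     pure_spinor X \<psi> \<and> nondegenerate_spinor X \<psi> \<and> d_closed X \<psi> \<and>
     generalized_kaehler X J0 (spinor_structure \<psi>)"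


section \<open>The induced structure on a submanifold\<close>

text \<open>For \<open>D\<close> the Jacobian of the inclusion of \<open>M\<close> at a point, \<open>real ^ ('m + 'n)\<close> is the fibre of
  \<open>TM \<oplus> T\<^sup>*X|\<^sub>M\<close>, with its inclusion into \<open>TX \<oplus> T\<^sup>*X|\<^sub>M\<close> and the map \<open>p = id \<oplus> i\<^sub>M\<^sup>*\<close> onto
  \<open>TM \<oplus> T\<^sup>*M\<close>.\<close>

definition restr_incl :: "real ^ 'm::finite ^ 'n::finite \<Rightarrow> real ^ ('m + 'n) \<Rightarrow> real ^ ('n + 'n)" where
  "restr_incl D E = gjoin (D *v vpart E) (cpart E)"

definition restr_proj :: "real ^ 'm::finite ^ 'n::finite \<Rightarrow> real ^ ('m + 'n) \<Rightarrow> real ^ ('m + 'm)" where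
  "restr_proj D E = gjoin (vpart E) (transpose D *v cpart E)"

definition conormal :: "real ^ 'm::finite ^ 'n::finite \<Rightarrow> (real ^ ('n + 'n)) set" where
  "conormal D = restr_incl D ` {E. restr_proj D E = 0}"

definition conormal_invariant ::
    "('y, 'm::finite) manifold \<Rightarrow> ('x, 'n::finite) manifold \<Rightarrow> ('y \<Rightarrow> 'x) \<Rightarrow> ('x, 'n) gend \<Rightarrow> bool" where
  "conormal_invariant M X f J \<longleftrightarrow> (\<forall>c\<in>atlas M. \<forall>c'\<in>atlas X. \<forall>p\<in>fst c. f p \<in> fst c' \<longrightarrow>
     (\<lambda>E. J c' (f p) *v E) ` conormal (jacobian c c' f p) = conormal (jacobian c c' f p))"

text \<open>The endomorphism of \<open>TM \<oplus> T\<^sup>*M\<close> that \<open>J\<close> induces on the quotient by \<open>N\<^sup>*\<close>: it maps \<open>p E\<close> to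
  \<open>p F\<close> whenever \<open>J E = F\<close> in \<open>TM \<oplus> T\<^sup>*X|\<^sub>M\<close>.\<close>

definition induced_structure ::
    "('x, 'n::finite) manifold \<Rightarrow> ('y \<Rightarrow> 'x) \<Rightarrow> ('x, 'n) gend \<Rightarrow> ('y, 'm::finite) gend" where
  "induced_structure X f J = (\<lambda>c p.
     let c' = chart_at X (f p); D = jacobian c c' f p
     in THE K. \<forall>E F. J c' (f p) *v restr_incl D E = restr_incl D F \<longrightarrow>
          K *v restr_proj D E = restr_proj D F)"

end

theory Submission
  imports Defs
begin

text \<open>Apart from smoothness, closedness and integrability, this is linear algebra at one point. Let \<open>D\<close> be the Jacobian of the
  inclusion there and \<open>J\<^sub>1\<close> the structure of \<open>\<psi>\<close>. As \<open>J\<^sub>0\<close> preserves the conormal space \<open>N\<^sup>*\<close>, the generalized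
  metric \<open>G = - J\<^sub>0 J\<^sub>1\<close> maps \<open>N\<^sup>*\<close> to \<open>J\<^sub>1 N\<^sup>*\<close>, and \<open>N\<^sup>* + G N\<^sup>*\<close> is invariant under \<open>J\<^sub>0\<close>, \<open>J\<^sub>1\<close> and \<open>G\<close>. Hence so
  is its orthogonal complement \<open>W\<close>, and positivity of \<open>G\<close> makes \<open>W\<close> a complement of \<open>N\<^sup>*\<close> in \<open>TM \<oplus> T\<^sup>*X\<close>. The
  projection thus identifies \<open>W\<close> isometrically with \<open>TM \<oplus> T\<^sup>*M\<close>, and the two structures on \<open>M\<close> are the
  restrictions of \<open>J\<^sub>0\<close> and \<open>J\<^sub>1\<close> to \<open>W\<close> (\<open>reduced_structures\<close>): they commute and give a generalized metric for
  free. The lift \<open>\<Lambda>\<close> from \<open>TM \<oplus> T\<^sup>*M\<close> to \<open>W\<close> solves a linear system with smooth coefficients, so it and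
  the reduced structures are smooth (\<open>smooth_on_linear_solve\<close>).

  The lift of the \<open>(- \<i>)\<close>-eigenspace of the reduced \<open>J\<^sub>1\<close> lies in the kernel of \<open>\<psi>\<close>, so this eigenspace
  annihilates the pull back of \<open>\<psi>\<close>. It is maximal isotropic, and the kernel of a nonzero form is isotropic
  by the Clifford relation (\<open>spinor_ker_isotropic\<close>); so it is the whole kernel once the pull back is known not
  to vanish. For that, every tangent vector of \<open>X\<close> is the sum of a vector tangent to \<open>M\<close> and of the
  (real) tangent part of an element of the kernel of \<open>\<psi>\<close>. If the pull back vanished, this would allow to replace the
  arguments of \<open>\<psi>\<close> one by one by vectors tangent to \<open>M\<close>, up to values of \<open>\<psi>\<close> in lower degree, and \<open>\<psi>\<close> would
  be zero (\<open>pullback_eq_0_imp\<close>). This gives purity and non-degeneracy; the kernel determines the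
  structure, so the structure of the pull back is the reduced \<open>J\<^sub>1\<close>.

  Closedness of the pull back and involutivity both rest on the symmetry of the second derivatives of the
  inclusion. For involutivity, which is proved in the same way for both structures, the pairing of a
  Courant bracket with a third element involves only the first order jets of the two sections
  (\<open>courant_pair\<close>). The lifts to \<open>W\<close> of two sections on \<open>M\<close> are matched to first order at a point by sections of
  the eigenbundle on \<open>X\<close> (\<open>section_extension\<close>), and under lifting the pairing does not change, because
  the second derivatives cancel (\<open>courant_reduction\<close>). So the bracket on \<open>M\<close> is orthogonal to the
  eigenspace, which equals its own orthogonal.\<close>

section \<open>Calculus of smooth maps\<close>

text \<open>For functions differing outside of \<open>S\<close>; this is what makes the arbitrary values of the inverse of a chart
  outside of its image harmless.\<close>

lemma Ck_on_cong:
  assumes "open S" "\<And>x. x \<in> S \<Longrightarrow> f x = g x" "Ck_on k S f"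
  shows "Ck_on k S g"
  using assms(2,3)
proof (induction k arbitrary: f g)
  case 0
  then show ?case by (simp cong: continuous_on_cong)
next
  case (Suc k)
  have fg: "f x = g x" if "x \<in> S" for x using Suc.prems(1) that by blast
  have eq: "frechet_derivative f (at x) = frechet_derivative g (at x)" "g differentiable at x" if "x \<in> S" for x
  proof -
    have d: "f differentiable at x" using Suc.prems(2) that by simp
    have D: "(f has_derivative frechet_derivative f (at x)) (at x)" using d frechet_derivative_works by blast
    have G: "(g has_derivative frechet_derivative f (at x)) (at x)"
      by (rule has_derivative_transform_within_open[OF D assms(1) that fg])
    show "frechet_derivative f (at x) = frechet_derivative g (at x)" 
      using frechet_derivative_at[OF G] .
    show "g differentiable at x" using G unfolding differentiable_def by blast
  qed
  have "Ck_on k S (\<lambda>x. frechet_derivative g (at x) v)" for v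
  proof (rule Suc.IH)
    show "Ck_on k S (\<lambda>x. frechet_derivative f (at x) v)" using Suc.prems(2) by simp
  qed (simp add: eq)
  then show ?case using eq by simp
qed

lemma Ck_on_SucD: "Ck_on (Suc k) S f \<Longrightarrow> Ck_on k S f"
proof (induction k arbitrary: f)
  case 0
  then show ?case
    by (auto intro!: continuous_at_imp_continuous_on differentiable_imp_continuous_within)
next
  case (Suc k)
  have "Ck_on k S (\<lambda>x. frechet_derivative f (at x) v)" for v
    by (rule Suc.IH) (use Suc.prems in auto)
  then show ?case using Suc.prems by simp
qed

lemma Ck_on_subset: "Ck_on k S f \<Longrightarrow> T \<subseteq> S \<Longrightarrow> Ck_on k T f"
  by (induction k arbitrary: f) (auto intro: continuous_on_subset)

lemma Ck_on_local:
  assumes "\<And>x. x \<in> S \<Longrightarrow> \<exists>T. open T \<and> x \<in> T \<and> Ck_on k T f"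
  shows "Ck_on k S f"
  using assms
proof (induction k arbitrary: f)
  case 0
  have "isCont f x" if "x \<in> S" for x
  proof -
    obtain T where "open T" "x \<in> T" "continuous_on T f" using 0[OF \<open>x \<in> S\<close>] by auto
    then show ?thesis by (simp add: continuous_on_eq_continuous_at)
  qed
  then show ?case by (auto intro: continuous_at_imp_continuous_on)
next
  case (Suc k)
  have "Ck_on k S (\<lambda>x. frechet_derivative f (at x) v)" for v
    by (rule Suc.IH) (use Suc.prems in fastforce)
  moreover have "f differentiable at x" if "x \<in> S" for x
    using Suc.prems[OF that] by auto
  ultimately show ?case by simp
qed

lemma Ck_on_const: "Ck_on k S (\<lambda>x. c)"
  by (induction k arbitrary: c) auto

lemma Ck_on_add:
  assumes "open S" "Ck_on k S f" "Ck_on k S g"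
  shows "Ck_on k S (\<lambda>x. f x + g x)"
  using assms(2,3)
proof (induction k arbitrary: f g)
  case 0
  then show ?case by (simp add: continuous_on_add)
next
  case (Suc k)
  have "Ck_on k S (\<lambda>x. frechet_derivative (\<lambda>x. f x + g x) (at x) v)" for v
  proof (rule Ck_on_cong[OF assms(1)])
    show "Ck_on k S (\<lambda>x. frechet_derivative f (at x) v + frechet_derivative g (at x) v)"
      by (rule Suc.IH) (use Suc.prems in auto)
    fix x assume "x \<in> S"
    then have "(f has_derivative frechet_derivative f (at x)) (at x)"
      "(g has_derivative frechet_derivative g (at x)) (at x)"
      using Suc.prems by (auto intro: frechet_derivative_works[THEN iffD1])
    then have "((\<lambda>x. f x + g x) has_derivative (\<lambda>v. frechet_derivative f (at x) v + frechet_derivative g (at x) v)) (at x)"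
      by (rule has_derivative_add)
    from frechet_derivative_at[OF this]
    show "frechet_derivative f (at x) v + frechet_derivative g (at x) v = frechet_derivative (\<lambda>x. f x + g x) (at x) v"
      by (metis (no_types, lifting))
  qed
  then show ?case using Suc.prems by (auto intro: differentiable_add)
qed

text \<open>Leibniz rule: the derivative is again a sum of two products of the same form, so the induction on
  the order closes up for all bilinear products at once.\<close>

lemma Ck_on_bilinear:
  assumes "open S" "bounded_bilinear B" "Ck_on k S f" "Ck_on k S g"
  shows "Ck_on k S (\<lambda>x. B (f x) (g x))"
  using assms(3,4)
proof (induction k arbitrary: f g)
  case 0
  then show ?case by (simp add: bounded_bilinear.continuous_on[OF assms(2)])
next
  case (Suc k)
  have D: "((\<lambda>x. B (f x) (g x)) has_derivative
        (\<lambda>v. B (f x) (frechet_derivative g (at x) v) + B (frechet_derivative f (at x) v) (g x))) (at x)"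
    if "x \<in> S" for x
  proof -
    have "(f has_derivative frechet_derivative f (at x)) (at x)"
      "(g has_derivative frechet_derivative g (at x)) (at x)"
      using Suc.prems that by (auto intro: frechet_derivative_works[THEN iffD1])
    then show ?thesis by (rule bounded_bilinear.FDERIV[OF assms(2)])
  qed
  have "Ck_on k S (\<lambda>x. frechet_derivative (\<lambda>x. B (f x) (g x)) (at x) v)" for v
  proof (rule Ck_on_cong[OF assms(1)])
    show "Ck_on k S (\<lambda>x. B (f x) (frechet_derivative g (at x) v) + B (frechet_derivative f (at x) v) (g x))"
      by (rule Ck_on_add[OF assms(1)]; rule Suc.IH) (use Suc.prems Ck_on_SucD in auto)
    fix x assume "x \<in> S"
    from frechet_derivative_at[OF D[OF this]]
    show "B (f x) (frechet_derivative g (at x) v) + B (frechet_derivative f (at x) v) (g x)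
        = frechet_derivative (\<lambda>x. B (f x) (g x)) (at x) v"
      by (metis (no_types, lifting))
  qed
  then show ?case using D by (auto simp: differentiable_def)
qed

lemma Ck_on_linear:
  assumes "open S" "bounded_linear L" "Ck_on k S f"
  shows "Ck_on k S (\<lambda>x. L (f x))"
proof -
  have "bounded_bilinear (\<lambda>(r::real) v. r *\<^sub>R L v)"
    using bounded_bilinear.comp[OF bounded_bilinear_scaleR bounded_linear_ident assms(2)] by simp
  from Ck_on_bilinear[OF assms(1) this Ck_on_const[of k S "1::real"] assms(3)] show ?thesis by simp
qed

lemma Ck_on_sum:
  assumes "open S" "\<And>i. i \<in> I \<Longrightarrow> Ck_on k S (f i)"
  shows "Ck_on k S (\<lambda>x. \<Sum>i\<in>I. f i x)"
proof (cases "finite I")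
  case True
  then show ?thesis using assms(2)
    by (induction I) (simp_all add: Ck_on_const Ck_on_add[OF assms(1)])
qed (simp add: Ck_on_const)

text \<open>The chain rule writes the derivative as a composition, for which the induction hypothesis needs a
  fixed direction; expanding the inner derivative in a basis provides one.\<close>

lemma Ck_on_compose:
  fixes f :: "'a::euclidean_space \<Rightarrow> 'b::euclidean_space"
  assumes "open S" "open T" "f ` S \<subseteq> T" "Ck_on k T g" "Ck_on k S f"
  shows "Ck_on k S (\<lambda>x. g (f x))"
  using assms(4,5)
proof (induction k arbitrary: g)
  case 0
  then show ?case using assms(3) by (auto intro: continuous_on_compose2)
next
  case (Suc k)
  have f: "(f has_derivative frechet_derivative f (at x)) (at x)" if "x \<in> S" for x
    using that Suc.prems(2) by (auto intro: frechet_derivative_works[THEN iffD1])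
  have g: "(g has_derivative frechet_derivative g (at (f x))) (at (f x))" if "x \<in> S" for x
    using that Suc.prems(1) assms(3) by (auto intro: frechet_derivative_works[THEN iffD1])
  have D: "((\<lambda>x. g (f x)) has_derivative (\<lambda>v. frechet_derivative g (at (f x)) (frechet_derivative f (at x) v))) (at x)"
    if "x \<in> S" for x
    using diff_chain_at[OF f g] that by (simp add: o_def)
  have "Ck_on k S (\<lambda>x. frechet_derivative (\<lambda>x. g (f x)) (at x) v)" for v
  proof (rule Ck_on_cong[OF assms(1)])
    have "Ck_on k S (\<lambda>x. frechet_derivative g (at (f x)) b)" for b
      by (rule Suc.IH[of "\<lambda>y. frechet_derivative g (at y) b"]) (use Suc.prems Ck_on_SucD in auto)
    moreover have "Ck_on k S (\<lambda>x. frechet_derivative f (at x) v \<bullet> b)" for b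
      by (rule Ck_on_linear[OF assms(1) bounded_linear_inner_left]) (use Suc.prems in auto)
    ultimately show "Ck_on k S (\<lambda>x. \<Sum>b\<in>Basis. (frechet_derivative f (at x) v \<bullet> b) *\<^sub>R frechet_derivative g (at (f x)) b)"
      by (intro Ck_on_sum[OF assms(1)] Ck_on_bilinear[OF assms(1) bounded_bilinear_scaleR])
    fix x assume x: "x \<in> S"
    have lin: "linear (frechet_derivative g (at (f x)))"
      using g[OF x] has_derivative_linear by blast
    have "(\<Sum>b\<in>Basis. (frechet_derivative f (at x) v \<bullet> b) *\<^sub>R frechet_derivative g (at (f x)) b)
      = frechet_derivative g (at (f x)) (frechet_derivative f (at x) v)"
      by (simp add: linear_sum[OF lin, symmetric] linear_scale[OF lin, symmetric] euclidean_representation)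
    also have "\<dots> = frechet_derivative (\<lambda>x. g (f x)) (at x) v"
      using frechet_derivative_at[OF D[OF x]] by metis
    finally show "(\<Sum>b\<in>Basis. (frechet_derivative f (at x) v \<bullet> b) *\<^sub>R frechet_derivative g (at (f x)) b)
      = frechet_derivative (\<lambda>x. g (f x)) (at x) v" .
  qed
  then show ?case using D by (auto simp: differentiable_def)
qed

lemma Ck_on_inverse:
  fixes f :: "'a::euclidean_space \<Rightarrow> 'b::real_normed_field"
  assumes "open S" "\<And>x. x \<in> S \<Longrightarrow> f x \<noteq> 0" "Ck_on k S f"
  shows "Ck_on k S (\<lambda>x. inverse (f x))"
  using assms(3)
proof (induction k)
  case 0
  then show ?case using assms(2) by (auto intro: continuous_on_inverse)
next
  case (Suc k)
  have D: "((\<lambda>x. inverse (f x)) has_derivative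
        (\<lambda>v. - (inverse (f x) * frechet_derivative f (at x) v * inverse (f x)))) (at x)"
    if "x \<in> S" for x
    by (rule Deriv.has_derivative_inverse, rule assms(2)[OF that])
      (use that Suc.prems in \<open>auto intro: frechet_derivative_works[THEN iffD1]\<close>)
  have "Ck_on k S (\<lambda>x. frechet_derivative (\<lambda>x. inverse (f x)) (at x) v)" for v
  proof (rule Ck_on_cong[OF assms(1)])
    show "Ck_on k S (\<lambda>x. - (inverse (f x) * frechet_derivative f (at x) v * inverse (f x)))"
      by (intro Ck_on_linear[OF assms(1) bounded_linear_minus[OF bounded_linear_ident]]
          Ck_on_bilinear[OF assms(1) bounded_bilinear_mult] Suc.IH Ck_on_SucD[OF Suc.prems])
        (use Suc.prems in auto)
    fix x assume "x \<in> S"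
    from frechet_derivative_at[OF D[OF this]]
    show "- (inverse (f x) * frechet_derivative f (at x) v * inverse (f x))
        = frechet_derivative (\<lambda>x. inverse (f x)) (at x) v"
      by metis
  qed
  then show ?case using D by (auto simp: differentiable_def)
qed

lemma smooth_on_cong: "open S \<Longrightarrow> (\<And>x. x \<in> S \<Longrightarrow> f x = g x) \<Longrightarrow> smooth_on S f \<Longrightarrow> smooth_on S g"
  unfolding smooth_on_def using Ck_on_cong by blast

lemma smooth_on_subset: "smooth_on S f \<Longrightarrow> T \<subseteq> S \<Longrightarrow> smooth_on T f"
  unfolding smooth_on_def using Ck_on_subset by blast

lemma smooth_on_local:
  "(\<And>x. x \<in> S \<Longrightarrow> \<exists>T. open T \<and> x \<in> T \<and> smooth_on T f) \<Longrightarrow> smooth_on S f"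
  unfolding smooth_on_def using Ck_on_local by metis

lemma smooth_on_const: "smooth_on S (\<lambda>x. c)"
  unfolding smooth_on_def by (simp add: Ck_on_const)

lemma smooth_on_add: "open S \<Longrightarrow> smooth_on S f \<Longrightarrow> smooth_on S g \<Longrightarrow> smooth_on S (\<lambda>x. f x + g x)"
  unfolding smooth_on_def by (simp add: Ck_on_add)

lemma smooth_on_bilinear:
  "open S \<Longrightarrow> bounded_bilinear B \<Longrightarrow> smooth_on S f \<Longrightarrow> smooth_on S g \<Longrightarrow> smooth_on S (\<lambda>x. B (f x) (g x))"
  unfolding smooth_on_def by (simp add: Ck_on_bilinear)

lemma smooth_on_linear:
  "open S \<Longrightarrow> bounded_linear L \<Longrightarrow> smooth_on S f \<Longrightarrow> smooth_on S (\<lambda>x. L (f x))"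
  unfolding smooth_on_def by (simp add: Ck_on_linear)

lemma smooth_on_sum: "open S \<Longrightarrow> (\<And>i. i \<in> I \<Longrightarrow> smooth_on S (f i)) \<Longrightarrow> smooth_on S (\<lambda>x. \<Sum>i\<in>I. f i x)"
  unfolding smooth_on_def by (simp add: Ck_on_sum)

lemma smooth_on_compose:
  fixes f :: "'a::euclidean_space \<Rightarrow> 'b::euclidean_space"
  shows "open S \<Longrightarrow> open T \<Longrightarrow> f ` S \<subseteq> T \<Longrightarrow> smooth_on T g \<Longrightarrow> smooth_on S f \<Longrightarrow> smooth_on S (\<lambda>x. g (f x))"
  unfolding smooth_on_def by (simp add: Ck_on_compose)

lemma smooth_on_inverse:
  fixes f :: "'a::euclidean_space \<Rightarrow> 'b::real_normed_field"
  shows "open S \<Longrightarrow> (\<And>x. x \<in> S \<Longrightarrow> f x \<noteq> 0) \<Longrightarrow> smooth_on S f \<Longrightarrow> smooth_on S (\<lambda>x. inverse (f x))"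
  unfolding smooth_on_def by (simp add: Ck_on_inverse)

lemma smooth_on_mult:
  fixes f :: "'a::euclidean_space \<Rightarrow> 'b::real_normed_algebra"
  shows "open S \<Longrightarrow> smooth_on S f \<Longrightarrow> smooth_on S g \<Longrightarrow> smooth_on S (\<lambda>x. f x * g x)"
  by (rule smooth_on_bilinear[OF _ bounded_bilinear_mult])

lemma smooth_on_prod:
  fixes f :: "'i \<Rightarrow> 'a::euclidean_space \<Rightarrow> 'b::{real_normed_algebra,comm_monoid_mult}"
  assumes "open S" "\<And>i. i \<in> I \<Longrightarrow> smooth_on S (f i)"
  shows "smooth_on S (\<lambda>x. \<Prod>i\<in>I. f i x)"
proof (cases "finite I")
  case True
  then show ?thesis using assms(2)
    by (induction I) (simp_all add: smooth_on_const smooth_on_mult assms(1))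
qed (simp add: smooth_on_const)

lemma smooth_on_ident: "smooth_on S (\<lambda>x. x)"
proof -
  have "Ck_on k S (\<lambda>x. x)" for k by (cases k) (auto simp: frechet_derivative_ident Ck_on_const)
  then show ?thesis by (simp add: smooth_on_def)
qed

lemma smooth_on_has_derivative:
  "smooth_on S f \<Longrightarrow> x \<in> S \<Longrightarrow> (f has_derivative frechet_derivative f (at x)) (at x)"
  unfolding smooth_on_def
  by (drule spec[of _ "Suc 0"]) (simp add: frechet_derivative_works[symmetric])

lemma smooth_on_frechet_derivative:
  "smooth_on S f \<Longrightarrow> smooth_on S (\<lambda>x. frechet_derivative f (at x) v)"
  unfolding smooth_on_def
proof
  fix k assume "\<forall>k. Ck_on k S f"
  then have "Ck_on (Suc k) S f" by blast
  then show "Ck_on k S (\<lambda>x. frechet_derivative f (at x) v)" by simp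
qed

lemma smooth_on_continuous: "smooth_on S f \<Longrightarrow> continuous_on S f"
  unfolding smooth_on_def by (drule spec[of _ 0]) simp

lemma smooth_on_vec_nth:
  fixes f :: "'a::euclidean_space \<Rightarrow> 'b::real_normed_vector ^ 'n"
  shows "open S \<Longrightarrow> smooth_on S f \<Longrightarrow> smooth_on S (\<lambda>x. f x $ i)"
  by (rule smooth_on_linear[OF _ bounded_linear_vec_nth])

lemma bounded_linear_axis: "bounded_linear (axis i :: 'b::real_normed_vector \<Rightarrow> 'b ^ 'n)"
proof (rule bounded_linear_intro[where K=1])
  fix x :: 'b
  have "norm (axis i x $ j) = (if j = i then norm x else 0)" for j by (simp add: axis_def)
  then show "norm (axis i x :: 'b ^ 'n) \<le> norm x * 1"
    by (simp add: norm_vec_def L2_set_def if_distrib[of "\<lambda>z. z\<^sup>2"] cong: if_cong)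
qed (auto simp: vec_eq_iff axis_def)

lemma smooth_on_vec_lambda:
  fixes f :: "'a::euclidean_space \<Rightarrow> 'n::finite \<Rightarrow> 'b::real_normed_vector"
  assumes "open S" "\<And>i. smooth_on S (\<lambda>x. f x i)"
  shows "smooth_on S (\<lambda>x. \<chi> i. f x i)"
proof -
  have "(\<chi> i. f x i) = (\<Sum>i\<in>UNIV. axis i (f x i))" for x
    by (simp add: vec_eq_iff axis_def)
  then show ?thesis
    using smooth_on_sum[OF assms(1) smooth_on_linear[OF assms(1) bounded_linear_axis assms(2)]] by simp
qed

lemma smooth_on_det:
  fixes A :: "'a::euclidean_space \<Rightarrow> real ^ 'n::finite ^ 'n"
  assumes "open S" "smooth_on S A"
  shows "smooth_on S (\<lambda>x. det (A x))"
  unfolding det_def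
  by (intro smooth_on_sum smooth_on_mult smooth_on_prod smooth_on_const smooth_on_vec_nth assms)

lemma smooth_on_matrix_vector_mult:
  fixes A :: "'a::euclidean_space \<Rightarrow> ('b::real_normed_algebra_1) ^ 'm::finite ^ 'n::finite"
  assumes "open S" "smooth_on S A" "smooth_on S y"
  shows "smooth_on S (\<lambda>x. A x *v y x)"
  unfolding matrix_vector_mult_def
  by (intro smooth_on_vec_lambda smooth_on_sum smooth_on_mult smooth_on_vec_nth assms)

lemma smooth_on_matrix_mult:
  fixes A :: "'a::euclidean_space \<Rightarrow> real ^ 'm::finite ^ 'n::finite"
  assumes "open S" "smooth_on S A" "smooth_on S B"
  shows "smooth_on S (\<lambda>x. A x ** B x)"
  unfolding matrix_matrix_mult_def
  by (intro smooth_on_vec_lambda smooth_on_sum smooth_on_mult smooth_on_vec_nth assms)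

lemma smooth_on_transpose:
  fixes A :: "'a::euclidean_space \<Rightarrow> real ^ 'm::finite ^ 'n::finite"
  assumes "open S" "smooth_on S A"
  shows "smooth_on S (\<lambda>x. transpose (A x))"
  unfolding transpose_def
  by (intro smooth_on_vec_lambda smooth_on_vec_nth assms)

lemma smooth_on_cmat:
  fixes A :: "'a::euclidean_space \<Rightarrow> real ^ 'm::finite ^ 'n::finite"
  assumes "open S" "smooth_on S A"
  shows "smooth_on S (\<lambda>x. cmat (A x))"
  unfolding map_matrix_def
  by (intro smooth_on_vec_lambda smooth_on_linear[OF _ bounded_linear_of_real] smooth_on_vec_nth assms)

text \<open>By Cramer's rule.\<close>

lemma smooth_on_linear_solve_square:
  fixes A :: "'a::euclidean_space \<Rightarrow> real ^ 'n::finite ^ 'n"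
  assumes S: "open S" and A: "smooth_on S A" and b: "smooth_on S b"
    and inj: "\<And>x. x \<in> S \<Longrightarrow> inj ((*v) (A x))" and eq: "\<And>x. x \<in> S \<Longrightarrow> A x *v y x = b x"
  shows "smooth_on S y"
proof (rule smooth_on_cong[OF S])
  have d: "det (A x) \<noteq> 0" if "x \<in> S" for x
    using inj[OF that] by (simp add: invertible_det_nz[symmetric] invertible_left_inverse matrix_left_invertible_injective)
  show "smooth_on S (\<lambda>x. \<chi> k. det (\<chi> i j. if j = k then b x $ i else A x $ i $ j) * inverse (det (A x)))"
    apply (intro smooth_on_vec_lambda S smooth_on_mult smooth_on_det smooth_on_inverse A d)
    subgoal for k i j by (cases "j = k") (simp_all add: smooth_on_vec_nth S A b)
    by assumption
  show "(\<chi> k. det (\<chi> i j. if j = k then b x $ i else A x $ i $ j) * inverse (det (A x))) = y x" if "x \<in> S" for x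
    using cramer[OF d[OF that], of "y x" "b x"] eq[OF that] by (simp add: divide_inverse)
qed

text \<open>Pass to the normal equations. All implicitly defined objects below (lifts, reduced structures, inverse
  Jacobians) get their smoothness from this lemma.\<close>

lemma smooth_on_linear_solve:
  fixes A :: "'a::euclidean_space \<Rightarrow> real ^ 'k::finite ^ 'n::finite"
  assumes S: "open S" and A: "smooth_on S A" and b: "smooth_on S b"
    and inj: "\<And>x. x \<in> S \<Longrightarrow> inj ((*v) (A x))" and eq: "\<And>x. x \<in> S \<Longrightarrow> A x *v y x = b x"
  shows "smooth_on S y"
proof (rule smooth_on_linear_solve_square[OF S])
  show "smooth_on S (\<lambda>x. transpose (A x) ** A x)" "smooth_on S (\<lambda>x. transpose (A x) *v b x)"
    by (intro smooth_on_matrix_mult smooth_on_matrix_vector_mult smooth_on_transpose S A b)+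
  fix x assume x: "x \<in> S"
  show "(transpose (A x) ** A x) *v y x = transpose (A x) *v b x"
    by (simp add: eq[OF x] matrix_vector_mul_assoc[symmetric])
  have "v = 0" if "(transpose (A x) ** A x) *v v = 0" for v
  proof -
    have "(A x *v v) \<bullet> (A x *v v) = v \<bullet> ((transpose (A x) ** A x) *v v)"
      by (simp add: matrix_vector_mul_assoc[symmetric] dot_lmul_matrix[symmetric] inner_commute)
    then have "A x *v v = 0" using that by simp
    then show ?thesis using inj[OF x] by (metis injD matrix_vector_mult_0_right)
  qed
  then show "inj ((*v) (transpose (A x) ** A x))"
    by (simp add: linear_injective_0)
qed

text \<open>Two applications of the mean value theorem. The left-hand side is symmetric in \<open>a\<close> and \<open>b\<close>, which gives
  the symmetry of second derivatives in the limit \<open>h \<rightarrow> 0\<close>.\<close>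

lemma second_difference_mean_value:
  fixes g :: "'a::euclidean_space \<Rightarrow> real"
  assumes "convex S" "open S" "smooth_on S g" "h > 0"
    "\<And>s t. 0 \<le> s \<Longrightarrow> s \<le> h \<Longrightarrow> 0 \<le> t \<Longrightarrow> t \<le> h \<Longrightarrow> x + s *\<^sub>R a + t *\<^sub>R b \<in> S"
  obtains s t where "0 \<le> s" "s \<le> h" "0 \<le> t" "t \<le> h"
    "g (x + h *\<^sub>R a + h *\<^sub>R b) - g (x + h *\<^sub>R a) - g (x + h *\<^sub>R b) + g x
      = h * h * frechet_derivative (\<lambda>z. frechet_derivative g (at z) a) (at (x + s *\<^sub>R a + t *\<^sub>R b)) b"
proof -
  define g1 where "g1 z = frechet_derivative g (at z) a" for z
  have g1: "smooth_on S g1" unfolding g1_def by (rule smooth_on_frechet_derivative) fact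
  have D: "((\<lambda>r. G (y + r *\<^sub>R c)) has_real_derivative frechet_derivative G (at (y + r *\<^sub>R c)) c) (at r)"
    if "smooth_on S G" "y + r *\<^sub>R c \<in> S" for G :: "'a \<Rightarrow> real" and y c r
  proof -
    have "((\<lambda>r. y + r *\<^sub>R c) has_derivative (\<lambda>r. r *\<^sub>R c)) (at r)" by (auto intro!: derivative_eq_intros)
    from diff_chain_at[OF this smooth_on_has_derivative[OF that]]
    have *: "((\<lambda>r. G (y + r *\<^sub>R c)) has_derivative (\<lambda>q. frechet_derivative G (at (y + r *\<^sub>R c)) (q *\<^sub>R c))) (at r)"
      by (simp add: o_def)
    have "linear (frechet_derivative G (at (y + r *\<^sub>R c)))"
      using smooth_on_has_derivative[OF that] has_derivative_linear by blast
    then have "(\<lambda>q. frechet_derivative G (at (y + r *\<^sub>R c)) (q *\<^sub>R c)) = (*) (frechet_derivative G (at (y + r *\<^sub>R c)) c)"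
      by (simp add: linear_scale mult.commute fun_eq_iff)
    then show ?thesis using * unfolding has_field_derivative_def by simp
  qed
  define F where "F s = g ((x + h *\<^sub>R b) + s *\<^sub>R a) - g (x + s *\<^sub>R a)" for s
  have mem: "(x + h *\<^sub>R b) + s *\<^sub>R a \<in> S" "x + s *\<^sub>R a \<in> S" if "0 \<le> s" "s \<le> h" for s
    using assms(5)[of s h] assms(5)[of s 0] that assms(4) by (auto simp: algebra_simps)
  have "\<exists>s. 0 < s \<and> s < h \<and> F h - F 0 = (h - 0) * (g1 ((x + h *\<^sub>R b) + s *\<^sub>R a) - g1 (x + s *\<^sub>R a))"
    by (rule MVT2[OF assms(4)]) (auto simp: F_def g1_def intro!: DERIV_diff D assms mem)
  then obtain s where s: "0 < s" "s < h" "F h - F 0 = h * (g1 ((x + h *\<^sub>R b) + s *\<^sub>R a) - g1 (x + s *\<^sub>R a))"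
    by auto
  have "\<exists>t. 0 < t \<and> t < h \<and> g1 ((x + s *\<^sub>R a) + h *\<^sub>R b) - g1 ((x + s *\<^sub>R a) + 0 *\<^sub>R b)
     = (h - 0) * frechet_derivative g1 (at ((x + s *\<^sub>R a) + t *\<^sub>R b)) b"
    using s by (intro MVT2[OF assms(4), of "\<lambda>t. g1 ((x + s *\<^sub>R a) + t *\<^sub>R b)"] D g1) (use assms(5)[of s] s in auto)
  then obtain t where t: "0 < t" "t < h" "g1 ((x + s *\<^sub>R a) + h *\<^sub>R b) - g1 (x + s *\<^sub>R a)
     = h * frechet_derivative g1 (at ((x + s *\<^sub>R a) + t *\<^sub>R b)) b" by auto
  show ?thesis
  proof (rule that[of s t])
    have "g (x + h *\<^sub>R a + h *\<^sub>R b) - g (x + h *\<^sub>R a) - g (x + h *\<^sub>R b) + g x = F h - F 0"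
      by (simp add: F_def algebra_simps)
    also have "\<dots> = h * (g1 ((x + s *\<^sub>R a) + h *\<^sub>R b) - g1 (x + s *\<^sub>R a))"
      using s by (simp add: algebra_simps)
    also have "\<dots> = h * h * frechet_derivative g1 (at (x + s *\<^sub>R a + t *\<^sub>R b)) b"
      using t by simp
    finally show "g (x + h *\<^sub>R a + h *\<^sub>R b) - g (x + h *\<^sub>R a) - g (x + h *\<^sub>R b) + g x
      = h * h * frechet_derivative (\<lambda>z. frechet_derivative g (at z) a) (at (x + s *\<^sub>R a + t *\<^sub>R b)) b"
      unfolding g1_def .
  qed (use s t in auto)
qed

lemma symmetric_second_derivative_real:
  fixes g :: "'a::euclidean_space \<Rightarrow> real"
  assumes "open S" "smooth_on S g" "x \<in> S"
  shows "frechet_derivative (\<lambda>z. frechet_derivative g (at z) a) (at x) b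
       = frechet_derivative (\<lambda>z. frechet_derivative g (at z) b) (at x) a"
proof -
  define P where "P a b z = frechet_derivative (\<lambda>z. frechet_derivative g (at z) a) (at z) b" for a b z
  have Pc: "isCont (P a b) x" for a b
    using smooth_on_continuous[OF smooth_on_frechet_derivative[OF smooth_on_frechet_derivative[OF assms(2)]]] assms(1,3)
    unfolding P_def continuous_on_eq_continuous_at[OF assms(1)] by blast
  obtain r where r: "r > 0" "ball x r \<subseteq> S" using assms openE by blast
  have "\<bar>P a b x - P b a x\<bar> < e + e" if "e > 0" for e
  proof -
    obtain d where d: "d > 0" "\<And>z. dist z x < d \<Longrightarrow> dist (P a b z) (P a b x) < e \<and> dist (P b a z) (P b a x) < e"
    proof -
      have "eventually (\<lambda>z. dist (P a b z) (P a b x) < e) (nhds x)" "eventually (\<lambda>z. dist (P b a z) (P b a x) < e) (nhds x)"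
        using Pc[of a b] Pc[of b a] tendstoD[OF _ \<open>e > 0\<close>] by (simp_all add: continuous_at tendsto_at_iff_tendsto_nhds)
      then have "eventually (\<lambda>z. dist (P a b z) (P a b x) < e \<and> dist (P b a z) (P b a x) < e) (nhds x)"
        by (rule eventually_conj)
      then show thesis using that unfolding eventually_nhds_metric by blast
    qed
    \<comment> \<open>the parallelogram spanned by \<open>h a\<close> and \<open>h b\<close> at \<open>x\<close> has to stay in both balls\<close>
    define h where "h = min d r / (norm a + norm b + 1) / 2"
    have h: "h > 0" unfolding h_def using d r by (intro divide_pos_pos add_nonneg_pos) auto
    have near: "dist (x + s *\<^sub>R a + t *\<^sub>R b) x < min d r" if "0 \<le> s" "s \<le> h" "0 \<le> t" "t \<le> h" for s t
    proof -
      have "dist (x + s *\<^sub>R a + t *\<^sub>R b) x \<le> s * norm a + t * norm b"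
        using norm_triangle_ineq[of "s *\<^sub>R a" "t *\<^sub>R b"] that by (simp add: dist_norm)
      also have "\<dots> \<le> h * norm a + h * norm b" using that by (intro add_mono mult_right_mono) auto
      also have "\<dots> \<le> h * (norm a + norm b + 1)" using h by (simp add: algebra_simps)
      also have "\<dots> = min d r / 2"
      proof -
        have "norm a + norm b + 1 \<noteq> 0" using norm_ge_zero[of a] norm_ge_zero[of b] by linarith
        then have "q / (norm a + norm b + 1) / 2 * (norm a + norm b + 1) = q / 2" for q by (simp add: divide_simps)
        then show ?thesis unfolding h_def .
      qed
      also have "\<dots> < min d r" using d(1) r(1) by (simp add: min_def)
      finally show ?thesis .
    qed
    have in1: "x + s *\<^sub>R a + t *\<^sub>R b \<in> ball x r" if "0 \<le> s" "s \<le> h" "0 \<le> t" "t \<le> h" for s t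
      using near[OF that] by (simp add: dist_commute)
    have in2: "x + s *\<^sub>R b + t *\<^sub>R a \<in> ball x r" if "0 \<le> s" "s \<le> h" "0 \<le> t" "t \<le> h" for s t
      using in1[of t s] that by (simp add: add.assoc add.commute[of "t *\<^sub>R a"])
    have sm: "smooth_on (ball x r) g" using assms(2) r(2) smooth_on_subset by blast
    obtain s t where st: "0 \<le> s" "s \<le> h" "0 \<le> t" "t \<le> h"
      "g (x + h *\<^sub>R a + h *\<^sub>R b) - g (x + h *\<^sub>R a) - g (x + h *\<^sub>R b) + g x = h * h * P a b (x + s *\<^sub>R a + t *\<^sub>R b)"
      unfolding P_def
      by (rule second_difference_mean_value[OF convex_ball open_ball sm h, of x a b]) (use in1 in auto)
    obtain s' t' where st': "0 \<le> s'" "s' \<le> h" "0 \<le> t'" "t' \<le> h"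
      "g (x + h *\<^sub>R b + h *\<^sub>R a) - g (x + h *\<^sub>R b) - g (x + h *\<^sub>R a) + g x = h * h * P b a (x + s' *\<^sub>R b + t' *\<^sub>R a)"
      unfolding P_def
      by (rule second_difference_mean_value[OF convex_ball open_ball sm h, of x b a])
        (use in2 in auto)
    have "h * h * P a b (x + s *\<^sub>R a + t *\<^sub>R b) = h * h * P b a (x + t' *\<^sub>R a + s' *\<^sub>R b)"
      using st(5) st'(5) by (simp add: algebra_simps)
    then have eq: "P a b (x + s *\<^sub>R a + t *\<^sub>R b) = P b a (x + t' *\<^sub>R a + s' *\<^sub>R b)" using h by simp
    have "dist (P a b (x + s *\<^sub>R a + t *\<^sub>R b)) (P a b x) < e"
      using d(2) near st(1-4) by auto
    moreover have "dist (P b a (x + t' *\<^sub>R a + s' *\<^sub>R b)) (P b a x) < e"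
      using d(2) near st'(1-4) by auto
    ultimately show ?thesis unfolding eq dist_real_def by linarith
  qed
  from this[of "\<bar>P a b x - P b a x\<bar> / 2"] have "P a b x = P b a x" by fastforce
  then show ?thesis by (simp add: P_def)
qed

lemma symmetric_second_derivative:
  fixes g :: "'a::euclidean_space \<Rightarrow> 'b::euclidean_space"
  assumes S: "open S" and g: "smooth_on S g" and x: "x \<in> S"
  shows "frechet_derivative (\<lambda>z. frechet_derivative g (at z) a) (at x) b
       = frechet_derivative (\<lambda>z. frechet_derivative g (at z) b) (at x) a"
proof (rule euclidean_eqI)
  fix i :: 'b assume "i \<in> Basis"
  have D: "frechet_derivative (\<lambda>z. G z \<bullet> i) (at z) c = frechet_derivative G (at z) c \<bullet> i"
    if "smooth_on S G" "z \<in> S" for G :: "'a \<Rightarrow> 'b" and z c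
    using frechet_derivative_at[OF has_derivative_inner_left[OF smooth_on_has_derivative[OF that], of i]] by metis
  have gi: "smooth_on S (\<lambda>z. g z \<bullet> i)" by (rule smooth_on_linear[OF S bounded_linear_inner_left g])
  have DD: "frechet_derivative (\<lambda>z. frechet_derivative g (at z) a) (at x) b \<bullet> i
     = frechet_derivative (\<lambda>z. frechet_derivative (\<lambda>z. g z \<bullet> i) (at z) a) (at x) b" for a b
  proof -
    have s: "smooth_on S (\<lambda>z. frechet_derivative g (at z) a)" by (rule smooth_on_frechet_derivative[OF g])
    have "((\<lambda>z. frechet_derivative g (at z) a \<bullet> i) has_derivative (\<lambda>b. frechet_derivative (\<lambda>z. frechet_derivative g (at z) a) (at x) b \<bullet> i)) (at x)"
      by (rule has_derivative_inner_left[OF smooth_on_has_derivative[OF s x]])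
    then have "((\<lambda>z. frechet_derivative (\<lambda>z. g z \<bullet> i) (at z) a) has_derivative (\<lambda>b. frechet_derivative (\<lambda>z. frechet_derivative g (at z) a) (at x) b \<bullet> i)) (at x)"
      by (rule has_derivative_transform_within_open[OF _ S x]) (simp add: D[OF g])
    from frechet_derivative_at[OF this] show ?thesis by metis
  qed
  show "frechet_derivative (\<lambda>z. frechet_derivative g (at z) a) (at x) b \<bullet> i
    = frechet_derivative (\<lambda>z. frechet_derivative g (at z) b) (at x) a \<bullet> i"
    unfolding DD by (rule symmetric_second_derivative_real[OF S gi x])
qed

section \<open>Generalized tangent vectors\<close>

text \<open>Pull backs of covectors are to stay products with a transposed matrix.\<close>

declare transpose_matrix_vector [simp del]

lemma matrix_neg_vector_mult [simp]: "(- A) *v x = - (A *v x)" for A :: "'a::comm_ring_1 ^ 'n::finite ^ 'm::finite"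
  by (simp add: matrix_vector_mult_def vec_eq_iff sum_negf)

lemma matrix_vector_mult_neg [simp]: "A *v (- x) = - (A *v x)" for A :: "'a::comm_ring_1 ^ 'n::finite ^ 'm::finite"
  by (simp add: matrix_vector_mult_def vec_eq_iff sum_negf)

lemma vpart_gjoin [simp]: "vpart (gjoin v \<eta>) = v"
  by (simp add: vpart_def gjoin_def)

lemma cpart_gjoin [simp]: "cpart (gjoin v \<eta>) = \<eta>"
  by (simp add: cpart_def gjoin_def)

lemma gjoin_vpart_cpart [simp]: "gjoin (vpart E) (cpart E) = E"
proof -
  have "gjoin (vpart E) (cpart E) $ k = E $ k" for k
    by (cases k) (simp_all add: gjoin_def vpart_def cpart_def)
  then show ?thesis by (simp add: vec_eq_iff)
qed

lemma gvec_eq_iff: "E = F \<longleftrightarrow> vpart E = vpart F \<and> cpart E = cpart F"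
  by (metis gjoin_vpart_cpart)

lemma vpart_cpart_simps [simp]:
  fixes E :: "'a::ab_group_add ^ ('m::finite + 'n::finite)" and H :: "'b::real_vector ^ ('m + 'n)" and K :: "'d::times ^ ('m + 'n)"
  shows "vpart (0 :: 'c::zero ^ ('m + 'n)) = 0" "cpart (0 :: 'c ^ ('m + 'n)) = 0"
    "vpart (E + F) = vpart E + vpart F" "cpart (E + F) = cpart E + cpart F"
    "vpart (E - F) = vpart E - vpart F" "cpart (E - F) = cpart E - cpart F"
    "vpart (- E) = - vpart E" "cpart (- E) = - cpart E"
    "vpart (a *s K) = a *s vpart K" "cpart (a *s K) = a *s cpart K"
    "vpart (r *\<^sub>R H) = r *\<^sub>R vpart H" "cpart (r *\<^sub>R H) = r *\<^sub>R cpart H"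
  by (simp_all add: vpart_def cpart_def vec_eq_iff)

lemma gjoin_0 [simp]: "gjoin 0 0 = 0"
  by (simp add: gvec_eq_iff)

lemma gpair_simps:
  "gpair (E + F) H = gpair E H + gpair F H" "gpair H (E + F) = gpair H E + gpair H F"
  "gpair (E - F) H = gpair E H - gpair F H" "gpair H (E - F) = gpair H E - gpair H F"
  "gpair (- E) H = - gpair E H" "gpair H (- E) = - gpair H E"
  "gpair (r *\<^sub>R E) H = r * gpair E H" "gpair H (r *\<^sub>R E) = r * gpair H E"
  "gpair 0 H = 0" "gpair H 0 = 0"
  by (simp_all add: gpair_def inner_simps field_simps)

lemma gpair_commute: "gpair E F = gpair F E"
  by (simp add: gpair_def)

lemma gpair_nondegenerate:
  assumes "\<And>F. gpair E F = 0"
  shows "E = 0"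
proof -
  have "vpart E \<bullet> vpart E = 0" "cpart E \<bullet> cpart E = 0"
    using assms[of "gjoin 0 (vpart E)"] assms[of "gjoin (cpart E) 0"] by (auto simp: gpair_def)
  then show ?thesis by (simp add: gvec_eq_iff)
qed

lemma continuous_on_det:
  fixes A :: "'a::topological_space \<Rightarrow> real ^ 'n::finite ^ 'n"
  assumes "\<And>i j. continuous_on S (\<lambda>x. A x $ i $ j)"
  shows "continuous_on S (\<lambda>x. det (A x))"
  unfolding det_def by (intro continuous_intros assms)

text \<open>The path \<open>cos t + sin t J\<close> joins the identity to \<open>J\<close> within the invertible matrices, as
  \<open>cos t - sin t J\<close> is an inverse. So the determinant is positive, and its square is \<open>\<plusminus>1\<close>.\<close>

lemma det_complex_structure:
  fixes J :: "real ^ 'n::finite ^ 'n"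
  assumes J: "J ** J = - mat 1"
  shows "det J = 1"
proof -
  define P where "P t = cos t *\<^sub>R mat 1 + sin t *\<^sub>R J" for t
  have JJ: "J *v (J *v x) = - x" for x
    by (simp add: matrix_vector_mul_assoc J)
  have mv: "P t *v x = cos t *\<^sub>R x + sin t *\<^sub>R (J *v x)" for t x
    by (simp add: P_def matrix_vector_mult_add_rdistrib scaleR_matrix_vector_assoc[symmetric])
  have "P t ** P (- t) = mat 1" for t
  proof -
    have "P t *v (P (- t) *v x) = x" for x
    proof -
      have "P t *v (P (- t) *v x) = (cos t * cos t) *\<^sub>R x + (sin t * sin t) *\<^sub>R x"
        by (simp add: mv matrix_vector_right_distrib matrix_vector_mult_scaleR JJ matrix_vector_mult_diff_distrib
             algebra_simps)
      then show ?thesis by (simp only: scaleR_add_left[symmetric] sin_cos_squared_add3 scaleR_one)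
    qed
    then show ?thesis by (metis matrix_eq matrix_vector_mul_assoc matrix_vector_mul_lid)
  qed
  then have nz: "det (P t) \<noteq> 0" for t
    by (metis det_I det_mul mult_zero_left zero_neq_one)
  have cont: "continuous_on {0..pi/2} (\<lambda>t. det (P t))"
    by (intro continuous_on_det) (simp add: P_def, intro continuous_intros)
  have "det J > 0"
  proof (rule ccontr)
    assume "\<not> 0 < det J"
    moreover have "P (pi/2) = J" "P 0 = mat 1" by (simp_all add: P_def)
    ultimately have "\<exists>t. 0 \<le> t \<and> t \<le> pi/2 \<and> det (P t) = 0"
      by (intro IVT2'[of "\<lambda>t. det (P t)"] cont) auto
    then show False using nz by blast
  qed
  moreover have "\<bar>det J * det J\<bar> = 1"
  proof -
    have "det (- mat 1 :: real ^ 'n ^ 'n) * det (- mat 1 :: real ^ 'n ^ 'n) = det (mat 1 :: real ^ 'n ^ 'n)"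
      unfolding det_mul[symmetric]
      by (rule arg_cong[where f = det]) (simp add: matrix_eq matrix_vector_mul_assoc[symmetric])
    then have "\<bar>det (- mat 1 :: real ^ 'n ^ 'n)\<bar> = 1"
      by (metis abs_1 abs_mult abs_mult_self_eq det_I power2_eq_1_iff power2_eq_square abs_minus_cancel)
    then show ?thesis unfolding det_mul[symmetric] J .
  qed
  ultimately have "(det J)\<^sup>2 = 1\<^sup>2" by (simp add: power2_eq_square)
  then show ?thesis using \<open>det J > 0\<close> by (simp only: power2_eq_iff) auto
qed

lemma smooth_on_matrix:
  fixes F :: "'a::euclidean_space \<Rightarrow> real ^ 'm::finite \<Rightarrow> real ^ 'n::finite"
  assumes S: "open S" and F: "\<And>z. smooth_on S (\<lambda>x. F x z)"
  shows "smooth_on S (\<lambda>x. matrix (F x))"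
  unfolding matrix_def by (intro smooth_on_vec_lambda smooth_on_vec_nth S F)

lemma smooth_on_matrixI:
  fixes A :: "'a::euclidean_space \<Rightarrow> real ^ 'm::finite ^ 'n::finite"
  assumes S: "open S" and F: "\<And>z. smooth_on S (\<lambda>x. A x *v z)"
  shows "smooth_on S A"
  using smooth_on_matrix[where F = "\<lambda>x. (*v) (A x)", OF assms] by simp

lemma smooth_on_vpart: 
  fixes h :: "'a::euclidean_space \<Rightarrow> 'b::real_normed_vector ^ ('m::finite + 'n::finite)"
  shows "open S \<Longrightarrow> smooth_on S h \<Longrightarrow> smooth_on S (\<lambda>x. vpart (h x))"
  unfolding vpart_def by (intro smooth_on_vec_lambda smooth_on_vec_nth)

lemma smooth_on_cpart: 
  fixes h :: "'a::euclidean_space \<Rightarrow> 'b::real_normed_vector ^ ('m::finite + 'n::finite)"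
  shows "open S \<Longrightarrow> smooth_on S h \<Longrightarrow> smooth_on S (\<lambda>x. cpart (h x))"
  unfolding cpart_def by (intro smooth_on_vec_lambda smooth_on_vec_nth)

lemma smooth_on_gjoin:
  fixes u :: "'a::euclidean_space \<Rightarrow> 'b::real_normed_vector ^ 'm::finite" and v :: "'a \<Rightarrow> 'b ^ 'n::finite"
  assumes S: "open S" and "smooth_on S u" "smooth_on S v"
  shows "smooth_on S (\<lambda>x. gjoin (u x) (v x))"
  unfolding gjoin_def
proof (rule smooth_on_vec_lambda[OF S])
  fix k :: "'m + 'n"
  show "smooth_on S (\<lambda>x. case k of Inl i \<Rightarrow> u x $ i | Inr i \<Rightarrow> v x $ i)"
    by (cases k) (simp_all add: smooth_on_vec_nth assms)
qed

lemma bounded_linear_vpart: "bounded_linear (vpart :: 'b::euclidean_space ^ ('m::finite + 'n::finite) \<Rightarrow> 'b ^ 'm)"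
  by (rule linear_conv_bounded_linear[THEN iffD1], rule linearI) simp_all

lemma bounded_linear_cpart: "bounded_linear (cpart :: 'b::euclidean_space ^ ('m::finite + 'n::finite) \<Rightarrow> 'b ^ 'n)"
  by (rule linear_conv_bounded_linear[THEN iffD1], rule linearI) simp_all

section \<open>Reduction by the conormal space\<close>

text \<open>The relation by which the induced structure is characterized. It makes sense for any structure \<open>J\<close>, also if
  \<open>J\<close> does not preserve the space \<open>TM \<oplus> T\<^sup>*X\<close>, and will be used for both \<open>J\<^sub>0\<close> and \<open>J\<^sub>1\<close>.\<close>

definition induced_rel :: "real ^ ('n::finite + 'n) ^ ('n + 'n) \<Rightarrow> real ^ 'm::finite ^ 'n \<Rightarrow> real ^ ('m + 'm) ^ ('m + 'm) \<Rightarrow> bool" where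
  "induced_rel J D K \<longleftrightarrow> (\<forall>E F. J *v restr_incl D E = restr_incl D F \<longrightarrow> K *v restr_proj D E = restr_proj D F)"

text \<open>\<open>\<Lambda>\<close> takes values in \<open>TM \<oplus> T\<^sup>*X\<close> and is a section of the projection onto \<open>TM \<oplus> T\<^sup>*M\<close>.\<close>

definition is_lift :: "real ^ 'm::finite ^ 'n::finite \<Rightarrow> real ^ ('m + 'm) ^ ('n + 'n) \<Rightarrow> bool" where
  "is_lift D \<Lambda> \<longleftrightarrow> (\<forall>x. vpart (\<Lambda> *v x) = D *v vpart x \<and> transpose D *v cpart (\<Lambda> *v x) = cpart x)"

lemma conormal_eq: "conormal D = {gjoin 0 \<nu> | \<nu>. transpose D *v \<nu> = 0}"
proof -
  have "restr_incl D E \<in> {gjoin 0 \<nu> | \<nu>. transpose D *v \<nu> = 0}" if "restr_proj D E = 0" for E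
    using that by (auto simp: restr_incl_def restr_proj_def gvec_eq_iff intro!: exI[of _ "cpart E"])
  moreover have "gjoin 0 \<nu> \<in> conormal D" if "transpose D *v \<nu> = 0" for \<nu>
    unfolding conormal_def
    by (rule image_eqI[of _ _ "gjoin 0 \<nu>"]) (simp_all add: that restr_incl_def restr_proj_def)
  ultimately show ?thesis by (auto simp: conormal_def)
qed

lemma inner_transpose_mult: "(transpose A *v x) \<bullet> y = x \<bullet> (A *v y)" for A :: "real ^ 'm::finite ^ 'n::finite"
  by (metis dot_lmul_matrix transpose_transpose vector_transpose_matrix transpose_matrix_vector)

text \<open>The algebraic part of a generalized Kaehler structure, at one point.\<close>

definition kaehler_pair :: "real ^ ('n::finite + 'n) ^ ('n + 'n) \<Rightarrow> real ^ ('n + 'n) ^ ('n + 'n) \<Rightarrow> bool" where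
  "kaehler_pair J0 J1 \<longleftrightarrow> J0 \<in> SO_gen \<and> J1 \<in> SO_gen \<and> J0 ** J0 = - mat 1 \<and> J1 ** J1 = - mat 1 \<and>
     J0 ** J1 = J1 ** J0 \<and> - (J0 ** J1) \<in> SO_gen \<and> - (J0 ** J1) ** - (J0 ** J1) = mat 1 \<and>
     (\<forall>x. x \<noteq> 0 \<longrightarrow> gpair (- (J0 ** J1) *v x) x > 0)"

lemma kaehler_pairD:
  assumes "kaehler_pair J0 J1"
  shows "J0 \<in> SO_gen" "J1 \<in> SO_gen" "J0 ** J0 = - mat 1" "J1 ** J1 = - mat 1" "J0 ** J1 = J1 ** J0"
    "- (J0 ** J1) \<in> SO_gen" "- (J0 ** J1) ** - (J0 ** J1) = mat 1"
    "x \<noteq> 0 \<Longrightarrow> gpair (- (J0 ** J1) *v x) x > 0"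
  using assms unfolding kaehler_pair_def by blast+

text \<open>Hence \<open>TM \<oplus> T\<^sup>*X\<close> is the orthogonal of \<open>N\<^sup>*\<close>, which is the next lemma.\<close>

lemma mem_range_iff_annihilated:
  fixes D :: "real ^ 'm::finite ^ 'n::finite"
  shows "v \<in> range ((*v) D) \<longleftrightarrow> (\<forall>\<nu>. transpose D *v \<nu> = 0 \<longrightarrow> \<nu> \<bullet> v = 0)"
proof
  assume "v \<in> range ((*v) D)"
  then show "\<forall>\<nu>. transpose D *v \<nu> = 0 \<longrightarrow> \<nu> \<bullet> v = 0"
    by (metis imageE inner_transpose_mult inner_zero_left)
next
  assume r: "\<forall>\<nu>. transpose D *v \<nu> = 0 \<longrightarrow> \<nu> \<bullet> v = 0"
  have sub: "subspace (range ((*v) D))" by (simp add: linear_subspace_image)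
  obtain y z where yz: "v = y + z" "y \<in> span (range ((*v) D))" "\<And>w. w \<in> span (range ((*v) D)) \<Longrightarrow> orthogonal z w"
    using orthogonal_subspace_decomp_exists[of "range ((*v) D)" v] by metis
  have y: "y \<in> range ((*v) D)" using yz(2) sub by (metis span_eq_iff)
  have "(transpose D *v z) \<bullet> w = 0" for w
    unfolding inner_transpose_mult using yz(3)[of "D *v w"] by (simp add: orthogonal_def span_base)
  then have "transpose D *v z = 0" using inner_eq_zero_iff by blast
  then have "z \<bullet> v = 0" using r by blast
  moreover have "z \<bullet> y = 0" using yz(2,3) by (simp add: orthogonal_def)
  ultimately have "z = 0" using yz(1) by (simp add: inner_right_distrib)
  then show "v \<in> range ((*v) D)" using y yz(1) by simp
qed

lemma vpart_mem_range_iff: "vpart E \<in> range ((*v) D) \<longleftrightarrow> (\<forall>N\<in>conormal D. gpair N E = 0)"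
  unfolding mem_range_iff_annihilated conormal_eq by (auto simp: gpair_def)

lemma SO_genD: "J \<in> SO_gen \<Longrightarrow> gpair (J *v E) (J *v F) = gpair E F"
  by (simp add: SO_gen_def)

lemma complex_structure_vector: "J ** J = - mat 1 \<Longrightarrow> J *v (J *v x) = - x" for J :: "real ^ 'n::finite ^ 'n"
  by (simp add: matrix_vector_mul_assoc)

text \<open>Apply orthogonality to \<open>J E\<close> and \<open>F\<close>.\<close>

lemma gpair_skew: 
  assumes "J \<in> SO_gen" "J ** J = - mat 1" 
  shows "gpair (J *v E) F = - gpair E (J *v F)"
proof -
  have "gpair (J *v E) F = gpair (J *v (J *v E)) (J *v F)" using assms by (simp add: SO_genD)
  then show ?thesis by (simp add: complex_structure_vector[OF assms(2)] gpair_simps)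
qed

text \<open>Lifting \<open>(u, \<xi>)\<close> to \<open>W\<close> means to find a covector \<open>\<eta>\<close> on \<open>X\<close> that restricts to \<open>\<xi>\<close> and for which \<open>G (D u, \<eta>)\<close> has
  a tangent part \<open>D w\<close>. With \<open>z = (\<eta>, w)\<close> as unknown, this is a linear system with as many equations as unknowns.\<close>

definition lift_system :: "real ^ 'm::finite ^ 'n::finite \<Rightarrow> real ^ ('n + 'n) ^ ('n + 'n) \<Rightarrow> real ^ ('n + 'm) \<Rightarrow> real ^ ('n + 'm)" where
  "lift_system D G z = gjoin (vpart (G *v gjoin 0 (vpart z)) - D *v cpart z) (transpose D *v vpart z)"

lemma linear_lift_system: "linear (lift_system D G)"
proof (rule linearI)
  have [simp]: "gjoin 0 (a + b) = gjoin 0 a + gjoin 0 b" "gjoin 0 (r *\<^sub>R a) = r *\<^sub>R gjoin 0 a" for a b :: "real ^ 'n" and r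
    by (simp_all add: gvec_eq_iff)
  show "lift_system D G (x + y) = lift_system D G x + lift_system D G y" for x y
    by (simp add: gvec_eq_iff lift_system_def matrix_vector_right_distrib)
  show "lift_system D G (r *\<^sub>R x) = r *\<^sub>R lift_system D G x" for x r
    by (simp add: gvec_eq_iff lift_system_def matrix_vector_mult_scaleR scaleR_diff_right)
qed

text \<open>The situation at one point of the submanifold, in coordinates.\<close>

locale kaehler_point =
  fixes D :: "real ^ 'm::finite ^ 'n::finite" and J0 J1 G :: "real ^ ('n + 'n) ^ ('n + 'n)"
  assumes D_inj: "inj ((*v) D)"
    and pair: "kaehler_pair J0 J1" and G_eq: "G = - (J0 ** J1)"
    and conormal_inv: "(\<lambda>E. J0 *v E) ` conormal D = conormal D"
begin

lemmas J0_SO = kaehler_pairD(1)[OF pair] and J1_SO = kaehler_pairD(2)[OF pair]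
  and J0_sq = kaehler_pairD(3)[OF pair] and J1_sq = kaehler_pairD(4)[OF pair]
  and J_commute = kaehler_pairD(5)[OF pair] and G_pos = kaehler_pairD(8)[OF pair, folded G_eq]

lemma D_inj_iff: "D *v x = D *v y \<longleftrightarrow> x = y"
  using D_inj by (auto dest: injD)

lemma J0J0 [simp]: "J0 *v (J0 *v x) = - x" and J1J1 [simp]: "J1 *v (J1 *v x) = - x"
  using complex_structure_vector J0_sq J1_sq by blast+

lemma J1J0: "J1 *v (J0 *v x) = J0 *v (J1 *v x)"
  by (simp add: matrix_vector_mul_assoc J_commute)

lemma Gv: "G *v x = - (J0 *v (J1 *v x))"
  by (simp add: G_eq matrix_vector_mul_assoc)

lemma J1_eq: "J1 *v x = G *v (J0 *v x)"
  by (simp add: Gv J1J0)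

lemma GG: "G *v (G *v x) = x"
  by (simp add: Gv J1J0)

lemma G_J0: "G *v (J0 *v x) = J0 *v (G *v x)"
  by (simp add: Gv J1J0)

lemma G_definite: "gpair (G *v E) E = 0 \<Longrightarrow> E = 0"
  using G_pos by force

lemma G_definite': "gpair E (G *v E) = 0 \<Longrightarrow> E = 0"
  using G_definite by (simp add: gpair_commute)

lemma J0_conormal: "N \<in> conormal D \<Longrightarrow> J0 *v N \<in> conormal D"
  using conormal_inv by blast

lemma conormal_pair: "N \<in> conormal D \<Longrightarrow> vpart E \<in> range ((*v) D) \<Longrightarrow> gpair N E = 0"
  using vpart_mem_range_iff by blast

lemma vpart_conormal: "N \<in> conormal D \<Longrightarrow> vpart N = 0"
  by (auto simp: conormal_eq)

text \<open>For a solution \<open>(\<eta>, w)\<close>, \<open>\<eta>\<close> is conormal and \<open>G \<eta>\<close> is orthogonal to \<open>N\<^sup>*\<close>, so \<open>\<langle>G \<eta>, \<eta>\<rangle> = 0\<close>.\<close>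

lemma lift_system_eq_0: 
  assumes "lift_system D G z = 0" shows "z = 0"
proof -
  let ?N = "gjoin 0 (vpart z) :: real ^ ('n + 'n)"
  have N: "?N \<in> conormal D" and v: "vpart (G *v ?N) = D *v cpart z"
    using assms by (auto simp: conormal_eq lift_system_def gvec_eq_iff)
  have "gpair ?N (G *v ?N) = 0" by (rule conormal_pair[OF N]) (simp add: v)
  then have "?N = 0" by (rule G_definite')
  then have "vpart z = 0" by (metis cpart_gjoin vpart_cpart_simps(2))
  moreover from this v have "D *v cpart z = D *v 0" by simp
  then have "cpart z = 0" using D_inj_iff by blast
  ultimately show ?thesis by (simp add: gvec_eq_iff)
qed

lemma lift_system_bij: "inj (lift_system D G)" "surj (lift_system D G)"
proof -
  show "inj (lift_system D G)"
    using linear_injective_0[OF linear_lift_system] lift_system_eq_0 by blast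
  then show "surj (lift_system D G)"
    using linear_inj_imp_surj[OF linear_lift_system] by blast
qed

text \<open>The system with \<open>\<xi> = 0\<close> and an arbitrary tangent part on the other side. It will show that the pulled back
  spinor does not vanish.\<close>

lemma tangent_vector_split:
  obtains w \<eta> where "transpose D *v \<eta> = 0" "v = D *v w + vpart (G *v gjoin 0 \<eta>)"
proof -
  obtain z where "lift_system D G z = gjoin v 0" using lift_system_bij(2) by (metis surjD)
  then have "transpose D *v vpart z = 0" "v = D *v (- cpart z) + vpart (G *v gjoin 0 (vpart z))"
    by (auto simp: lift_system_def gvec_eq_iff)
  then show ?thesis using that by blast
qed

text \<open>The orthogonal of \<open>N\<^sup>* + G N\<^sup>*\<close>, see the next lemma.\<close>

definition W where "W = {E. vpart E \<in> range ((*v) D) \<and> vpart (G *v E) \<in> range ((*v) D)}"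

lemma W_eq: "W = {E. \<forall>N\<in>conormal D. gpair N E = 0 \<and> gpair N (G *v E) = 0}"
  unfolding W_def vpart_mem_range_iff by blast

lemma J0_W: "E \<in> W \<Longrightarrow> J0 *v E \<in> W"
  unfolding W_eq using J0_conormal
  by (simp add: G_J0) (metis gpair_commute gpair_skew[OF J0_SO J0_sq] neg_equal_0_iff_equal)

lemma G_W: "E \<in> W \<Longrightarrow> G *v E \<in> W"
  unfolding W_def by (simp add: GG)

lemma J1_W: "E \<in> W \<Longrightarrow> J1 *v E \<in> W"
  by (simp add: J1_eq J0_W G_W)

definition lift :: "real ^ ('m + 'm) \<Rightarrow> real ^ ('n + 'n)" where
  "lift x = (THE E. E \<in> W \<and> vpart E = D *v vpart x \<and> transpose D *v cpart E = cpart x)"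

text \<open>The difference \<open>N\<close> is conormal and lies in \<open>W\<close>, so \<open>\<langle>N, G N\<rangle> = 0\<close>.\<close>

lemma lift_unique:
  assumes "E \<in> W" "F \<in> W" "vpart E = vpart F" "transpose D *v cpart E = transpose D *v cpart F"
  shows "E = F"
proof -
  let ?N = "E - F"
  have N: "?N \<in> conormal D"
    unfolding conormal_eq using assms(3,4)
    by (auto simp: gvec_eq_iff matrix_vector_mult_diff_distrib intro!: exI[of _ "cpart E - cpart F"])
  have "gpair ?N (G *v E) = 0" "gpair ?N (G *v F) = 0"
    using assms(1,2) N by (auto simp: W_eq)
  then have "gpair ?N (G *v ?N) = 0" by (simp add: matrix_vector_mult_diff_distrib gpair_simps(4))
  then have "?N = 0" by (rule G_definite')
  then show ?thesis by simp
qed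

lemma lift_ex: "\<exists>!E. E \<in> W \<and> vpart E = D *v vpart x \<and> transpose D *v cpart E = cpart x"
proof -
  obtain z where z: "lift_system D G z = gjoin (- vpart (G *v gjoin (D *v vpart x) 0)) (cpart x)"
    using lift_system_bij(2) by (metis surjD)
  let ?E = "gjoin (D *v vpart x) (vpart z)"
  have "?E = gjoin (D *v vpart x) 0 + gjoin 0 (vpart z)" by (simp add: gvec_eq_iff)
  then have "G *v ?E = G *v gjoin (D *v vpart x) 0 + G *v gjoin 0 (vpart z)"
    by (simp only: matrix_vector_right_distrib)
  then have "vpart (G *v ?E) = D *v cpart z"
    using z by (simp add: lift_system_def gvec_eq_iff algebra_simps)
  moreover have "transpose D *v vpart z = cpart x" using z by (simp add: lift_system_def gvec_eq_iff)
  ultimately show ?thesis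
    by (intro ex1I[of _ ?E]) (auto simp: W_def intro!: lift_unique)
qed

lemma lift_props: "lift x \<in> W" "vpart (lift x) = D *v vpart x" "transpose D *v cpart (lift x) = cpart x"
  using theI'[OF lift_ex[of x]] by (simp_all add: lift_def)

lemma lift_eqI: "E \<in> W \<Longrightarrow> vpart E = D *v vpart x \<Longrightarrow> transpose D *v cpart E = cpart x \<Longrightarrow> lift x = E"
  using lift_props[of x] lift_unique by metis

lemma W_add: "E \<in> W \<Longrightarrow> F \<in> W \<Longrightarrow> E + F \<in> W" and W_scale: "E \<in> W \<Longrightarrow> r *\<^sub>R E \<in> W"
  unfolding W_eq by (auto simp: matrix_vector_right_distrib matrix_vector_mult_scaleR gpair_simps)

lemma linear_lift: "linear lift"
proof (rule linearI)
  show "lift (x + y) = lift x + lift y" for x y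
    by (rule lift_eqI) (simp_all add: W_add lift_props matrix_vector_right_distrib)
  show "lift (r *\<^sub>R x) = r *\<^sub>R lift x" for r x
    by (rule lift_eqI) (simp_all add: W_scale lift_props matrix_vector_mult_scaleR)
qed

lemma lift_inj: "inj lift"
proof (rule injI)
  fix x y assume "lift x = lift y"
  then show "x = y" using lift_props(2)[of x] lift_props(2)[of y] lift_props(3)[of x] lift_props(3)[of y]
    by (metis D_inj_iff gvec_eq_iff)
qed

lemma lift_surj: 
  assumes "E \<in> W" shows "\<exists>x. lift x = E"
proof -
  obtain u where "vpart E = D *v u" using assms by (auto simp: W_def)
  then have "lift (gjoin u (transpose D *v cpart E)) = E" using assms by (intro lift_eqI) auto
  then show ?thesis by blast
qed

definition \<Lambda> where "\<Lambda> = matrix lift"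

lemma \<Lambda>_mult: "\<Lambda> *v x = lift x"
  unfolding \<Lambda>_def using linear_lift by simp

lemma is_lift_\<Lambda>: "is_lift D \<Lambda>"
  by (simp add: is_lift_def \<Lambda>_mult lift_props)

lemma lift_transport:
  assumes "\<And>E. E \<in> W \<Longrightarrow> J *v E \<in> W"
  obtains K where "\<And>x. J *v lift x = lift (K *v x)"
proof -
  have "\<exists>k. linear k \<and> (\<forall>x. lift (k x) = J *v lift x)"
  proof -
    obtain g where g: "linear g" "g \<circ> lift = id"
      using linear_injective_left_inverse[OF linear_lift lift_inj] by blast
    have "lift (g (J *v lift x)) = J *v lift x" for x
      using lift_surj[OF assms[OF lift_props(1)[of x]]] g(2) by (metis comp_apply id_apply)
    moreover have "linear (\<lambda>x. g (J *v lift x))"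
      using linear_compose[OF linear_lift linear_compose[OF matrix_vector_mul_linear[of J] g(1)]] by (simp add: o_def)
    ultimately show ?thesis by blast
  qed
  then obtain k where "linear k" "\<And>x. lift (k x) = J *v lift x" by blast
  then show ?thesis using that[of "matrix k"] by (simp add: matrix_works)
qed

lemma gpair_lift: "gpair (lift x) (lift y) = gpair x y"
proof -
  have "cpart (lift x) \<bullet> vpart (lift y) = cpart x \<bullet> vpart y" for x y
    by (metis inner_transpose_mult lift_props(2,3))
  then show ?thesis by (simp add: gpair_def)
qed

lemma lift_transport_props:
  assumes "\<And>x. J *v lift x = lift (K *v x)"
  shows "J \<in> SO_gen \<Longrightarrow> gpair (K *v x) (K *v y) = gpair x y"
    "J ** J = - mat 1 \<Longrightarrow> K ** K = - mat 1"
proof -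
  show "gpair (K *v x) (K *v y) = gpair x y" if "J \<in> SO_gen"
    by (metis SO_genD assms gpair_lift that)
  show "K ** K = - mat 1" if "J ** J = - mat 1"
  proof -
    have "lift (K *v (K *v x)) = lift (- x)" for x
      using complex_structure_vector[OF that, of "lift x"] 
      by (simp add: assms[symmetric] linear_neg[OF linear_lift])
    then have "K *v (K *v x) = - x" for x using lift_inj by (auto dest: injD)
    then show ?thesis by (simp add: matrix_eq matrix_vector_mul_assoc[symmetric])
  qed
qed

text \<open>An element \<open>E\<close> of \<open>TM \<oplus> T\<^sup>*X\<close> differs from the lift of its projection by a conormal element, on which \<open>J\<close> has
  no effect modulo \<open>N\<^sup>*\<close> as soon as \<open>J E\<close> is in \<open>TM \<oplus> T\<^sup>*X\<close>.\<close>

lemma induced_rel_transport: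
  assumes K: "\<And>x. J *v lift x = lift (K *v x)" 
    and N: "\<And>N. N \<in> conormal D \<Longrightarrow> vpart (J *v N) \<in> range ((*v) D) \<Longrightarrow> J *v N \<in> conormal D"
  shows "induced_rel J D K"
  unfolding induced_rel_def
proof (intro allI impI)
  fix E F assume EF: "J *v restr_incl D E = restr_incl D F"
  let ?x = "restr_proj D E"
  define N where "N = restr_incl D E - lift ?x"
  have Nc: "N \<in> conormal D"
    unfolding conormal_eq N_def
    by (auto simp: gvec_eq_iff lift_props restr_incl_def restr_proj_def matrix_vector_mult_diff_distrib
        intro!: exI[of _ "cpart E - cpart (lift ?x)"])
  have eq: "restr_incl D F = lift (K *v ?x) + J *v N"
    unfolding EF[symmetric] N_def by (simp add: matrix_vector_mult_diff_distrib K)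
  have "J *v N = restr_incl D F - lift (K *v ?x)" using eq by simp
  then have "vpart (J *v N) = D *v (vpart F - vpart (K *v ?x))"
    by (simp add: lift_props restr_incl_def matrix_vector_mult_diff_distrib)
  then have JN: "J *v N \<in> conormal D" using N[OF Nc] by blast
  have "D *v vpart F = D *v vpart (K *v ?x)"
    using arg_cong[OF eq, of vpart] vpart_conormal[OF JN] by (simp add: lift_props restr_incl_def)
  then have v: "vpart F = vpart (K *v ?x)" using D_inj_iff by blast
  have "transpose D *v cpart (J *v N) = 0" using JN by (auto simp: conormal_eq)
  then have "transpose D *v cpart F = cpart (K *v ?x)"
    using arg_cong[OF eq, of cpart] by (simp add: lift_props restr_incl_def matrix_vector_right_distrib)
  with v show "K *v ?x = restr_proj D F" by (simp add: restr_proj_def gvec_eq_iff)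
qed

text \<open>In fact such an \<open>N\<close> is zero: \<open>J\<^sub>1 N = G J\<^sub>0 N\<close> is orthogonal to the conormal element \<open>J\<^sub>0 N\<close>.\<close>

lemma J1_conormal:
  assumes "N \<in> conormal D" "vpart (J1 *v N) \<in> range ((*v) D)"
  shows "J1 *v N \<in> conormal D"
proof -
  have "gpair (J0 *v N) (G *v (J0 *v N)) = 0"
    using conormal_pair[OF J0_conormal[OF assms(1)] assms(2)] by (simp add: J1_eq)
  then have "J0 *v N = 0" by (rule G_definite')
  then show ?thesis using assms(1) by (metis J1_eq matrix_vector_mult_0_right J0_conormal)
qed

text \<open>The restrictions of \<open>J\<^sub>0\<close> and \<open>J\<^sub>1\<close> to \<open>W\<close>, transported to \<open>TM \<oplus> T\<^sup>*M\<close>, inherit all algebraic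
  properties, since \<open>lift\<close> is an isometry.\<close>

lemma reduced_structures:
  obtains K0 K1 where
    "\<And>x. J0 *v (\<Lambda> *v x) = \<Lambda> *v (K0 *v x)" "\<And>x. J1 *v (\<Lambda> *v x) = \<Lambda> *v (K1 *v x)"
    "kaehler_pair K0 K1" "induced_rel J0 D K0" "induced_rel J1 D K1"
proof -
  obtain K0 where K0: "\<And>x. J0 *v lift x = lift (K0 *v x)" using lift_transport[OF J0_W] by blast
  obtain K1 where K1: "\<And>x. J1 *v lift x = lift (K1 *v x)" using lift_transport[OF J1_W] by blast
  note sq = lift_transport_props(2)[OF K0 J0_sq] lift_transport_props(2)[OF K1 J1_sq]
  note iso = lift_transport_props(1)[OF K0 J0_SO] lift_transport_props(1)[OF K1 J1_SO]
  have lift_eq: "lift x = lift y \<longleftrightarrow> x = y" for x y using lift_inj by (auto dest: injD)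
  have comm: "K0 *v (K1 *v x) = K1 *v (K0 *v x)" for x
  proof -
    have "lift (K0 *v (K1 *v x)) = lift (K1 *v (K0 *v x))" by (simp only: K0[symmetric] K1[symmetric] J1J0)
    then show ?thesis by (simp only: lift_eq)
  qed
  then have comm': "K0 ** K1 = K1 ** K0" by (simp add: matrix_eq matrix_vector_mul_assoc[symmetric])
  have G: "G *v lift x = lift (- (K0 ** K1) *v x)" for x
    by (simp add: Gv K0 K1 matrix_vector_mul_assoc[symmetric] linear_neg[OF linear_lift])
  have Gsq: "- (K0 ** K1) ** - (K0 ** K1) = mat 1"
    by (simp add: matrix_eq matrix_vector_mul_assoc[symmetric] comm complex_structure_vector[OF sq(1)] complex_structure_vector[OF sq(2)])
  have "(- K0) ** (- K0) = - mat 1" 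
    by (simp add: matrix_eq matrix_vector_mul_assoc[symmetric] complex_structure_vector[OF sq(1)])
  then have "det (- K0) = 1" by (rule det_complex_structure)
  moreover have "- (K0 ** K1) = (- K0) ** K1" by (simp add: matrix_eq matrix_vector_mul_assoc[symmetric])
  ultimately have "det (- (K0 ** K1)) = 1" by (simp add: det_mul det_complex_structure sq)
  then have GSO: "- (K0 ** K1) \<in> SO_gen"
    by (simp add: SO_gen_def matrix_vector_mul_assoc[symmetric] iso gpair_simps)
  have pos: "gpair (- (K0 ** K1) *v x) x > 0" if "x \<noteq> 0" for x
  proof -
    have "lift x \<noteq> 0" using that lift_eq linear_0[OF linear_lift] by metis
    then show ?thesis using G_pos[of "lift x"] unfolding G gpair_lift by blast
  qed
  have SO: "K0 \<in> SO_gen" "K1 \<in> SO_gen"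
    by (simp_all add: SO_gen_def det_complex_structure sq iso)
  have KL: "J0 *v (\<Lambda> *v x) = \<Lambda> *v (K0 *v x)" "J1 *v (\<Lambda> *v x) = \<Lambda> *v (K1 *v x)" for x
    unfolding \<Lambda>_mult by (fact K0 K1)+
  have rel: "induced_rel J0 D K0" "induced_rel J1 D K1"
    using induced_rel_transport[OF K0 J0_conormal] induced_rel_transport[OF K1 J1_conormal] by blast+
  have "kaehler_pair K0 K1" unfolding kaehler_pair_def using SO sq comm' GSO Gsq pos by blast
  then show ?thesis by (rule that[OF KL _ rel])
qed

lemma lift_solves:
  obtains w where
    "lift_system D G (gjoin (cpart (\<Lambda> *v x)) w) = gjoin (- vpart (G *v gjoin (D *v vpart x) 0)) (cpart x)"
proof -
  obtain w where w: "vpart (G *v lift x) = D *v w" using lift_props(1)[of x] by (auto simp: W_def)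
  have "gjoin (D *v vpart x) 0 + gjoin 0 (cpart (lift x)) = lift x" by (simp add: gvec_eq_iff lift_props)
  then have "G *v lift x = G *v gjoin (D *v vpart x) 0 + G *v gjoin 0 (cpart (lift x))"
    by (simp only: matrix_vector_right_distrib[symmetric])
  then have "vpart (G *v gjoin 0 (cpart (lift x))) - D *v w = - vpart (G *v gjoin (D *v vpart x) 0)"
    unfolding w[symmetric] by simp
  then show ?thesis
    using that[of w] by (simp add: lift_system_def \<Lambda>_mult lift_props)
qed

lemma induced_rel_unique:
  assumes "\<And>x. J *v (\<Lambda> *v x) = \<Lambda> *v (K *v x)" "induced_rel J D K'"
  shows "K' = K"
proof -
  \<comment> \<open>\<open>lift x\<close> as an element of \<open>TM \<oplus> T\<^sup>*X\<close>\<close>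
  define emb where "emb x = gjoin (vpart x) (cpart (lift x))" for x
  have "restr_incl D (emb x) = lift x" "restr_proj D (emb x) = x" for x
    by (simp_all add: emb_def restr_incl_def restr_proj_def lift_props gvec_eq_iff)
  then have "K' *v x = K *v x" for x
    using assms by (metis \<Lambda>_mult induced_rel_def)
  then show ?thesis by (simp add: matrix_eq)
qed

end

section \<open>Eigenspaces of generalized complex structures\<close>

definition cvec :: "real ^ 'n::finite \<Rightarrow> complex ^ 'n" where "cvec x = (\<chi> i. complex_of_real (x $ i))"
definition Re_vec :: "complex ^ 'n::finite \<Rightarrow> real ^ 'n" where "Re_vec E = (\<chi> i. Re (E $ i))"
definition Im_vec :: "complex ^ 'n::finite \<Rightarrow> real ^ 'n" where "Im_vec E = (\<chi> i. Im (E $ i))"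

lemma Re_Im_vec_simps [simp]:
  "Re_vec (cvec x) = x" "Im_vec (cvec x) = 0"
  "Re_vec (E + F) = Re_vec E + Re_vec F" "Im_vec (E + F) = Im_vec E + Im_vec F"
  "Re_vec (E - F) = Re_vec E - Re_vec F" "Im_vec (E - F) = Im_vec E - Im_vec F"
  "Re_vec (c *s E) = Re c *\<^sub>R Re_vec E - Im c *\<^sub>R Im_vec E"
  "Im_vec (c *s E) = Re c *\<^sub>R Im_vec E + Im c *\<^sub>R Re_vec E"
  "Re_vec (cnj_vec E) = Re_vec E" "Im_vec (cnj_vec E) = - Im_vec E"
  "Re_vec 0 = 0" "Im_vec 0 = 0" "Re_vec (- E) = - Re_vec E" "Im_vec (- E) = - Im_vec E"
  by (simp_all add: vec_eq_iff cvec_def Re_vec_def Im_vec_def cnj_vec_def)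

lemma Re_Im_vec_nth: "Re_vec E $ i = Re (E $ i)" "Im_vec E $ i = Im (E $ i)"
  by (simp_all add: Re_vec_def Im_vec_def)

lemma complex_vec_eq_iff: "E = F \<longleftrightarrow> Re_vec E = Re_vec F \<and> Im_vec E = Im_vec F"
  by (auto simp: vec_eq_iff Re_Im_vec_nth complex_eq_iff)

lemma Re_Im_vec_cmat [simp]:
  "Re_vec (cmat A *v E) = A *v Re_vec E" "Im_vec (cmat A *v E) = A *v Im_vec E"
  by (simp_all add: vec_eq_iff Re_vec_def Im_vec_def matrix_vector_mult_def)

lemma Re_Im_vec_parts [simp]:
  "Re_vec (vpart E) = vpart (Re_vec E)" "Im_vec (vpart E) = vpart (Im_vec E)"
  "Re_vec (cpart E) = cpart (Re_vec E)" "Im_vec (cpart E) = cpart (Im_vec E)"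
  by (simp_all add: vec_eq_iff Re_vec_def Im_vec_def vpart_def cpart_def)

lemma cmat_transpose: "cmat (transpose A) = transpose (cmat A)"
  by (simp add: vec_eq_iff transpose_def map_matrix_def)

lemma mem_eigenspace_minus_i:
  "E \<in> eigenspace_minus_i J \<longleftrightarrow> J *v Re_vec E = Im_vec E \<and> J *v Im_vec E = - Re_vec E"
  unfolding eigenspace_minus_i_def by (auto simp: complex_vec_eq_iff)

lemma eigenspace_minus_i_cvec:
  "J ** J = - mat 1 \<Longrightarrow> cvec a + \<i> *s cvec (J *v a) \<in> eigenspace_minus_i J"
  by (simp add: mem_eigenspace_minus_i complex_structure_vector)

text \<open>Twice the complex bilinear extension of \<open>gpair\<close>.\<close>

definition cpair :: "complex ^ ('n::finite + 'n) \<Rightarrow> complex ^ ('n + 'n) \<Rightarrow> complex" where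
  "cpair E F = (\<Sum>i\<in>UNIV. cpart E $ i * vpart F $ i) + (\<Sum>i\<in>UNIV. cpart F $ i * vpart E $ i)"

lemma Re_cpair: "Re (cpair E F) = 2 * (gpair (Re_vec E) (Re_vec F) - gpair (Im_vec E) (Im_vec F))"
  and Im_cpair: "Im (cpair E F) = 2 * (gpair (Re_vec E) (Im_vec F) + gpair (Im_vec E) (Re_vec F))"
proof -
  have "inner (Re_vec a) (Re_vec b) - inner (Im_vec a) (Im_vec b) = Re (\<Sum>i\<in>UNIV. a $ i * b $ i)"
    "inner (Re_vec a) (Im_vec b) + inner (Im_vec a) (Re_vec b) = Im (\<Sum>i\<in>UNIV. a $ i * b $ i)" for a b :: "complex ^ 'a"
    by (simp_all add: inner_vec_def Re_Im_vec_nth sum_subtractf sum.distrib)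
  from this[of "cpart E" "vpart F"] this[of "cpart F" "vpart E"]
  show "Re (cpair E F) = 2 * (gpair (Re_vec E) (Re_vec F) - gpair (Im_vec E) (Im_vec F))"
    "Im (cpair E F) = 2 * (gpair (Re_vec E) (Im_vec F) + gpair (Im_vec E) (Re_vec F))"
    by (simp_all add: cpair_def gpair_def field_simps inner_commute)
qed

text \<open>This lemma and the next one: the eigenspace is its own orthogonal.\<close>

lemma eigenspace_isotropic:
  assumes "J \<in> SO_gen" "J ** J = - mat 1" "E \<in> eigenspace_minus_i J" "F \<in> eigenspace_minus_i J"
  shows "cpair E F = 0"
proof -
  note s = gpair_skew[OF assms(1,2)] 
  have "gpair (Im_vec E) (Im_vec F) = gpair (Re_vec E) (Re_vec F)" 
    using assms(3,4) SO_genD[OF assms(1)] unfolding mem_eigenspace_minus_i by metis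
  moreover have "gpair (Im_vec E) (Re_vec F) = - gpair (Re_vec E) (Im_vec F)"
    using assms(3,4) s unfolding mem_eigenspace_minus_i by metis
  ultimately show ?thesis by (simp add: complex_eq_iff Re_cpair Im_cpair)
qed

lemma eigenspace_maximal:
  assumes "J \<in> SO_gen" "J ** J = - mat 1" "\<And>F. F \<in> eigenspace_minus_i J \<Longrightarrow> cpair E F = 0"
  shows "E \<in> eigenspace_minus_i J"
proof -
  have "gpair (Re_vec E + J *v Im_vec E) c = 0" for c
    using assms(3)[OF eigenspace_minus_i_cvec[OF assms(2), of c]] gpair_skew[OF assms(1,2), of "Im_vec E" c]
    by (simp add: complex_eq_iff Re_cpair gpair_simps)
  then have "Re_vec E + J *v Im_vec E = 0" by (rule gpair_nondegenerate)
  then have "J *v Im_vec E = - Re_vec E" by (simp add: eq_neg_iff_add_eq_0 add.commute)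
  moreover from arg_cong[OF this, of "(*v) J"] have "J *v Re_vec E = Im_vec E"
    by (simp add: complex_structure_vector[OF assms(2)])
  ultimately show ?thesis by (simp add: mem_eigenspace_minus_i)
qed

text \<open>\<open>J a\<close> is the imaginary part of the only element of the eigenspace with real part \<open>a\<close>.\<close>

lemma eigenspace_determines_structure:
  assumes "J ** J = - mat 1" "eigenspace_minus_i J = eigenspace_minus_i J'"
  shows "J' = J"
proof -
  have "J' *v a = J *v a" for a
    using eigenspace_minus_i_cvec[OF assms(1), of a] unfolding assms(2) by (simp add: mem_eigenspace_minus_i)
  then show ?thesis by (simp add: matrix_eq)
qed

lemma eigenspace_Int_cnj:
  "eigenspace_minus_i J \<inter> cnj_vec ` eigenspace_minus_i J = {0}" (is "?L \<inter> _ = _")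
proof -
  have "E = 0" if "E \<in> ?L" "F \<in> ?L" "E = cnj_vec F" for E F
  proof -
    have "Im_vec E = - Im_vec E" "Re_vec E = - Re_vec E"
      using that(1,2) unfolding mem_eigenspace_minus_i that(3) by auto
    then show ?thesis by (simp add: complex_vec_eq_iff vec_eq_iff)
  qed
  moreover have "cnj_vec 0 = (0 :: complex ^ ('a + 'a))" by (simp add: complex_vec_eq_iff)
  then have "0 \<in> ?L \<inter> cnj_vec ` ?L" by (force simp: mem_eigenspace_minus_i)
  ultimately show ?thesis by blast
qed

lemma eigenspace_plus_cnj:
  assumes "J ** J = - mat 1"
  shows "{E + F | E F. E \<in> eigenspace_minus_i J \<and> F \<in> cnj_vec ` eigenspace_minus_i J} = UNIV" (is "?S = _")
proof -
  have "H \<in> ?S" for H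
  proof -
    \<comment> \<open>the real parts of the two components of \<open>H\<close>\<close>
    define a b where "a = (1/2) *\<^sub>R (Re_vec H - J *v Im_vec H)" and "b = (1/2) *\<^sub>R (Re_vec H + J *v Im_vec H)"
    have "a + b = Re_vec H" "a - b = - (J *v Im_vec H)" by (simp_all add: a_def b_def vec_eq_iff field_simps)
    moreover from arg_cong[OF this(2), of "(*v) J"] have "J *v a - J *v b = Im_vec H"
      by (simp add: complex_structure_vector[OF assms] matrix_vector_mult_diff_distrib)
    ultimately have "H = (cvec a + \<i> *s cvec (J *v a)) + cnj_vec (cvec b + \<i> *s cvec (J *v b))"
      by (simp add: complex_vec_eq_iff)
    then show ?thesis using eigenspace_minus_i_cvec[OF assms] by blast
  qed
  then show ?thesis by blast
qed

lemma subspace_eigenspace: "vec.subspace (eigenspace_minus_i J)"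
  unfolding vec.subspace_def mem_eigenspace_minus_i
  by (simp add: mem_eigenspace_minus_i matrix_vector_right_distrib matrix_vector_mult_diff_distrib
      matrix_vector_mult_scaleR algebra_simps)

lemma cnj_vec_simps [simp]: "cnj_vec (E + F) = cnj_vec E + cnj_vec F" "cnj_vec (c *s E) = cnj c *s cnj_vec E"
  "cnj_vec 0 = 0" "cnj_vec (cnj_vec E) = E"
  by (simp_all add: vec_eq_iff cnj_vec_def)

lemma subspace_cnj: 
  assumes "vec.subspace S" shows "vec.subspace (cnj_vec ` S)"
proof -
  have "c *s cnj_vec E \<in> cnj_vec ` S" if "E \<in> S" for c E
  proof -
    have "cnj c *s E \<in> S" using assms that by (simp add: vec.subspace_def)
    moreover have "c *s cnj_vec E = cnj_vec (cnj c *s E)" by simp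
    ultimately show ?thesis by blast
  qed
  moreover have "cnj_vec E + cnj_vec F \<in> cnj_vec ` S" if "E \<in> S" "F \<in> S" for E F
    using vec.subspace_add[OF assms that] by (metis cnj_vec_simps(1) image_eqI)
  moreover have "0 \<in> cnj_vec ` S" using assms by (force simp: vec.subspace_def)
  ultimately show ?thesis unfolding vec.subspace_def by blast
qed

text \<open>Conjugation is antilinear, so that the dimension theory of linear maps does not apply.\<close>

lemma dim_cnj_le:
  assumes "vec.subspace S"
  shows "vec.dim (cnj_vec ` S) \<le> vec.dim S"
proof -
  obtain B where B: "B \<subseteq> S" "vec.independent B" "S \<subseteq> vec.span B" "card B = vec.dim S"
    using vec.basis_exists by blast
  have fin: "finite B" using B(2) vec.finiteI_independent by blast
  have "S \<subseteq> cnj_vec ` vec.span (cnj_vec ` B)"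
  proof -
    have "vec.span B \<subseteq> cnj_vec ` vec.span (cnj_vec ` B)"
      by (rule vec.span_minimal[OF _ subspace_cnj[OF vec.subspace_span]])
        (metis (no_types, lifting) cnj_vec_simps(4) image_eqI subsetI vec.span_base)
    then show ?thesis using B(3) by blast
  qed
  then have "cnj_vec ` S \<subseteq> vec.span (cnj_vec ` B)" by auto
  then have "vec.dim (cnj_vec ` S) \<le> card (cnj_vec ` B)"
    using fin by (intro vec.dim_le_card) auto
  then show ?thesis using B(4) card_image_le[OF fin, of cnj_vec] by linarith
qed

lemma dim_eigenspace:
  fixes J :: "real ^ ('n::finite + 'n) ^ ('n + 'n)"
  assumes "J ** J = - mat 1"
  shows "vec.dim (eigenspace_minus_i J) = CARD('n)"
proof -
  let ?L = "eigenspace_minus_i J"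
  have "vec.dim {x + y |x y. x \<in> ?L \<and> y \<in> cnj_vec ` ?L} + vec.dim (?L \<inter> cnj_vec ` ?L) = vec.dim ?L + vec.dim (cnj_vec ` ?L)"
    by (rule vec.dim_sums_Int[OF subspace_eigenspace subspace_cnj[OF subspace_eigenspace]])
  then have "vec.dim ?L + vec.dim (cnj_vec ` ?L) = CARD('n) + CARD('n)"
    unfolding eigenspace_plus_cnj[OF assms] eigenspace_Int_cnj vec_dim_card by simp
  moreover have "vec.dim (cnj_vec ` ?L) \<le> vec.dim ?L" by (rule dim_cnj_le[OF subspace_eigenspace])
  moreover have "vec.dim (cnj_vec ` cnj_vec ` ?L) \<le> vec.dim (cnj_vec ` ?L)"
    by (rule dim_cnj_le[OF subspace_cnj[OF subspace_eigenspace]])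
  moreover have "cnj_vec ` cnj_vec ` ?L = ?L" by (simp add: image_image)
  ultimately show ?thesis by simp
qed

section \<open>Pure spinors\<close>

definition wedge_covector :: "complex ^ 'n::finite \<Rightarrow> 'n cform \<Rightarrow> 'n cform" where
  "wedge_covector \<eta> \<phi> vs = (\<Sum>i<length vs. (- 1) ^ i * (\<Sum>j\<in>UNIV. \<eta> $ j * complex_of_real (vs ! i $ j)) * \<phi> (drop_nth i vs))"

lemma clifford_eq:
  "clifford E \<phi> vs = \<phi> (vpart (Re_vec E) # vs) + \<i> * \<phi> (vpart (Im_vec E) # vs) + wedge_covector (cpart E) \<phi> vs"
  unfolding clifford_def wedge_covector_def Re_Im_vec_parts[symmetric]
  unfolding Re_vec_def Im_vec_def by (rule refl)

lemma length_drop_nth: "i < length vs \<Longrightarrow> length (drop_nth i vs) = length vs - 1"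
  by (simp add: drop_nth_def)

lemma drop_nth_Cons: "drop_nth 0 (v # vs) = vs" "drop_nth (Suc i) (v # vs) = v # drop_nth i vs"
  by (simp_all add: drop_nth_def)

lemma drop_nth_map: "drop_nth i (map f vs) = map f (drop_nth i vs)"
  by (simp add: drop_nth_def take_map drop_map)

lemma wedge_covector_Cons:
  "wedge_covector \<eta> \<phi> (v # vs) = (\<Sum>j\<in>UNIV. \<eta> $ j * complex_of_real (v $ j)) * \<phi> vs - wedge_covector \<eta> (\<lambda>us. \<phi> (v # us)) vs"
  unfolding wedge_covector_def
  by (simp add: sum.lessThan_Suc_shift drop_nth_Cons sum_negf del: sum.lessThan_Suc)

lemma wedge_covector_eq_0:
  "(\<And>us. length us < length vs \<Longrightarrow> \<phi> us = 0) \<Longrightarrow> wedge_covector \<eta> \<phi> vs = 0"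
  unfolding wedge_covector_def by (intro sum.neutral) (auto simp: length_drop_nth)

lemma alternating_linear: "alternating_form \<phi> \<Longrightarrow> linear (\<lambda>v. \<phi> (us @ v # ws))"
  by (simp add: alternating_form_def)

lemma alternating_head:
  assumes "alternating_form \<phi>"
  shows "\<phi> ((a + b) # ws) = \<phi> (a # ws) + \<phi> (b # ws)" (is ?add) and "\<phi> ((a - b) # ws) = \<phi> (a # ws) - \<phi> (b # ws)" (is ?diff)
    and "\<phi> ((r *\<^sub>R a) # ws) = r *\<^sub>R \<phi> (a # ws)" (is ?scale) and "\<phi> ((- a) # ws) = - \<phi> (a # ws)" (is ?neg) and "\<phi> (0 # ws) = 0" (is ?zero)
proof -
  have l: "linear (\<lambda>v. \<phi> (v # ws))" using alternating_linear[OF assms, of "[]" ws] by simp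
  show ?add ?diff ?scale ?neg ?zero
    by (rule linear_add[OF l] linear_diff[OF l] linear_scale[OF l] linear_neg[OF l] linear_0[OF l])+
qed

lemma alternating_swap:
  assumes "alternating_form \<phi>"
  shows "\<phi> (us @ a # b # ws) = - \<phi> (us @ b # a # ws)"
proof -
  have l1: "linear (\<lambda>v. \<phi> (us @ v # w # ws))" for w by (rule alternating_linear[OF assms])
  have l2: "linear (\<lambda>v. \<phi> (us @ w # v # ws))" for w
    using alternating_linear[OF assms, of "us @ [w]" ws] by simp
  have z: "\<phi> (us @ w # w # ws) = 0" for w
  proof -
    have "\<not> distinct (us @ w # w # ws)" by simp
    then show ?thesis using assms unfolding alternating_form_def by blast
  qed
  have "0 = \<phi> (us @ (a + b) # (a + b) # ws)" by (simp only: z)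
  also have "\<dots> = \<phi> (us @ a # b # ws) + \<phi> (us @ b # a # ws)"
    unfolding linear_add[OF l1] linear_add[OF l2] by (simp add: z)
  finally have "\<phi> (us @ a # b # ws) + \<phi> (us @ b # a # ws) = 0" by (rule sym)
  then show ?thesis by (rule eq_neg_iff_add_eq_0[THEN iffD2])
qed

lemma alternating_move:
  assumes "alternating_form \<phi>"
  shows "\<phi> (us @ v # ws) = (- 1) ^ length us * \<phi> (v # us @ ws)"
proof (induction us arbitrary: ws rule: rev_induct)
  case (snoc u us)
  have "\<phi> ((us @ [u]) @ v # ws) = - \<phi> (us @ v # u # ws)"
    using alternating_swap[OF assms, of us u v ws] by simp
  then show ?case using snoc[of "u # ws"] by simp
qed simp

lemma clifford_add:
  assumes "alternating_form \<phi>"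
  shows "clifford (E + F) \<phi> vs = clifford E \<phi> vs + clifford F \<phi> vs"
  unfolding clifford_eq wedge_covector_def
  by (simp add: alternating_head[OF assms] algebra_simps sum.distrib sum_distrib_left sum_distrib_right)

lemma clifford_scale:
  assumes "alternating_form \<phi>"
  shows "clifford (c *s E) \<phi> vs = c * clifford E \<phi> vs"
proof -
  have "wedge_covector (c *s cpart E) \<phi> vs = c * wedge_covector (cpart E) \<phi> vs"
    unfolding wedge_covector_def by (simp add: sum_distrib_left sum_distrib_right mult.assoc mult.left_commute)
  moreover have "\<phi> (vpart (Re_vec (c *s E)) # vs) + \<i> * \<phi> (vpart (Im_vec (c *s E)) # vs)
      = c * (\<phi> (vpart (Re_vec E) # vs) + \<i> * \<phi> (vpart (Im_vec E) # vs))"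
    by (simp add: alternating_head[OF assms]) (simp add: complex_eq_iff algebra_simps)
  ultimately show ?thesis unfolding clifford_eq by (simp add: algebra_simps)
qed

lemma subspace_spinor_ker: "alternating_form \<phi> \<Longrightarrow> vec.subspace (spinor_ker \<phi>)"
  unfolding vec.subspace_def spinor_ker_def
  by (auto simp: clifford_add clifford_scale) (simp add: clifford_eq alternating_head wedge_covector_def)

text \<open>An element of the kernel trades a tangent argument of \<open>\<phi>\<close> for values of \<open>\<phi>\<close> on shorter lists. The
  inductions on the length in this section rest on it.\<close>

lemma spinor_ker_cons:
  assumes "E \<in> spinor_ker \<phi>"
  shows "\<phi> (vpart (Re_vec E) # vs) + \<i> * \<phi> (vpart (Im_vec E) # vs) = - wedge_covector (cpart E) \<phi> vs"
  using assms unfolding spinor_ker_def clifford_eq by (auto simp: eq_neg_iff_add_eq_0)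

text \<open>Use \<open>spinor_ker_cons\<close> for \<open>F\<close>: one term is \<open>\<phi>\<close> times the pairing of the covector part of \<open>F\<close> with the tangent part
  of \<open>E\<close>. In the other terms the tangent part of \<open>E\<close> is still an argument, and \<open>spinor_ker_cons\<close> for \<open>E\<close> turns them into
  values of \<open>\<phi>\<close> on shorter lists.\<close>

lemma spinor_ker_double:
  assumes "E \<in> spinor_ker \<phi>" "F \<in> spinor_ker \<phi>" "\<And>us. length us < length vs \<Longrightarrow> \<phi> us = 0"
  shows "(\<phi> (vpart (Re_vec F) # vpart (Re_vec E) # vs) + \<i> * \<phi> (vpart (Im_vec F) # vpart (Re_vec E) # vs))
     + \<i> * (\<phi> (vpart (Re_vec F) # vpart (Im_vec E) # vs) + \<i> * \<phi> (vpart (Im_vec F) # vpart (Im_vec E) # vs))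
     = - (\<Sum>i\<in>UNIV. cpart F $ i * vpart E $ i) * \<phi> vs"
proof -
  let ?a = "vpart (Re_vec E)" and ?b = "vpart (Im_vec E)"
  have "wedge_covector (cpart F) (\<lambda>us. \<phi> (?a # us)) vs + \<i> * wedge_covector (cpart F) (\<lambda>us. \<phi> (?b # us)) vs
     = wedge_covector (cpart F) (\<lambda>us. \<phi> (?a # us) + \<i> * \<phi> (?b # us)) vs"
    unfolding wedge_covector_def by (simp add: algebra_simps sum.distrib sum_distrib_left)
  also have "\<dots> = wedge_covector (cpart F) (\<lambda>us. - wedge_covector (cpart E) \<phi> us) vs"
    by (simp add: spinor_ker_cons[OF assms(1)])
  also have "\<dots> = 0"
    by (intro wedge_covector_eq_0, subst neg_equal_0_iff_equal, intro wedge_covector_eq_0 assms(3)) auto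
  finally have w: "wedge_covector (cpart F) (\<lambda>us. \<phi> (?a # us)) vs + \<i> * wedge_covector (cpart F) (\<lambda>us. \<phi> (?b # us)) vs = 0" .
  have "vpart E $ j = complex_of_real (?a $ j) + \<i> * complex_of_real (?b $ j)" for j
    by (simp add: complex_eq_iff vpart_def Re_Im_vec_nth)
  then have s: "(\<Sum>i\<in>UNIV. cpart F $ i * vpart E $ i) = (\<Sum>j\<in>UNIV. cpart F $ j * complex_of_real (?a $ j))
      + \<i> * (\<Sum>j\<in>UNIV. cpart F $ j * complex_of_real (?b $ j))"
    by (simp add: sum.distrib sum_distrib_left algebra_simps)
  show ?thesis
    unfolding spinor_ker_cons[OF assms(2)] wedge_covector_Cons s using w by (simp add: algebra_simps)
qed

text \<open>The Clifford relation \<open>E \<cdot> F \<cdot> \<phi> + F \<cdot> E \<cdot> \<phi> = cpair E F \<phi>\<close>, one degree at a time: by \<open>spinor_ker_double\<close>, the double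
  contractions in both orders are multiples of \<open>\<phi>\<close>. They are opposite, and their factors add up to \<open>- cpair E F\<close>.\<close>

lemma spinor_ker_isotropic:
  assumes alt: "alternating_form \<phi>" and "E \<in> spinor_ker \<phi>" "F \<in> spinor_ker \<phi>" "cpair E F \<noteq> 0"
  shows "\<phi> vs = 0"
proof (induction vs rule: length_induct)
  case (1 vs)
  then have IH: "\<And>us. length us < length vs \<Longrightarrow> \<phi> us = 0" by blast
  have sw: "\<phi> (a # b # vs) = - \<phi> (b # a # vs)" for a b using alternating_swap[OF alt, of "[]" a b vs] by simp
  let ?a = "vpart (Re_vec E)" and ?b = "vpart (Im_vec E)" and ?c = "vpart (Re_vec F)" and ?d = "vpart (Im_vec F)"
  have d1: "(\<phi> (?c # ?a # vs) + \<i> * \<phi> (?d # ?a # vs)) + \<i> * (\<phi> (?c # ?b # vs) + \<i> * \<phi> (?d # ?b # vs))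
      = - (\<Sum>i\<in>UNIV. cpart F $ i * vpart E $ i) * \<phi> vs"
    by (rule spinor_ker_double[OF assms(2,3)]) (rule IH)
  have d2: "(\<phi> (?a # ?c # vs) + \<i> * \<phi> (?b # ?c # vs)) + \<i> * (\<phi> (?a # ?d # vs) + \<i> * \<phi> (?b # ?d # vs))
      = - (\<Sum>i\<in>UNIV. cpart E $ i * vpart F $ i) * \<phi> vs"
    by (rule spinor_ker_double[OF assms(3,2)]) (rule IH)
  have "- cpair E F * \<phi> vs = (\<phi> (?c # ?a # vs) + \<i> * \<phi> (?d # ?a # vs) + \<i> * (\<phi> (?c # ?b # vs) + \<i> * \<phi> (?d # ?b # vs)))
     + (\<phi> (?a # ?c # vs) + \<i> * \<phi> (?b # ?c # vs) + \<i> * (\<phi> (?a # ?d # vs) + \<i> * \<phi> (?b # ?d # vs)))"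
    unfolding d1 d2 by (simp add: cpair_def algebra_simps)
  also have "\<dots> = 0"
    unfolding sw[of ?a ?c] sw[of ?b ?c] sw[of ?a ?d] sw[of ?b ?d] by (simp add: algebra_simps)
  finally have "cpair E F * \<phi> vs = 0" by simp
  then show ?case using assms(4) by simp
qed

text \<open>Replace the arguments one by one by vectors tangent to the submanifold, moving each of them to the
  front. The error term is \<open>\<phi>\<close> on shorter lists, which vanishes by the outer induction.\<close>

lemma pullback_eq_0_imp:
  fixes D :: "real ^ 'm::finite ^ 'n::finite"
  assumes alt: "alternating_form \<phi>"
    and split: "\<And>v. \<exists>w. \<exists>E\<in>spinor_ker \<phi>. vpart (Re_vec E) = v - D *v w \<and> vpart (Im_vec E) = 0"
    and zero: "\<And>ws. \<phi> (map ((*v) D) ws) = 0"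
  shows "\<phi> vs = 0"
proof (induction vs rule: length_induct)
  case (1 vs)
  have "\<phi> (map ((*v) D) us @ vs') = 0" if "length us + length vs' = length vs" for us vs'
    using that
  proof (induction vs' arbitrary: us)
    case Nil
    then show ?case using zero by simp
  next
    case (Cons v vs')
    obtain w E where E: "E \<in> spinor_ker \<phi>" "vpart (Re_vec E) = v - D *v w" "vpart (Im_vec E) = 0"
      using split by blast
    have "\<phi> ((v - D *v w) # (map ((*v) D) us @ vs')) = 0"
    proof -
      have "wedge_covector (cpart E) \<phi> (map ((*v) D) us @ vs') = 0"
        by (rule wedge_covector_eq_0) (use "1" Cons.prems in auto)
      then show ?thesis
        using spinor_ker_cons[OF E(1), of "map ((*v) D) us @ vs'"] by (simp add: E(2,3) alternating_head(5)[OF alt])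
    qed
    then have "\<phi> (map ((*v) D) us @ (v - D *v w) # vs') = 0"
      using alternating_move[OF alt] by simp
    moreover have "\<phi> (map ((*v) D) us @ (D *v w) # vs') = 0"
      using Cons.IH[of "us @ [w]"] Cons.prems by simp
    ultimately show ?case
      using linear_diff[OF alternating_linear[OF alt]] by (metis diff_zero)
  qed
  from this[of "[]" vs] show ?case by simp
qed

lemma clifford_pullback:
  fixes D :: "real ^ 'm::finite ^ 'n::finite"
  assumes "vpart E = cmat D *v vpart x" "cpart x = cmat (transpose D) *v cpart E"
  shows "clifford x (\<lambda>ws. \<phi> (map ((*v) D) ws)) ws = clifford E \<phi> (map ((*v) D) ws)"
proof -
  have "(\<Sum>j\<in>UNIV. cpart x $ j * complex_of_real (w $ j)) = (\<Sum>j\<in>UNIV. cpart E $ j * complex_of_real ((D *v w) $ j))" for w :: "real ^ 'm"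
    unfolding assms(2) matrix_vector_mult_def
    by (simp add: sum_distrib_left sum_distrib_right transpose_def mult_ac, subst sum.swap, simp)
  moreover have "vpart (Re_vec E) = D *v vpart (Re_vec x)" "vpart (Im_vec E) = D *v vpart (Im_vec x)"
    using arg_cong[OF assms(1), of Re_vec] arg_cong[OF assms(1), of Im_vec] by simp_all
  ultimately show ?thesis
    unfolding clifford_eq wedge_covector_def by (simp add: drop_nth_map)
qed

lemma alternating_pullback:
  fixes D :: "real ^ 'm::finite ^ 'n::finite"
  assumes "alternating_form \<phi>"
  shows "alternating_form (\<lambda>ws. \<phi> (map ((*v) D) ws))"
  unfolding alternating_form_def
proof (intro conjI allI impI)
  fix us ws
  show "linear (\<lambda>v. \<phi> (map ((*v) D) (us @ v # ws)))"
    using linear_compose[OF matrix_vector_mul_linear[of D] alternating_linear[OF assms, of "map ((*v) D) us" "map ((*v) D) ws"]]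
    by (simp add: o_def)
next
  fix vs :: "(real ^ 'm) list" assume "\<not> distinct vs"
  then have "\<not> distinct (map ((*v) D) vs)" by (simp add: distinct_map)
  then show "\<phi> (map ((*v) D) vs) = 0" using assms by (simp add: alternating_form_def)
qed

text \<open>The reduced eigenspace annihilates the pull back because its lift annihilates \<open>\<phi>\<close>; it is
  the full kernel because it is maximal isotropic and the pull back does not vanish.\<close>

lemma (in kaehler_point) spinor_ker_pullback:
  assumes alt: "alternating_form \<phi>" and ker: "spinor_ker \<phi> = eigenspace_minus_i J1" and nz: "\<phi> vs \<noteq> 0"
    and K: "\<And>x. J1 *v (\<Lambda> *v x) = \<Lambda> *v (K *v x)" "K \<in> SO_gen" "K ** K = - mat 1"
  shows "spinor_ker (\<lambda>ws. \<phi> (map ((*v) D) ws)) = eigenspace_minus_i K" (is "spinor_ker ?\<phi>M = _")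
proof
  show sub: "eigenspace_minus_i K \<subseteq> spinor_ker ?\<phi>M"
  proof
    fix x assume x: "x \<in> eigenspace_minus_i K"
    let ?E = "cmat \<Lambda> *v x"
    have "?E \<in> spinor_ker \<phi>"
      using x unfolding ker mem_eigenspace_minus_i by (simp add: K)
    moreover have "vpart ?E = cmat D *v vpart x" "cpart x = cmat (transpose D) *v cpart ?E"
      using is_lift_\<Lambda> unfolding is_lift_def by (simp_all add: complex_vec_eq_iff)
    ultimately show "x \<in> spinor_ker ?\<phi>M"
      unfolding spinor_ker_def using clifford_pullback[of ?E D x \<phi>] by simp
  qed
  have "\<exists>ws. ?\<phi>M ws \<noteq> 0"
  proof (rule ccontr)
    assume z: "\<nexists>ws. ?\<phi>M ws \<noteq> 0"
    have "\<phi> vs = 0"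
    proof (rule pullback_eq_0_imp[OF alt])
      fix v
      obtain w \<eta> where \<eta>: "transpose D *v \<eta> = 0" "v = D *v w + vpart (G *v gjoin 0 \<eta>)"
        using tangent_vector_split by blast
      define N :: "real ^ ('n + 'n)" where "N = gjoin 0 \<eta>"
      have N: "N \<in> conormal D" using \<eta>(1) by (auto simp: N_def conormal_eq)
      \<comment> \<open>in the kernel; its tangent part is real because \<open>J0 N\<close> is conormal, and it is that of \<open>- G N\<close>\<close>
      define E where "E = cvec (J1 *v (J0 *v N)) - \<i> *s cvec (J0 *v N)"
      have "E \<in> spinor_ker \<phi>" unfolding ker mem_eigenspace_minus_i by (simp add: E_def)
      then have "- E \<in> spinor_ker \<phi>" unfolding ker mem_eigenspace_minus_i by simp
      moreover have "vpart (Re_vec (- E)) = v - D *v w" "vpart (Im_vec (- E)) = 0"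
        using \<eta>(2) vpart_conormal[OF J0_conormal[OF N]] by (simp_all add: E_def J1J0 Gv N_def)
      ultimately show "\<exists>w. \<exists>E\<in>spinor_ker \<phi>. vpart (Re_vec E) = v - D *v w \<and> vpart (Im_vec E) = 0"
        by blast
    next
      show "\<phi> (map ((*v) D) ws) = 0" for ws using z by simp
    qed
    with nz show False ..
  qed
  then obtain ws where ws: "?\<phi>M ws \<noteq> 0" by blast
  show "spinor_ker ?\<phi>M \<subseteq> eigenspace_minus_i K"
  proof
    fix x assume x: "x \<in> spinor_ker ?\<phi>M"
    show "x \<in> eigenspace_minus_i K"
    proof (rule eigenspace_maximal[OF K(2,3)])
      show "cpair x y = 0" if "y \<in> eigenspace_minus_i K" for y
        using spinor_ker_isotropic[OF alternating_pullback[OF alt] x] sub that ws by blast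
    qed
  qed
qed

lemma spinor_with_small_ker_nonzero:
  fixes \<phi> :: "'n::finite cform"
  assumes "vec.dim (spinor_ker \<phi>) = CARD('n)"
  shows "\<exists>vs. \<phi> vs \<noteq> 0"
proof (rule ccontr)
  assume "\<nexists>vs. \<phi> vs \<noteq> 0"
  then have "spinor_ker \<phi> = UNIV" by (auto simp: spinor_ker_def clifford_eq wedge_covector_def)
  then have "vec.dim (UNIV :: (complex ^ ('n + 'n)) set) = CARD('n)" using assms by simp
  then show False unfolding vec_dim_card by simp
qed

text \<open>By non-degeneracy, taking real parts is a bijection from the kernel \<open>K\<close> to the real vectors; let \<open>s\<close> be
  its inverse. Then \<open>J\<close> is the imaginary part of \<open>s\<close>. It squares to \<open>-1\<close> because \<open>K\<close> is stable under \<open>\<i>\<close>, and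
  it is orthogonal because \<open>K\<close> is isotropic.\<close>

lemma spinor_structure_ex:
  fixes \<phi> :: "'n::finite cform"
  assumes alt: "alternating_form \<phi>" and dim: "vec.dim (spinor_ker \<phi>) = CARD('n)"
    and disj: "spinor_ker \<phi> \<inter> cnj_vec ` spinor_ker \<phi> = {0}"
    and sum: "{E + F | E F. E \<in> spinor_ker \<phi> \<and> F \<in> cnj_vec ` spinor_ker \<phi>} = UNIV"
  shows "\<exists>J \<in> SO_gen. J ** J = - mat 1 \<and> eigenspace_minus_i J = spinor_ker \<phi>"
proof -
  let ?K = "spinor_ker \<phi>"
  have sub: "vec.subspace ?K" by (rule subspace_spinor_ker[OF alt])
  have add: "E + F \<in> ?K" and diff: "E - F \<in> ?K" if "E \<in> ?K" "F \<in> ?K" for E F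
    using sub that vec.subspace_add vec.subspace_diff by auto
  have scale: "c *s E \<in> ?K" if "E \<in> ?K" for c E using sub that vec.subspace_scale by auto
  have iso: "cpair E F = 0" if "E \<in> ?K" "F \<in> ?K" for E F
    using spinor_with_small_ker_nonzero[OF dim] spinor_ker_isotropic[OF alt that] by blast
  have inj: "E = F" if "E \<in> ?K" "F \<in> ?K" "Re_vec E = Re_vec F" for E F
  proof -
    have "E - F = cnj_vec (- 1 *s (E - F))" using that(3) by (simp add: complex_vec_eq_iff)
    moreover have "E - F \<in> ?K" "- 1 *s (E - F) \<in> ?K" using diff scale that by blast+
    ultimately have "E - F \<in> ?K \<inter> cnj_vec ` ?K" by blast
    then show ?thesis using disj by simp
  qed
  have surj: "\<exists>E\<in>?K. Re_vec E = a" for a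
  proof -
    obtain E F where EF: "E \<in> ?K" "F \<in> ?K" "cvec a = E + cnj_vec F" using sum by blast
    have "Re_vec E + Re_vec F = a" using arg_cong[OF EF(3), of Re_vec] by simp
    then show ?thesis using add[OF EF(1,2)] by (intro bexI[of _ "E + F"]) auto
  qed
  define s where "s a = (THE E. E \<in> ?K \<and> Re_vec E = a)" for a
  have s: "s a \<in> ?K" "Re_vec (s a) = a" for a
    using theI'[of "\<lambda>E. E \<in> ?K \<and> Re_vec E = a"] surj[of a] inj unfolding s_def by blast+
  have s_eqI: "E \<in> ?K \<Longrightarrow> s (Re_vec E) = E" for E using inj s by blast
  have "linear (\<lambda>a. Im_vec (s a))"
  proof (rule linearI)
    show "Im_vec (s (a + b)) = Im_vec (s a) + Im_vec (s b)" for a b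
      using s_eqI[OF add[OF s(1)[of a] s(1)[of b]]] by (simp add: s)
    show "Im_vec (s (r *\<^sub>R a)) = r *\<^sub>R Im_vec (s a)" for r a
      using s_eqI[OF scale[OF s(1)[of a], of "complex_of_real r"]] by (simp add: s)
  qed
  then obtain J where J: "\<And>a. J *v a = Im_vec (s a)" by (metis matrix_works linear_linear matrix_vector_mul)
  have JJ: "J *v (J *v a) = - a" for a
    using s_eqI[OF scale[OF s(1)[of a], of "- \<i>"]] by (simp add: s J)
  have sq: "J ** J = - mat 1" by (simp add: matrix_eq matrix_vector_mul_assoc[symmetric] JJ)
  have "gpair (J *v a) (J *v b) = gpair a b" for a b
    using iso[OF s(1)[of a] s(1)[of b]] by (simp add: complex_eq_iff Re_cpair s J)
  then have SO: "J \<in> SO_gen" by (simp add: SO_gen_def det_complex_structure[OF sq])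
  have "eigenspace_minus_i J = ?K"
  proof (intro set_eqI iffI)
    fix E assume "E \<in> eigenspace_minus_i J"
    then have "E = s (Re_vec E)" by (simp add: mem_eigenspace_minus_i J complex_vec_eq_iff s)
    then show "E \<in> ?K" using s(1) by metis
  next
    fix E assume "E \<in> ?K"
    then have "J *v Re_vec E = Im_vec E" by (simp add: J s_eqI)
    then show "E \<in> eigenspace_minus_i J" using JJ[of "Re_vec E"] by (simp add: mem_eigenspace_minus_i)
  qed
  then show ?thesis using SO sq by blast
qed

lemma spinor_structure_eqI:
  assumes "J \<in> SO_gen" "J ** J = - mat 1" "eigenspace_minus_i J = spinor_ker (\<psi> c p)"
  shows "spinor_structure \<psi> c p = J"
  unfolding spinor_structure_def
  by (rule the_equality) (use assms eigenspace_determines_structure[OF assms(2)] in auto)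

section \<open>Charts and Jacobians\<close>

abbreviation chart_inv :: "('x, 'n::finite) chart \<Rightarrow> real ^ 'n \<Rightarrow> 'x" where
  "chart_inv c \<equiv> inv_into (fst c) (snd c)"

lemma chart_props:
  assumes "smooth_manifold X" "c \<in> atlas X"
  shows "inj_on (snd c) (fst c)" "openin (topo X) (fst c)" "fst c \<subseteq> topspace (topo X)"
proof -
  have h: "homeomorphic_map (subtopology (topo X) (fst c)) (top_of_set (snd c ` fst c)) (snd c)"
    and o: "openin (topo X) (fst c)"
    using assms by (auto simp: smooth_manifold_def)
  show "openin (topo X) (fst c)" by fact
  then show sub: "fst c \<subseteq> topspace (topo X)" by (rule openin_subset)
  then show "inj_on (snd c) (fst c)"
    using homeomorphic_imp_injective_map[OF h] by (simp add: inf.absorb2)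
qed

lemma chart_inv [simp]: "smooth_manifold X \<Longrightarrow> c \<in> atlas X \<Longrightarrow> p \<in> fst c \<Longrightarrow> chart_inv c (snd c p) = p"
  using chart_props(1) by (metis inv_into_f_f)

lemma open_chart_image:
  assumes "smooth_manifold X" "c \<in> atlas X" "openin (topo X) W"
  shows "open (snd c ` (fst c \<inter> W))"
proof -
  have h: "homeomorphic_map (subtopology (topo X) (fst c)) (top_of_set (snd c ` fst c)) (snd c)"
    and o: "open (snd c ` fst c)"
    using assms by (auto simp: smooth_manifold_def)
  have "openin (subtopology (topo X) (fst c)) (fst c \<inter> W)"
    using assms(3) by (metis inf_commute openin_subtopology_Int)
  then have "openin (top_of_set (snd c ` fst c)) (snd c ` (fst c \<inter> W))"
    using homeomorphic_imp_open_map[OF h] unfolding open_map_def by blast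
  then show ?thesis using o openin_open_trans by blast
qed

lemma open_chart: "smooth_manifold X \<Longrightarrow> c \<in> atlas X \<Longrightarrow> open (snd c ` fst c)"
  by (simp add: smooth_manifold_def)

lemma openin_preimage:
  assumes "smooth_manifold M" "smooth_manifold X" "smooth_map M X f" "c \<in> atlas M" "c' \<in> atlas X"
  shows "openin (topo M) (fst c \<inter> f -` fst c')"
proof -
  have "continuous_map (topo M) (topo X) f" using assms(3) by (simp add: smooth_map_def)
  then have "openin (topo M) {x \<in> topspace (topo M). f x \<in> fst c'}"
    using chart_props(2)[OF assms(2,5)] by (auto simp: continuous_map_def)
  then have "openin (topo M) (fst c \<inter> {x \<in> topspace (topo M). f x \<in> fst c'})"
    using chart_props(2)[OF assms(1,4)] by (rule openin_Int[rotated])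
  moreover have "fst c \<inter> {x \<in> topspace (topo M). f x \<in> fst c'} = fst c \<inter> f -` fst c'"
    using chart_props(3)[OF assms(1,4)] by auto
  ultimately show ?thesis by simp
qed

lemma smooth_map_id: "smooth_manifold X \<Longrightarrow> smooth_map X X id"
  by (auto simp: smooth_map_def smooth_manifold_def)

lemma open_preimage:
  assumes "smooth_manifold M" "smooth_manifold X" "smooth_map M X f" "c \<in> atlas M" "c' \<in> atlas X"
  shows "open (snd c ` (fst c \<inter> f -` fst c'))"
  using open_chart_image[OF assms(1,4) openin_preimage[OF assms]] by (simp add: Int_absorb1 inf_assoc[symmetric])

lemma smooth_on_rep:
  assumes "smooth_map M X f" "c \<in> atlas M" "c' \<in> atlas X"
  shows "smooth_on (snd c ` (fst c \<inter> f -` fst c')) (snd c' \<circ> f \<circ> chart_inv c)"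
  using assms unfolding smooth_map_def smooth_in_def by (simp add: comp_assoc)

lemma has_derivative_rep:
  assumes "smooth_map M X f" "c \<in> atlas M" "c' \<in> atlas X" "p \<in> fst c" "f p \<in> fst c'"
  shows "((snd c' \<circ> f \<circ> chart_inv c) has_derivative ((*v) (jacobian c c' f p))) (at (snd c p))"
proof -
  have D: "((snd c' \<circ> f \<circ> chart_inv c) has_derivative frechet_derivative (snd c' \<circ> f \<circ> chart_inv c) (at (snd c p))) (at (snd c p))"
    by (rule smooth_on_has_derivative[OF smooth_on_rep[OF assms(1-3)]]) (use assms in auto)
  then have "linear (frechet_derivative (snd c' \<circ> f \<circ> chart_inv c) (at (snd c p)))"
    by (rule has_derivative_linear)
  then have "(*v) (jacobian c c' f p) = frechet_derivative (snd c' \<circ> f \<circ> chart_inv c) (at (snd c p))"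
    unfolding jacobian_def cderiv_def comp_assoc by (simp add: fun_eq_iff cderiv_def eta_contract_eq)
  then show ?thesis using D by simp
qed

lemma jacobian_eqI:
  assumes "((snd c' \<circ> f \<circ> chart_inv c) has_derivative ((*v) A)) (at (snd c p))"
  shows "jacobian c c' f p = A"
  using frechet_derivative_at[OF assms] unfolding jacobian_def cderiv_def
  by (metis comp_assoc matrix_of_matrix_vector_mul)

lemma jacobian_compose:
  assumes M: "smooth_manifold M" and X: "smooth_manifold X" and f: "smooth_map M X f" and g: "smooth_map X Y g"
    and c: "c \<in> atlas M" "c' \<in> atlas X" "c'' \<in> atlas Y" and p: "p \<in> fst c" "f p \<in> fst c'" "g (f p) \<in> fst c''"
  shows "jacobian c c'' (g \<circ> f) p = jacobian c' c'' g (f p) ** jacobian c c' f p"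
proof (rule jacobian_eqI)
  have eq: "(snd c' \<circ> f \<circ> chart_inv c) (snd c p) = snd c' (f p)" using M c p by simp
  have "((snd c'' \<circ> g \<circ> chart_inv c') has_derivative (*v) (jacobian c' c'' g (f p))) (at ((snd c' \<circ> f \<circ> chart_inv c) (snd c p)))"
    unfolding eq by (rule has_derivative_rep[OF g c(2,3) p(2,3)])
  from diff_chain_at[OF has_derivative_rep[OF f c(1,2) p(1,2)] this]
  have "((snd c'' \<circ> g \<circ> chart_inv c') \<circ> (snd c' \<circ> f \<circ> chart_inv c) has_derivative (*v) (jacobian c' c'' g (f p) ** jacobian c c' f p)) (at (snd c p))"
    by (simp add: o_def matrix_vector_mul_assoc)
  then show "(snd c'' \<circ> (g \<circ> f) \<circ> chart_inv c has_derivative (*v) (jacobian c' c'' g (f p) ** jacobian c c' f p)) (at (snd c p))"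
  proof (rule has_derivative_transform_within_open[OF _ open_preimage[OF M X f c(1,2)]])
    show "snd c p \<in> snd c ` (fst c \<inter> f -` fst c')" using p by auto
    fix x assume "x \<in> snd c ` (fst c \<inter> f -` fst c')"
    then show "((snd c'' \<circ> g \<circ> chart_inv c') \<circ> (snd c' \<circ> f \<circ> chart_inv c)) x = (snd c'' \<circ> (g \<circ> f) \<circ> chart_inv c) x"
      using M X c by auto
  qed
qed

lemma jacobian_id:
  assumes "smooth_manifold X" "c \<in> atlas X" "p \<in> fst c"
  shows "jacobian c c id p = mat 1"
proof (rule jacobian_eqI)
  have o: "open (snd c ` fst c)" using assms by (auto simp: smooth_manifold_def)
  have "(*v) (mat 1 :: real ^ 'b ^ 'b) = (\<lambda>x. x)" by (simp add: fun_eq_iff)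
  then have "((\<lambda>x. x) has_derivative (*v) (mat 1 :: real ^ 'b ^ 'b)) (at (snd c p))" by simp
  then show "(snd c \<circ> id \<circ> chart_inv c has_derivative (*v) (mat 1)) (at (snd c p))"
    by (rule has_derivative_transform_within_open[OF _ o]) (use assms in auto)
qed

lemma jacobian_inverse:
  assumes X: "smooth_manifold X" and c: "c \<in> atlas X" "c' \<in> atlas X" "p \<in> fst c" "p \<in> fst c'"
  shows "jacobian c' c id p ** jacobian c c' id p = mat 1"
  using jacobian_compose[OF X X smooth_map_id[OF X] smooth_map_id[OF X] c(1,2,1)] c jacobian_id[OF X c(1,3)] by simp

lemma smooth_on_jacobian:
  assumes M: "smooth_manifold M" and X: "smooth_manifold X" and f: "smooth_map M X f" and c: "c \<in> atlas M" "c' \<in> atlas X"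
  shows "smooth_on (snd c ` (fst c \<inter> f -` fst c')) (\<lambda>x. jacobian c c' f (chart_inv c x))"
proof (rule smooth_on_cong[OF open_preimage[OF assms]])
  show "smooth_on (snd c ` (fst c \<inter> f -` fst c')) (\<lambda>x. matrix (frechet_derivative (snd c' \<circ> f \<circ> chart_inv c) (at x)))"
    by (rule smooth_on_matrix[OF open_preimage[OF assms]], rule smooth_on_frechet_derivative, rule smooth_on_rep) fact+
  fix x assume "x \<in> snd c ` (fst c \<inter> f -` fst c')"
  then have "snd c (chart_inv c x) = x" using M c by auto
  then show "matrix (frechet_derivative (snd c' \<circ> f \<circ> chart_inv c) (at x)) = jacobian c c' f (chart_inv c x)"
    unfolding jacobian_def cderiv_def comp_assoc by (simp add: cderiv_def)
qed

lemma smooth_on_pullback: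
  assumes M: "smooth_manifold M" and X: "smooth_manifold X" and f: "smooth_map M X f" and c: "c \<in> atlas M" "c' \<in> atlas X"
    and g: "smooth_in c' UNIV g"
  shows "smooth_on (snd c ` (fst c \<inter> f -` fst c')) (\<lambda>x. g (f (chart_inv c x)))"
proof (rule smooth_on_cong[OF open_preimage[OF M X f c]])
  have o: "open (snd c' ` fst c')" by (rule open_chart[OF X c(2)])
  have g': "smooth_on (snd c' ` fst c') (g \<circ> chart_inv c')" using g by (simp add: smooth_in_def)
  show "smooth_on (snd c ` (fst c \<inter> f -` fst c')) (\<lambda>x. (g \<circ> chart_inv c') ((snd c' \<circ> f \<circ> chart_inv c) x))"
    by (rule smooth_on_compose[OF open_preimage[OF M X f c] o _ g' smooth_on_rep[OF f c]]) (use M c in auto)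
  show "(g \<circ> chart_inv c') ((snd c' \<circ> f \<circ> chart_inv c) x) = g (f (chart_inv c x))"
    if "x \<in> snd c ` (fst c \<inter> f -` fst c')" for x
    using that M X c by auto
qed

lemma smooth_in_local:
  assumes "smooth_manifold X" "c \<in> atlas X" 
    "\<And>p. p \<in> fst c \<Longrightarrow> \<exists>W. openin (topo X) W \<and> p \<in> W \<and> smooth_in c W g"
  shows "smooth_in c UNIV g"
  unfolding smooth_in_def
proof (rule smooth_on_local)
  fix x assume "x \<in> snd c ` (fst c \<inter> UNIV)"
  then obtain p where p: "p \<in> fst c" "x = snd c p" by auto
  then obtain W where W: "openin (topo X) W" "p \<in> W" "smooth_in c W g" using assms(3) by blast
  then show "\<exists>T. open T \<and> x \<in> T \<and> smooth_on T (g \<circ> chart_inv c)"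
    using p open_chart_image[OF assms(1,2) W(1)] unfolding smooth_in_def by blast
qed

lemma chart_at: "smooth_manifold X \<Longrightarrow> x \<in> topspace (topo X) \<Longrightarrow> chart_at X x \<in> atlas X \<and> x \<in> fst (chart_at X x)"
  unfolding chart_at_def by (rule someI_ex) (auto simp: smooth_manifold_def)

lemma gtrans_inverse:
  fixes A B :: "'a::comm_ring_1 ^ 'n::finite ^ 'n"
  assumes "B ** A = mat 1"
  shows "gtrans B A (gtrans A B E) = E"
proof -
  have "transpose A ** transpose B = mat 1" using assms by (metis matrix_transpose_mul transpose_mat)
  then show ?thesis using assms by (simp add: gtrans_def gvec_eq_iff matrix_vector_mul_assoc)
qed

text \<open>A change of the chart of \<open>X\<close>, with Jacobian \<open>A\<close> and inverse Jacobian \<open>B\<close>.\<close>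

lemma induced_rel_change_target:
  fixes A B :: "real ^ 'n::finite ^ 'n" and D :: "real ^ 'm::finite ^ 'n"
  assumes "B ** A = mat 1" "A ** B = mat 1" "\<And>E. J' *v gtrans A B E = gtrans A B (J *v E)" "induced_rel J' (A ** D) K"
  shows "induced_rel J D K"
  unfolding induced_rel_def
proof (intro allI impI)
  fix E F assume EF: "J *v restr_incl D E = restr_incl D F"
  have t: "transpose A ** transpose B = mat 1" using assms(1) by (metis matrix_transpose_mul transpose_mat)
  define tr where "tr E = gjoin (vpart E) (transpose B *v cpart E)" for E :: "real ^ ('m + 'n)"
  have i: "restr_incl (A ** D) (tr E) = gtrans A B (restr_incl D E)" for E
    by (simp add: tr_def restr_incl_def gtrans_def matrix_vector_mul_assoc gvec_eq_iff)
  have p: "restr_proj (A ** D) (tr E) = restr_proj D E" for E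
    by (simp add: tr_def restr_proj_def gvec_eq_iff matrix_transpose_mul matrix_vector_mul_assoc matrix_mul_assoc[symmetric] t)
  show "K *v restr_proj D E = restr_proj D F"
    using assms(4) unfolding induced_rel_def by (metis EF assms(3) i p)
qed

lemma matrix_gtrans_conjugate:
  fixes A B :: "real ^ 'm::finite ^ 'm"
  shows "matrix (\<lambda>x. gtrans B A (K *v gtrans A B x)) *v E = gtrans B A (K *v gtrans A B E)"
proof -
  have lin: "linear (gtrans A B)" for A B :: "real ^ 'm ^ 'm"
    by (rule linearI) (simp_all add: gtrans_def gvec_eq_iff matrix_vector_right_distrib matrix_vector_mult_scaleR)
  have "linear (\<lambda>x. gtrans B A (K *v gtrans A B x))"
    using linear_compose[OF linear_compose[OF lin[of A B] matrix_vector_mul_linear[of K]] lin[of B A]] by (simp add: o_def)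
  then show ?thesis by simp
qed

text \<open>A change of the chart of \<open>M\<close>, with Jacobian \<open>A\<close> and inverse Jacobian \<open>B\<close>.\<close>

lemma induced_rel_change_source:
  fixes A B :: "real ^ 'm::finite ^ 'm" and D :: "real ^ 'm ^ 'n::finite"
  assumes "B ** A = mat 1" "A ** B = mat 1" "induced_rel J (D ** B) K'" 
  shows "induced_rel J D (matrix (\<lambda>x. gtrans B A (K' *v gtrans A B x)))"
  unfolding induced_rel_def
proof (intro allI impI)
  fix E F assume EF: "J *v restr_incl D E = restr_incl D F"
  define tr where "tr E = gjoin (A *v vpart E) (cpart E)" for E :: "real ^ ('m + 'n)"
  have i: "restr_incl (D ** B) (tr E) = restr_incl D E" for E
    by (simp add: tr_def restr_incl_def matrix_vector_mul_assoc gvec_eq_iff matrix_mul_assoc[symmetric] assms(1))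
  have p: "restr_proj (D ** B) (tr E) = gtrans A B (restr_proj D E)" for E
    by (simp add: tr_def restr_proj_def gtrans_def gvec_eq_iff matrix_transpose_mul matrix_vector_mul_assoc)
  have "K' *v gtrans A B (restr_proj D E) = gtrans A B (restr_proj D F)"
    using assms(3) unfolding induced_rel_def by (metis EF i p)
  then have *: "gtrans B A (K' *v gtrans A B (restr_proj D E)) = restr_proj D F"
    by (simp add: gtrans_inverse[OF assms(1)])
  show "matrix (\<lambda>x. gtrans B A (K' *v gtrans A B x)) *v restr_proj D E = restr_proj D F"
    unfolding matrix_gtrans_conjugate by (rule *)
qed

section \<open>The reduced structures on the submanifold\<close>

locale kaehler_submanifold =
  fixes X :: "('x, 'n::finite) manifold" and M :: "('y, 'm::finite) manifold"
    and f :: "'y \<Rightarrow> 'x" and J0 :: "('x, 'n) gend" and \<psi> :: "('x, 'n) cform_field"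
  assumes X: "smooth_manifold X" and gk: "generalized_kaehler_one_spinor X J0 \<psi>"
    and M: "smooth_manifold M" and emb: "smooth_embedding M X f" and inv: "conormal_invariant M X f J0"
begin

definition \<psi>M :: "('y, 'm) cform_field" where "\<psi>M = form_pullback X f \<psi>"
text \<open>\<open>K0\<close> and \<open>K1\<close> are the structures on \<open>M\<close> that correspond to \<open>J0\<close> and \<open>J1\<close>.\<close>

definition K0 :: "('y, 'm) gend" where "K0 = induced_structure X f J0"
definition K1 :: "('y, 'm) gend" where "K1 = spinor_structure \<psi>M"
abbreviation J1 :: "('x, 'n) gend" where "J1 \<equiv> spinor_structure \<psi>"
abbreviation G :: "('x, 'n) gend" where "G \<equiv> (\<lambda>c p. - (J0 c p ** J1 c p))"
abbreviation \<Lambda> where "\<Lambda> c c' q \<equiv> kaehler_point.\<Lambda> (jacobian c c' f q) (G c' (f q))"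

lemma f_smooth: "smooth_map M X f"
  using emb by (simp add: smooth_embedding_def)

lemma ambient_structures: "generalized_kaehler X J0 J1" "gc_structure X J0" "gc_structure X J1"
  "smooth_SO_section X J0" "smooth_SO_section X J1" "generalized_metric X G"
  using gk by (auto simp: generalized_kaehler_one_spinor_def generalized_kaehler_def gc_structure_def almost_gc_structure_def)

context
  fixes c' p assumes c': "c' \<in> atlas X" and p: "p \<in> fst c'"
begin

lemma alternating_\<psi>: "alternating_form (\<psi> c' p)"
  using gk c' p by (auto simp: generalized_kaehler_one_spinor_def pure_spinor_def differential_form_def)

lemma dim_ker_\<psi>: "vec.dim (spinor_ker (\<psi> c' p)) = CARD('n)"
  using gk c' p by (auto simp: generalized_kaehler_one_spinor_def pure_spinor_def)

lemma ker_\<psi>: "spinor_ker (\<psi> c' p) = eigenspace_minus_i (J1 c' p)"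
proof -
  have "\<exists>J \<in> SO_gen. J ** J = - mat 1 \<and> eigenspace_minus_i J = spinor_ker (\<psi> c' p)"
    by (rule spinor_structure_ex[OF alternating_\<psi> dim_ker_\<psi>])
      (use gk c' p in \<open>auto simp: generalized_kaehler_one_spinor_def nondegenerate_spinor_def Let_def\<close>)
  then obtain J where J: "J \<in> SO_gen" "J ** J = - mat 1" "eigenspace_minus_i J = spinor_ker (\<psi> c' p)" by blast
  then show ?thesis by (simp add: spinor_structure_eqI[of J \<psi> c' p, OF J])
qed

lemma ambient_at: "kaehler_pair (J0 c' p) (J1 c' p)"
  unfolding kaehler_pair_def
proof (intro conjI)
  show "J0 c' p \<in> SO_gen" "J1 c' p \<in> SO_gen"
    using ambient_structures(4,5) c' p unfolding smooth_SO_section_def by blast+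
  show "J0 c' p ** J0 c' p = - mat 1" "J1 c' p ** J1 c' p = - mat 1" "J0 c' p ** J1 c' p = J1 c' p ** J0 c' p"
    using ambient_structures(1) c' p unfolding generalized_kaehler_def gc_structure_def almost_gc_structure_def by blast+
  show "G c' p \<in> SO_gen" "G c' p ** G c' p = mat 1" "\<forall>E. E \<noteq> 0 \<longrightarrow> gpair (G c' p *v E) E > 0"
    using ambient_structures(6) c' p unfolding generalized_metric_def smooth_SO_section_def by blast+
qed

end

lemma kaehler_point:
  assumes "c \<in> atlas M" "c' \<in> atlas X" "q \<in> fst c" "f q \<in> fst c'"
  shows "kaehler_point (jacobian c c' f q) (J0 c' (f q)) (J1 c' (f q)) (G c' (f q))"
proof
  show "inj ((*v) (jacobian c c' f q))" using emb assms by (auto simp: smooth_embedding_def)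
  show "(\<lambda>E. J0 c' (f q) *v E) ` conormal (jacobian c c' f q) = conormal (jacobian c c' f q)"
    using inv assms by (auto simp: conormal_invariant_def)
qed (rule ambient_at[OF assms(2,4)] refl)+

lemma chart_at_f:
  assumes "c \<in> atlas M" "q \<in> fst c"
  shows "chart_at X (f q) \<in> atlas X" "f q \<in> fst (chart_at X (f q))"
proof -
  have "f q \<in> topspace (topo X)"
    using f_smooth assms chart_props(3)[OF M assms(1)] by (auto simp: smooth_map_def continuous_map_def)
  then show "chart_at X (f q) \<in> atlas X" "f q \<in> fst (chart_at X (f q))" using chart_at[OF X] by auto
qed

lemma jacobian_change_target:
  assumes "c \<in> atlas M" "c' \<in> atlas X" "c'' \<in> atlas X" "q \<in> fst c" "f q \<in> fst c'" "f q \<in> fst c''"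
  shows "jacobian c c'' f q = jacobian c' c'' id (f q) ** jacobian c c' f q"
  using jacobian_compose[OF M X f_smooth smooth_map_id[OF X], of c c' c'' q] assms by simp

lemma jacobian_change_source:
  assumes "c \<in> atlas M" "c2 \<in> atlas M" "c' \<in> atlas X" "q \<in> fst c" "q \<in> fst c2" "f q \<in> fst c'"
  shows "jacobian c c' f q = jacobian c2 c' f q ** jacobian c c2 id q"
  using jacobian_compose[OF M M smooth_map_id[OF M] f_smooth, of c c2 c' q] assms by simp

text \<open>The definition uses the chart \<open>chart_at X (f q)\<close>, which may jump with \<open>q\<close>; in a fixed chart \<open>c'\<close> the right-hand side can be
  differentiated in \<open>q\<close>. The lemma \<open>induced_rel_K0\<close> does the same for the induced structure.\<close>

lemma \<psi>M_eq:
  assumes "c \<in> atlas M" "c' \<in> atlas X" "q \<in> fst c" "f q \<in> fst c'"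
  shows "\<psi>M c q = (\<lambda>ws. \<psi> c' (f q) (map ((*v) (jacobian c c' f q)) ws))"
proof
  fix ws
  let ?c = "chart_at X (f q)"
  note c0 = chart_at_f[OF assms(1,3)]
  have "\<psi> c' (f q) vs = \<psi> ?c (f q) (map (\<lambda>v. jacobian c' ?c id (f q) *v v) vs)" for vs
    using gk c0 assms unfolding generalized_kaehler_one_spinor_def pure_spinor_def differential_form_def by blast
  then show "\<psi>M c q ws = \<psi> c' (f q) (map ((*v) (jacobian c c' f q)) ws)"
    unfolding \<psi>M_def form_pullback_def Let_def jacobian_change_target[OF assms(1,2) c0(1) assms(3,4) c0(2)]
    by (simp add: o_def matrix_vector_mul_assoc)
qed

lemma induced_rel_K0:
  assumes "c \<in> atlas M" "c' \<in> atlas X" "q \<in> fst c" "f q \<in> fst c'"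
  shows "induced_rel (J0 c' (f q)) (jacobian c c' f q) (K0 c q)"
proof -
  let ?c = "chart_at X (f q)"
  note c0 = chart_at_f[OF assms(1,3)]
  interpret P: kaehler_point "jacobian c ?c f q" "J0 ?c (f q)" "J1 ?c (f q)" "G ?c (f q)"
    by (rule kaehler_point) (use assms c0 in auto)
  obtain L where L: "\<And>x. J0 ?c (f q) *v (P.\<Lambda> *v x) = P.\<Lambda> *v (L *v x)" "induced_rel (J0 ?c (f q)) (jacobian c ?c f q) L"
    by (rule P.reduced_structures) (rule that, assumption+)
  have "\<exists>!K. induced_rel (J0 ?c (f q)) (jacobian c ?c f q) K"
    by (rule ex1I[of _ L], rule L(2), rule P.induced_rel_unique[OF L(1)])
  from theI'[OF this] have "induced_rel (J0 ?c (f q)) (jacobian c ?c f q) (K0 c q)"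
    unfolding K0_def induced_structure_def Let_def induced_rel_def .
  then have *: "induced_rel (J0 ?c (f q)) (jacobian c' ?c id (f q) ** jacobian c c' f q) (K0 c q)"
    by (simp add: jacobian_change_target[OF assms(1,2) c0(1) assms(3,4) c0(2)])
  show ?thesis
  proof (rule induced_rel_change_target[OF _ _ _ *])
    show "jacobian ?c c' id (f q) ** jacobian c' ?c id (f q) = mat 1" "jacobian c' ?c id (f q) ** jacobian ?c c' id (f q) = mat 1"
      by (rule jacobian_inverse[OF X]; use assms c0 in auto)+
    show "J0 ?c (f q) *v gtrans (jacobian c' ?c id (f q)) (jacobian ?c c' id (f q)) E
      = gtrans (jacobian c' ?c id (f q)) (jacobian ?c c' id (f q)) (J0 c' (f q) *v E)" for E
      using ambient_structures(4) assms c0 by (auto simp: smooth_SO_section_def)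
  qed
qed

text \<open>The link between the definitions of \<open>K0\<close> and \<open>K1\<close>, which have nothing to do with \<open>W\<close>, and the structures
  obtained by restriction to \<open>W\<close>.\<close>

lemma reduced_at_in_charts:
  assumes "c \<in> atlas M" "c' \<in> atlas X" "q \<in> fst c" "f q \<in> fst c'"
  shows "J0 c' (f q) *v (\<Lambda> c c' q *v x) = \<Lambda> c c' q *v (K0 c q *v x)" (is ?lift0)
    and "J1 c' (f q) *v (\<Lambda> c c' q *v x) = \<Lambda> c c' q *v (K1 c q *v x)" (is ?lift1)
    and "kaehler_pair (K0 c q) (K1 c q)" (is ?pair)
    and "induced_rel (J1 c' (f q)) (jacobian c c' f q) (K1 c q)" (is ?rel)
    and "spinor_ker (\<psi>M c q) = eigenspace_minus_i (K1 c q)" (is ?ker)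
proof -
  interpret P: kaehler_point "jacobian c c' f q" "J0 c' (f q)" "J1 c' (f q)" "G c' (f q)"
    by (rule kaehler_point) (use assms in auto)
  obtain L0 L1 where L:
    "\<And>x. J0 c' (f q) *v (P.\<Lambda> *v x) = P.\<Lambda> *v (L0 *v x)" "\<And>x. J1 c' (f q) *v (P.\<Lambda> *v x) = P.\<Lambda> *v (L1 *v x)"
    "kaehler_pair L0 L1" "induced_rel (J1 c' (f q)) (jacobian c c' f q) L1"
    by (rule P.reduced_structures) (rule that, assumption+)
  have K0: "K0 c q = L0" by (rule P.induced_rel_unique[OF L(1) induced_rel_K0[OF assms]])
  note L1 = kaehler_pairD(2,4)[OF L(3)]
  obtain vs where nz: "\<psi> c' (f q) vs \<noteq> 0"
    using spinor_with_small_ker_nonzero[OF dim_ker_\<psi>[OF assms(2,4)]] by blast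
  have ker: "spinor_ker (\<psi>M c q) = eigenspace_minus_i L1"
    unfolding \<psi>M_eq[OF assms]
    by (rule P.spinor_ker_pullback[OF alternating_\<psi>[OF assms(2,4)] ker_\<psi>[OF assms(2,4)] nz L(2) L1])
  have K1: "K1 c q = L1"
    unfolding K1_def by (rule spinor_structure_eqI[of L1 \<psi>M c q, OF L1 ker[symmetric]])
  show ?lift0 ?lift1 ?pair ?rel ?ker
    unfolding K0 K1 by (rule L ker)+
qed

lemma smooth_in_pointI:
  assumes c: "c \<in> atlas M"
    and "\<And>c'. c' \<in> atlas X \<Longrightarrow> smooth_on (snd c ` (fst c \<inter> f -` fst c')) (\<lambda>x. g (chart_inv c x))"
  shows "smooth_in c UNIV g"
proof (rule smooth_in_local[OF M c])
  fix p assume p: "p \<in> fst c"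
  let ?c = "chart_at X (f p)"
  note c0 = chart_at_f[OF c p]
  have "smooth_in c (fst c \<inter> f -` fst ?c) g"
    using assms(2)[OF c0(1)] by (simp add: smooth_in_def o_def Int_assoc[symmetric])
  then show "\<exists>W. openin (topo M) W \<and> p \<in> W \<and> smooth_in c W g"
    using openin_preimage[OF M X f_smooth c c0(1)] c0(2) p by blast
qed

context
  fixes c c' assumes c: "c \<in> atlas M" and c': "c' \<in> atlas X"
begin

definition overlap where "overlap = snd c ` (fst c \<inter> f -` fst c')"

lemma open_overlap: "open overlap"
  unfolding overlap_def by (rule open_preimage[OF M X f_smooth c c'])

lemma chart_inv_overlap: "x \<in> overlap \<Longrightarrow> chart_inv c x \<in> fst c" "x \<in> overlap \<Longrightarrow> f (chart_inv c x) \<in> fst c'"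
  unfolding overlap_def using M c by auto

lemma smooth_D: "smooth_on overlap (\<lambda>x. jacobian c c' f (chart_inv c x))"
  unfolding overlap_def by (rule smooth_on_jacobian[OF M X f_smooth c c'])

lemma smooth_J: "smooth_SO_section X J \<Longrightarrow> smooth_on overlap (\<lambda>x. J c' (f (chart_inv c x)))"
  unfolding overlap_def using c' by (intro smooth_on_pullback[OF M X f_smooth c c']) (auto simp: smooth_SO_section_def)

lemma smooth_G: "smooth_on overlap (\<lambda>x. G c' (f (chart_inv c x)))"
  by (rule smooth_J) (use ambient_structures(6) in \<open>simp add: generalized_metric_def\<close>)

lemma smooth_\<Lambda>: "smooth_on overlap (\<lambda>x. \<Lambda> c c' (chart_inv c x))"
proof (rule smooth_on_matrixI[OF open_overlap])
  fix u :: "real ^ ('m + 'm)"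
  let ?D = "\<lambda>x. jacobian c c' f (chart_inv c x)" and ?G = "\<lambda>x. G c' (f (chart_inv c x))"
  let ?\<eta> = "\<lambda>x. cpart (\<Lambda> c c' (chart_inv c x) *v u)"
  let ?A = "\<lambda>x. lift_system (?D x) (?G x)"
  let ?b = "\<lambda>x. gjoin (- vpart (?G x *v gjoin (?D x *v vpart u) 0)) (cpart u)"
  have kp: "kaehler_point (?D x) (J0 c' (f (chart_inv c x))) (J1 c' (f (chart_inv c x))) (?G x)" if "x \<in> overlap" for x
    by (rule kaehler_point[OF c c' chart_inv_overlap[OF that]])
  have "\<exists>w. ?A x (gjoin (?\<eta> x) w) = ?b x" if "x \<in> overlap" for x
    using kaehler_point.lift_solves[OF kp[OF that]] by blast
  then have "\<exists>w. \<forall>x\<in>overlap. ?A x (gjoin (?\<eta> x) (w x)) = ?b x"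
    by (intro bchoice ballI)
  then obtain w where w: "\<And>x. x \<in> overlap \<Longrightarrow> ?A x (gjoin (?\<eta> x) (w x)) = ?b x"
    by blast
  have "smooth_on overlap (\<lambda>x. gjoin (?\<eta> x) (w x))"
  proof (rule smooth_on_linear_solve[OF open_overlap])
    note intros = smooth_on_gjoin[OF open_overlap] smooth_on_const smooth_on_matrix_vector_mult[OF open_overlap]
      smooth_on_vpart[OF open_overlap] smooth_on_transpose[OF open_overlap] smooth_D smooth_G
      smooth_on_add[OF open_overlap] smooth_on_linear[OF open_overlap bounded_linear_minus[OF bounded_linear_ident]]
    show "smooth_on overlap (\<lambda>x. matrix (?A x))"
      unfolding lift_system_def diff_conv_add_uminus
      by (rule smooth_on_matrix[OF open_overlap]) (intro intros)
    show "smooth_on overlap ?b" by (intro intros)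
    fix x assume x: "x \<in> overlap"
    have m: "(*v) (matrix (?A x)) = ?A x" by (rule ext) (simp add: linear_lift_system)
    show "inj ((*v) (matrix (?A x)))" unfolding m by (rule kaehler_point.lift_system_bij(1)[OF kp[OF x]])
    show "matrix (?A x) *v gjoin (?\<eta> x) (w x) = ?b x"
      unfolding m by (rule w[OF x])
  qed
  from smooth_on_vpart[OF open_overlap this]
  have s: "smooth_on overlap (\<lambda>x. ?\<eta> x)" by simp
  show "smooth_on overlap (\<lambda>x. \<Lambda> c c' (chart_inv c x) *v u)"
  proof (rule smooth_on_cong[OF open_overlap])
    show "smooth_on overlap (\<lambda>x. gjoin (?D x *v vpart u) (?\<eta> x))"
      by (intro smooth_on_gjoin[OF open_overlap] smooth_on_matrix_vector_mult[OF open_overlap] smooth_D smooth_on_const s)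
    show "gjoin (?D x *v vpart u) (?\<eta> x) = \<Lambda> c c' (chart_inv c x) *v u" if "x \<in> overlap" for x
      using kaehler_point.is_lift_\<Lambda>[OF kp[OF that]] by (simp add: is_lift_def gvec_eq_iff)
  qed
qed

lemma inj_\<Lambda>:
  assumes "q \<in> fst c" "f q \<in> fst c'"
  shows "inj ((*v) (\<Lambda> c c' q))"
proof -
  interpret P: kaehler_point "jacobian c c' f q" "J0 c' (f q)" "J1 c' (f q)" "G c' (f q)"
    by (rule kaehler_point) (use assms c c' in auto)
  show ?thesis using P.lift_inj by (simp add: P.\<Lambda>_mult[abs_def] inj_def)
qed

lemma smooth_reduced:
  assumes "smooth_SO_section X J" "\<And>q x. q \<in> fst c \<Longrightarrow> f q \<in> fst c' \<Longrightarrow> J c' (f q) *v (\<Lambda> c c' q *v x) = \<Lambda> c c' q *v (K c q *v x)"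
  shows "smooth_on overlap (\<lambda>x. K c (chart_inv c x))"
proof (rule smooth_on_matrixI[OF open_overlap])
  fix u
  show "smooth_on overlap (\<lambda>x. K c (chart_inv c x) *v u)"
  proof (rule smooth_on_linear_solve[OF open_overlap smooth_\<Lambda>])
    show "smooth_on overlap (\<lambda>x. J c' (f (chart_inv c x)) *v (\<Lambda> c c' (chart_inv c x) *v u))"
      by (intro smooth_on_matrix_vector_mult[OF open_overlap] smooth_\<Lambda> smooth_on_const smooth_J assms)
    show "inj ((*v) (\<Lambda> c c' (chart_inv c x)))" if "x \<in> overlap" for x
      by (rule inj_\<Lambda>[OF chart_inv_overlap[OF that]])
    show "\<Lambda> c c' (chart_inv c x) *v (K c (chart_inv c x) *v u) = J c' (f (chart_inv c x)) *v (\<Lambda> c c' (chart_inv c x) *v u)"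
      if "x \<in> overlap" for x
      using assms(2)[OF chart_inv_overlap[OF that]] by simp
  qed
qed

end

text \<open>The transformation law holds because both sides satisfy \<open>induced_rel\<close> in the same charts, which has only one
  solution.\<close>

lemma smooth_SO_section_reduced:
  assumes J: "smooth_SO_section X J"
    and lift: "\<And>c c' q x. c \<in> atlas M \<Longrightarrow> c' \<in> atlas X \<Longrightarrow> q \<in> fst c \<Longrightarrow> f q \<in> fst c' \<Longrightarrow> J c' (f q) *v (\<Lambda> c c' q *v x) = \<Lambda> c c' q *v (K c q *v x)"
    and rel: "\<And>c c' q. c \<in> atlas M \<Longrightarrow> c' \<in> atlas X \<Longrightarrow> q \<in> fst c \<Longrightarrow> f q \<in> fst c' \<Longrightarrow> induced_rel (J c' (f q)) (jacobian c c' f q) (K c q)"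
    and SO: "\<And>c q. c \<in> atlas M \<Longrightarrow> q \<in> fst c \<Longrightarrow> K c q \<in> SO_gen"
  shows "smooth_SO_section M K"
  unfolding smooth_SO_section_def
proof (intro conjI ballI allI)
  fix c assume c: "c \<in> atlas M"
  show "smooth_in c UNIV (K c)"
  proof (rule smooth_in_pointI[OF c])
    fix c' assume c': "c' \<in> atlas X"
    have "smooth_on (overlap c c') (\<lambda>x. K c (chart_inv c x))"
      by (rule smooth_reduced[OF c c' J]) (rule lift[OF c c'])
    then show "smooth_on (snd c ` (fst c \<inter> f -` fst c')) (\<lambda>x. K c (chart_inv c x))"
      by (simp add: overlap_def[OF c c'])
  qed
  show "K c q \<in> SO_gen" if "q \<in> fst c" for q using SO c that by blast
next
  fix c c2 p E assume c: "c \<in> atlas M" "c2 \<in> atlas M" "p \<in> fst c \<inter> fst c2"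
  let ?A = "jacobian c c2 id p" and ?B = "jacobian c2 c id p" and ?c = "chart_at X (f p)"
  have p: "p \<in> fst c" "p \<in> fst c2" using c by auto
  note c0 = chart_at_f[OF c(1) p(1)]
  interpret P: kaehler_point "jacobian c ?c f p" "J0 ?c (f p)" "J1 ?c (f p)" "G ?c (f p)"
    by (rule kaehler_point) (use c p c0 in auto)
  have AB: "?B ** ?A = mat 1" "?A ** ?B = mat 1"
    by (rule jacobian_inverse[OF M]; use c p in auto)+
  have "induced_rel (J ?c (f p)) (jacobian c ?c f p ** ?B) (K c2 p)"
    using rel[OF c(2) c0(1) p(2) c0(2)] unfolding jacobian_change_source[OF c(2,1) c0(1) p(2,1) c0(2)] .
  then have "induced_rel (J ?c (f p)) (jacobian c ?c f p) (matrix (\<lambda>x. gtrans ?B ?A (K c2 p *v gtrans ?A ?B x)))"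
    by (rule induced_rel_change_source[OF AB])
  then have eq: "matrix (\<lambda>x. gtrans ?B ?A (K c2 p *v gtrans ?A ?B x)) = K c p"
    by (rule P.induced_rel_unique[OF lift[OF c(1) c0(1) p(1) c0(2)]])
  have "K c p *v E = gtrans ?B ?A (K c2 p *v gtrans ?A ?B E)" unfolding eq[symmetric] by (rule matrix_gtrans_conjugate)
  then show "K c2 p *v gtrans ?A ?B E = gtrans ?A ?B (K c p *v E)"
    by (simp add: gtrans_inverse[OF AB(2)])
qed

lemma
  assumes "c \<in> atlas M" "q \<in> fst c"
  shows kaehler_pair_K: "kaehler_pair (K0 c q) (K1 c q)"
    and ker_\<psi>M: "spinor_ker (\<psi>M c q) = eigenspace_minus_i (K1 c q)"
  using reduced_at_in_charts(3,5)[OF assms(1) chart_at_f(1)[OF assms] assms(2) chart_at_f(2)[OF assms]] by blast+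

lemmas reduced_at = kaehler_pairD[OF kaehler_pair_K] ker_\<psi>M

lemma almost_gc_K0: "almost_gc_structure M K0" and almost_gc_K1: "almost_gc_structure M K1"
proof -
  have "smooth_SO_section M K0"
    by (rule smooth_SO_section_reduced[OF ambient_structures(4)]) (fact reduced_at_in_charts(1) | fact induced_rel_K0 | fact reduced_at(1))+
  then show "almost_gc_structure M K0" by (simp add: almost_gc_structure_def reduced_at)
  have "smooth_SO_section M K1"
    by (rule smooth_SO_section_reduced[OF ambient_structures(5)]) (fact reduced_at_in_charts(2) | fact reduced_at_in_charts(4) | fact reduced_at(2))+
  then show "almost_gc_structure M K1" by (simp add: almost_gc_structure_def reduced_at)
qed

lemma generalized_metric_M: "generalized_metric M (\<lambda>c p. - (K0 c p ** K1 c p))"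
proof -
  have K: "smooth_SO_section M K0" "smooth_SO_section M K1"
    using almost_gc_K0 almost_gc_K1 by (auto simp: almost_gc_structure_def)
  have "smooth_SO_section M (\<lambda>c p. - (K0 c p ** K1 c p))"
    unfolding smooth_SO_section_def
  proof (intro conjI ballI allI)
    fix c assume c: "c \<in> atlas M"
    have o: "open (snd c ` (fst c \<inter> UNIV))" using M c by (auto simp: smooth_manifold_def)
    show "smooth_in c UNIV (\<lambda>p. - (K0 c p ** K1 c p))"
      using K c unfolding smooth_SO_section_def smooth_in_def o_def
      by (intro smooth_on_linear[OF o bounded_linear_minus[OF bounded_linear_ident]] smooth_on_matrix_mult[OF o]) auto
    show "- (K0 c p ** K1 c p) \<in> SO_gen" if "p \<in> fst c" for p using reduced_at(6)[OF c that] .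
  next
    fix c c2 p E assume c: "c \<in> atlas M" "c2 \<in> atlas M" "p \<in> fst c \<inter> fst c2"
    have neg: "gtrans A B (- E) = - gtrans A B E" for A B :: "real ^ 'm ^ 'm" and E
      by (simp add: gtrans_def gvec_eq_iff)
    show "- (K0 c2 p ** K1 c2 p) *v gtrans (jacobian c c2 id p) (jacobian c2 c id p) E =
       gtrans (jacobian c c2 id p) (jacobian c2 c id p) (- (K0 c p ** K1 c p) *v E)"
      using K c unfolding smooth_SO_section_def by (simp add: neg matrix_vector_mul_assoc[symmetric])
  qed
  then show ?thesis unfolding generalized_metric_def using reduced_at(7,8) by blast
qed

lemma nondegenerate_\<psi>M: "nondegenerate_spinor M \<psi>M"
  unfolding nondegenerate_spinor_def Let_def
  by (simp add: reduced_at eigenspace_Int_cnj eigenspace_plus_cnj)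

end

section \<open>The pull back of the spinor\<close>

lemma linear_eq_sum_Basis:
  fixes v :: "'a::euclidean_space"
  assumes "linear L"
  shows "L v = (\<Sum>b\<in>Basis. (v \<bullet> b) *\<^sub>R L b)"
  by (simp add: linear_sum[OF assms, symmetric] linear_scale[OF assms, symmetric] euclidean_representation)

lemma bounded_linear_matrix_apply: "bounded_linear (\<lambda>A :: real ^ 'm::finite ^ 'n::finite. A *v b)"
  by (rule linear_conv_bounded_linear[THEN iffD1], rule linearI)
    (simp_all add: matrix_vector_mult_add_rdistrib scaleR_matrix_vector_assoc[symmetric])

text \<open>The coordinate picture of the pull back along \<open>g\<close> of a form \<open>\<Phi>\<close> of mixed degree. \<open>D\<close> plays the role of the
  Jacobian of \<open>g\<close>, but enters here as an independent matrix function.\<close>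

locale smooth_multilinear =
  fixes S :: "(real ^ 'm::finite) set" and T :: "(real ^ 'n::finite) set" and g :: "real ^ 'm \<Rightarrow> real ^ 'n"
    and D :: "real ^ 'm \<Rightarrow> real ^ 'm ^ 'n" and \<Phi> :: "real ^ 'n \<Rightarrow> 'n cform"
  assumes S: "open S" and T: "open T" and gS: "g ` S \<subseteq> T" and g: "smooth_on S g" and D: "smooth_on S D"
    and \<Phi>: "\<And>vs. smooth_on T (\<lambda>y. \<Phi> y vs)" and lin: "\<And>y us ws. y \<in> T \<Longrightarrow> linear (\<lambda>v. \<Phi> y (us @ v # ws))"
begin

text \<open>Expanding the first argument \<open>D x w\<close> in a basis moves its dependence on \<open>x\<close> into coefficients; a
  constant basis vector takes its place in the prefix \<open>us\<close>. The same induction gives the derivative.\<close>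

lemma smooth_pullback: "smooth_on S (\<lambda>x. \<Phi> (g x) (us @ map ((*v) (D x)) ws))"
proof (induction ws arbitrary: us)
  case Nil
  then show ?case using smooth_on_compose[OF S T gS \<Phi> g] by simp
next
  case (Cons w ws)
  show ?case
  proof (rule smooth_on_cong[OF S])
    have Dw: "smooth_on S (\<lambda>x. (D x *v w) \<bullet> b)" for b
      by (intro smooth_on_linear[OF S bounded_linear_inner_left] smooth_on_matrix_vector_mult[OF S D] smooth_on_const)
    show "smooth_on S (\<lambda>x. \<Sum>b\<in>Basis. ((D x *v w) \<bullet> b) *\<^sub>R \<Phi> (g x) ((us @ [b]) @ map ((*v) (D x)) ws))"
      by (intro smooth_on_sum[OF S] smooth_on_bilinear[OF S bounded_bilinear_scaleR] Dw Cons.IH)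
    fix x assume "x \<in> S"
    then have "linear (\<lambda>v. \<Phi> (g x) (us @ v # map ((*v) (D x)) ws))" using gS by (intro lin) auto
    from linear_eq_sum_Basis[OF this, of "D x *v w"]
    show "(\<Sum>b\<in>Basis. ((D x *v w) \<bullet> b) *\<^sub>R \<Phi> (g x) ((us @ [b]) @ map ((*v) (D x)) ws))
      = \<Phi> (g x) (us @ map ((*v) (D x)) (w # ws))" by simp
  qed
qed

lemma linear_derivative:
  assumes y: "y \<in> T"
  shows "linear (\<lambda>v. frechet_derivative (\<lambda>y. \<Phi> y (us @ v # ws)) (at y) b)"
proof (rule linearI)
  have d: "((\<lambda>y. \<Phi> y vs) has_derivative frechet_derivative (\<lambda>y. \<Phi> y vs) (at y)) (at y)" for vs
    by (rule smooth_on_has_derivative[OF \<Phi> y])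
  fix v w :: "real ^ 'n" and r :: real
  have "((\<lambda>y. \<Phi> y (us @ (v + w) # ws)) has_derivative
      (\<lambda>b. frechet_derivative (\<lambda>y. \<Phi> y (us @ v # ws)) (at y) b + frechet_derivative (\<lambda>y. \<Phi> y (us @ w # ws)) (at y) b)) (at y)"
    by (rule has_derivative_transform_within_open[OF has_derivative_add[OF d d] T y]) (rule linear_add[OF lin, symmetric])
  from fun_cong[OF frechet_derivative_at[OF this], of b]
  show "frechet_derivative (\<lambda>y. \<Phi> y (us @ (v + w) # ws)) (at y) b = 
     frechet_derivative (\<lambda>y. \<Phi> y (us @ v # ws)) (at y) b + frechet_derivative (\<lambda>y. \<Phi> y (us @ w # ws)) (at y) b"
    by (rule sym)
  have "((\<lambda>y. \<Phi> y (us @ (r *\<^sub>R v) # ws)) has_derivative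
      (\<lambda>b. r *\<^sub>R frechet_derivative (\<lambda>y. \<Phi> y (us @ v # ws)) (at y) b)) (at y)"
    by (rule has_derivative_transform_within_open[OF has_derivative_scaleR_right[OF d] T y]) (rule linear_scale[OF lin, symmetric])
  from fun_cong[OF frechet_derivative_at[OF this], of b]
  show "frechet_derivative (\<lambda>y. \<Phi> y (us @ (r *\<^sub>R v) # ws)) (at y) b = 
     r *\<^sub>R frechet_derivative (\<lambda>y. \<Phi> y (us @ v # ws)) (at y) b"
    by (rule sym)
qed

lemma pullback_has_derivative:
  assumes x: "x \<in> S" and g': "(g has_derivative g') (at x)" and D': "(D has_derivative D') (at x)"
  shows "((\<lambda>x. \<Phi> (g x) (us @ map ((*v) (D x)) ws)) has_derivative
     (\<lambda>a. frechet_derivative (\<lambda>y. \<Phi> y (us @ map ((*v) (D x)) ws)) (at (g x)) (g' a)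
        + (\<Sum>j<length ws. \<Phi> (g x) (us @ (map ((*v) (D x)) ws)[j := D' a *v (ws ! j)])))) (at x)"
proof (induction ws arbitrary: us)
  case Nil
  have y: "g x \<in> T" using gS x by auto
  have "((\<lambda>y. \<Phi> y us) has_derivative frechet_derivative (\<lambda>y. \<Phi> y us) (at (g x))) (at (g x))"
    by (rule smooth_on_has_derivative[OF \<Phi> y])
  from diff_chain_at[OF g' this] show ?case by (simp add: o_def)
next
  case (Cons w ws)
  have y: "g x \<in> T" using gS x by auto
  let ?R = "map ((*v) (D x)) ws"
  let ?d = "\<lambda>vs a. frechet_derivative (\<lambda>y. \<Phi> y vs) (at (g x)) (g' a)"
  let ?H = "\<lambda>b x. \<Phi> (g x) ((us @ [b]) @ map ((*v) (D x)) ws)"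
  let ?H' = "\<lambda>b a. ?d ((us @ [b]) @ ?R) a + (\<Sum>j<length ws. \<Phi> (g x) ((us @ [b]) @ ?R[j := D' a *v (ws ! j)]))"
  have Dw: "((\<lambda>x. (D x *v w) \<bullet> b) has_derivative (\<lambda>a. (D' a *v w) \<bullet> b)) (at x)" for b
  proof -
    from bounded_linear.has_derivative[OF bounded_linear_matrix_apply D'] show ?thesis by (rule has_derivative_inner_left)
  qed
  have "((\<lambda>x. \<Sum>b\<in>Basis. ((D x *v w) \<bullet> b) *\<^sub>R ?H b x) has_derivative
     (\<lambda>a. \<Sum>b\<in>Basis. ((D x *v w) \<bullet> b) *\<^sub>R ?H' b a + ((D' a *v w) \<bullet> b) *\<^sub>R ?H b x)) (at x)"
    by (intro has_derivative_sum has_derivative_scaleR Dw Cons.IH)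
  then have *: "((\<lambda>x. \<Phi> (g x) (us @ map ((*v) (D x)) (w # ws))) has_derivative
     (\<lambda>a. \<Sum>b\<in>Basis. ((D x *v w) \<bullet> b) *\<^sub>R ?H' b a + ((D' a *v w) \<bullet> b) *\<^sub>R ?H b x)) (at x)"
  proof (rule has_derivative_transform_within_open[OF _ S x])
    fix z assume "z \<in> S"
    then have "linear (\<lambda>v. \<Phi> (g z) (us @ v # map ((*v) (D z)) ws))" using gS by (intro lin) auto
    from linear_eq_sum_Basis[OF this, of "D z *v w"]
    show "(\<Sum>b\<in>Basis. ((D z *v w) \<bullet> b) *\<^sub>R ?H b z) = \<Phi> (g z) (us @ map ((*v) (D z)) (w # ws))" by simp
  qed
  have "(\<Sum>b\<in>Basis. ((D x *v w) \<bullet> b) *\<^sub>R ?H' b a + ((D' a *v w) \<bullet> b) *\<^sub>R ?H b x)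
    = ?d (us @ map ((*v) (D x)) (w # ws)) a
        + (\<Sum>j<length (w # ws). \<Phi> (g x) (us @ (map ((*v) (D x)) (w # ws))[j := D' a *v ((w # ws) ! j)]))" for a
  proof -
    have 1: "(\<Sum>b\<in>Basis. ((D x *v w) \<bullet> b) *\<^sub>R ?d (us @ b # ?R) a) = ?d (us @ (D x *v w) # ?R) a"
      by (rule linear_eq_sum_Basis[OF linear_derivative[OF y], symmetric])
    have 2: "(\<Sum>b\<in>Basis. ((D x *v w) \<bullet> b) *\<^sub>R \<Phi> (g x) (us @ b # L)) = \<Phi> (g x) (us @ (D x *v w) # L)" for L
      by (rule linear_eq_sum_Basis[OF lin[OF y], symmetric])
    have 3: "(\<Sum>b\<in>Basis. ((D' a *v w) \<bullet> b) *\<^sub>R \<Phi> (g x) (us @ b # ?R)) = \<Phi> (g x) (us @ (D' a *v w) # ?R)"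
      by (rule linear_eq_sum_Basis[OF lin[OF y], symmetric])
    have "(\<Sum>b\<in>Basis. ((D x *v w) \<bullet> b) *\<^sub>R (\<Sum>j<length ws. \<Phi> (g x) (us @ b # ?R[j := D' a *v (ws ! j)])))
      = (\<Sum>j<length ws. \<Phi> (g x) (us @ (D x *v w) # ?R[j := D' a *v (ws ! j)]))"
      unfolding scaleR_sum_right by (subst sum.swap) (simp only: 2)
    then show ?thesis
      using 1 3 by (simp add: scaleR_add_right sum.distrib sum.lessThan_Suc_shift del: sum.lessThan_Suc)
  qed
  with * show ?case by simp
qed

end

lemma nth_drop_nth: "i < length vs \<Longrightarrow> k < length vs - 1 \<Longrightarrow> drop_nth i vs ! k = (if k < i then vs ! k else vs ! Suc k)"
  by (auto simp: drop_nth_def nth_append)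

lemma drop_nth_drop_nth:
  assumes "j < i" "i < length vs"
  shows "drop_nth j (drop_nth i vs) = drop_nth (i - 1) (drop_nth j vs)"
proof (rule nth_equalityI)
  show "length (drop_nth j (drop_nth i vs)) = length (drop_nth (i - 1) (drop_nth j vs))"
    using assms by (simp add: length_drop_nth)
  fix k assume "k < length (drop_nth j (drop_nth i vs))"
  then show "drop_nth j (drop_nth i vs) ! k = drop_nth (i - 1) (drop_nth j vs) ! k"
    using assms by (auto simp: length_drop_nth nth_drop_nth)
qed

text \<open>The cancellation behind \<open>d\<^sup>2 = 0\<close>: \<open>(i, j)\<close> with \<open>j < i\<close> is paired with \<open>(j, i - 1)\<close>.\<close>

lemma alternating_sum_cancel:
  fixes B :: "nat \<Rightarrow> nat \<Rightarrow> complex"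
  assumes "\<And>i j. j < i \<Longrightarrow> i < n \<Longrightarrow> B i j = B j (i - 1)"
  shows "(\<Sum>i<n. \<Sum>j<n - 1. (- 1) ^ (i + j) * B i j) = 0"
proof -
  let ?t = "\<lambda>(i, j). (- 1) ^ (i + j) * B i j"
  let ?L = "{(i, j). i < n \<and> j < i}" and ?U = "{(i, j). i \<le> j \<and> j < n - 1}"
  have "finite ({..<n} \<times> {..<n - 1})" by simp
  moreover have "?L \<subseteq> {..<n} \<times> {..<n - 1}" "?U \<subseteq> {..<n} \<times> {..<n - 1}" by auto
  ultimately have fin: "finite ?L" "finite ?U" using finite_subset by blast+
  have "(\<Sum>i<n. \<Sum>j<n - 1. (- 1) ^ (i + j) * B i j) = sum ?t ({..<n} \<times> {..<n - 1})"
    by (simp add: sum.cartesian_product)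
  also have "{..<n} \<times> {..<n - 1} = ?L \<union> ?U" by auto
  also have "sum ?t (?L \<union> ?U) = sum ?t ?L + sum ?t ?U" by (rule sum.union_disjoint[OF fin]) auto
  also have "sum ?t ?L = sum (\<lambda>ij. - ?t ij) ?U"
  proof (rule sum.reindex_bij_witness[of _ "\<lambda>(i, j). (Suc j, i)" "\<lambda>(i, j). (j, i - 1)"])
    fix ij assume "ij \<in> ?L"
    then obtain i j where ij: "ij = (Suc i, j)" "Suc i < n" "j < Suc i"
      by (cases ij) (metis (no_types, lifting) case_prodD gr0_implies_Suc less_nat_zero_code mem_Collect_eq not_gr_zero prod.inject)
    then show "- ?t ((\<lambda>(i, j). (j, i - 1)) ij) = ?t ij"
      using assms[of j "Suc i"] by (simp add: add.commute)
  qed auto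
  finally show ?thesis by (simp add: sum_negf)
qed

context kaehler_submanifold
begin

context
  fixes c c' assumes c: "c \<in> atlas M" and c': "c' \<in> atlas X"
begin

lemma smooth_multilinear:
  "smooth_multilinear (overlap c c') (snd c' ` fst c') (snd c' \<circ> f \<circ> chart_inv c) (\<lambda>x. jacobian c c' f (chart_inv c x))
    (\<lambda>y. \<psi> c' (chart_inv c' y))"
proof (rule smooth_multilinear.intro)
  show "open (overlap c c')" by (rule open_overlap[OF c c'])
  show "open (snd c' ` fst c')" by (rule open_chart[OF X c'])
  show "(snd c' \<circ> f \<circ> chart_inv c) ` overlap c c' \<subseteq> snd c' ` fst c'"
    using chart_inv_overlap[OF c c'] by auto
  show "smooth_on (overlap c c') (snd c' \<circ> f \<circ> chart_inv c)"
    unfolding overlap_def[OF c c'] by (rule smooth_on_rep[OF f_smooth c c'])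
  show "smooth_on (overlap c c') (\<lambda>x. jacobian c c' f (chart_inv c x))" by (rule smooth_D[OF c c'])
  have "smooth_in c' UNIV (\<lambda>p. \<psi> c' p vs)" for vs
    using gk c' unfolding generalized_kaehler_one_spinor_def pure_spinor_def differential_form_def by blast
  then show "smooth_on (snd c' ` fst c') (\<lambda>y. \<psi> c' (chart_inv c' y) vs)" for vs
    by (simp add: smooth_in_def o_def)
  fix y us ws assume "y \<in> snd c' ` fst c'"
  then show "linear (\<lambda>v. \<psi> c' (chart_inv c' y) (us @ v # ws))"
    using X c' by (intro alternating_linear alternating_\<psi>[OF c']) auto
qed

lemma \<psi>M_rep:
  assumes "x \<in> overlap c c'"
  shows "\<psi>M c (chart_inv c x) ws = \<psi> c' (chart_inv c' ((snd c' \<circ> f \<circ> chart_inv c) x)) (map ((*v) (jacobian c c' f (chart_inv c x))) ws)"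
proof -
  note d = chart_inv_overlap[OF c c' assms]
  have "chart_inv c' (snd c' (f (chart_inv c x))) = f (chart_inv c x)" by (rule chart_inv[OF X c' d(2)])
  then show ?thesis unfolding \<psi>M_eq[OF c c' d] by simp
qed

lemma smooth_\<psi>M: "smooth_on (overlap c c') (\<lambda>x. \<psi>M c (chart_inv c x) ws)"
  by (rule smooth_on_cong[OF open_overlap[OF c c'] _ smooth_multilinear.smooth_pullback[OF smooth_multilinear, of "[]" ws]])
    (simp add: \<psi>M_rep)

text \<open>The symmetry of the second derivatives of the inclusion.\<close>

lemma derivative_D_symmetric:
  assumes x: "x \<in> overlap c c'" and D': "((\<lambda>x. jacobian c c' f (chart_inv c x)) has_derivative D') (at x)"
  shows "D' a *v b = D' b *v a"
proof -
  let ?g = "snd c' \<circ> f \<circ> chart_inv c"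
  have g: "smooth_on (overlap c c') ?g" unfolding overlap_def[OF c c'] by (rule smooth_on_rep[OF f_smooth c c'])
  have "D' a *v b = frechet_derivative (\<lambda>z. frechet_derivative ?g (at z) b) (at x) a" for a b
  proof -
    from bounded_linear.has_derivative[OF bounded_linear_matrix_apply D']
    have "((\<lambda>z. frechet_derivative ?g (at z) b) has_derivative (\<lambda>a. D' a *v b)) (at x)"
    proof (rule has_derivative_transform_within_open[OF _ open_overlap[OF c c'] x])
      fix z assume z: "z \<in> overlap c c'"
      have "snd c (chart_inv c z) = z" using z M c by (auto simp: overlap_def[OF c c'])
      then have "(?g has_derivative (*v) (jacobian c c' f (chart_inv c z))) (at z)"
        using has_derivative_rep[OF f_smooth c c' chart_inv_overlap[OF c c' z]] by simp
      from frechet_derivative_at[OF this]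
      show "jacobian c c' f (chart_inv c z) *v b = frechet_derivative ?g (at z) b" by metis
    qed
    from frechet_derivative_at[OF this] show ?thesis by metis
  qed
  then show ?thesis using symmetric_second_derivative[OF open_overlap[OF c c'] g x] by metis
qed

text \<open>The terms in which the derivative falls on the form add up to the exterior derivative of \<open>\<psi>\<close>. Those in which it
  falls on a Jacobian contain \<open>D' (v\<^sub>i) v\<^sub>j\<close>, which is symmetric, so they cancel in pairs.\<close>

lemma exterior_d_\<psi>M:
  assumes p: "p \<in> fst c" "f p \<in> fst c'"
  shows "exterior_d \<psi>M c p vs = 0"
proof -
  let ?x = "snd c p" and ?g = "snd c' \<circ> f \<circ> chart_inv c" and ?D = "\<lambda>x. jacobian c c' f (chart_inv c x)"
  let ?\<Phi> = "\<lambda>y. \<psi> c' (chart_inv c' y)" and ?A = "jacobian c c' f p" and ?\<phi> = "\<psi> c' (f p)"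
  interpret S: smooth_multilinear "overlap c c'" "snd c' ` fst c'" ?g ?D ?\<Phi>
    by (rule smooth_multilinear)
  have x: "?x \<in> overlap c c'" unfolding overlap_def[OF c c'] using p by auto
  have [simp]: "chart_inv c ?x = p" "chart_inv c' (snd c' (f p)) = f p" using p M c X c' by auto
  have g': "(?g has_derivative (*v) ?A) (at ?x)" by (rule has_derivative_rep[OF f_smooth c c' p])
  define D' where "D' = frechet_derivative ?D (at ?x)"
  have D': "(?D has_derivative D') (at ?x)" unfolding D'_def by (rule smooth_on_has_derivative[OF S.D x])
  have alt: "alternating_form ?\<phi>" by (rule alternating_\<psi>[OF c' p(2)])
  have cd: "cderiv c (\<lambda>q. \<psi>M c q ws) p a = cderiv c' (\<lambda>q. \<psi> c' q (map ((*v) ?A) ws)) (f p) (?A *v a)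
      + (\<Sum>j<length ws. ?\<phi> ((map ((*v) ?A) ws)[j := D' a *v (ws ! j)]))" for ws a
  proof -
    have "((\<lambda>x. \<psi>M c (chart_inv c x) ws) has_derivative
      (\<lambda>a. frechet_derivative (\<lambda>y. ?\<Phi> y ([] @ map ((*v) (?D ?x)) ws)) (at (?g ?x)) (?A *v a)
        + (\<Sum>j<length ws. ?\<Phi> (?g ?x) ([] @ (map ((*v) (?D ?x)) ws)[j := D' a *v (ws ! j)])))) (at ?x)"
      by (rule has_derivative_transform_within_open[OF S.pullback_has_derivative[OF x g' D', of "[]" ws] S.S x])
        (simp add: \<psi>M_rep)
    from frechet_derivative_at[OF this]
    show ?thesis unfolding cderiv_def o_def by (simp add: fun_eq_iff)
  qed
  let ?n = "length vs"
  let ?B = "\<lambda>i j. ?\<phi> ((D' (vs ! i) *v (drop_nth i vs ! j)) # map ((*v) ?A) (drop_nth j (drop_nth i vs)))"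
  \<comment> \<open>moving the exceptional argument to the front costs the sign that alternates in \<open>j\<close>\<close>
  have mv: "?\<phi> (L[j := s]) = (- 1) ^ j * ?\<phi> (s # drop_nth j L)" if "j < length L" for L j s
    using alternating_move[OF alt, of "take j L" s "drop (Suc j) L"] that
    by (simp add: upd_conv_take_nth_drop drop_nth_def)
  have "exterior_d \<psi>M c p vs = (\<Sum>i<?n. (- 1) ^ i * cderiv c' (\<lambda>q. \<psi> c' q (drop_nth i (map ((*v) ?A) vs))) (f p) (map ((*v) ?A) vs ! i))
     + (\<Sum>i<?n. \<Sum>j<?n - 1. (- 1) ^ (i + j) * ?B i j)"
    unfolding exterior_d_def cd
    by (simp add: distrib_left sum.distrib sum_distrib_left length_drop_nth mv drop_nth_map power_add mult.assoc)
  also have "(\<Sum>i<?n. (- 1) ^ i * cderiv c' (\<lambda>q. \<psi> c' q (drop_nth i (map ((*v) ?A) vs))) (f p) (map ((*v) ?A) vs ! i)) 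
      = exterior_d \<psi> c' (f p) (map ((*v) ?A) vs)"
    by (simp add: exterior_d_def)
  also have "\<dots> = 0"
    using gk c' p unfolding generalized_kaehler_one_spinor_def d_closed_def by blast
  also have "(\<Sum>i<?n. \<Sum>j<?n - 1. (- 1) ^ (i + j) * ?B i j) = 0"
  proof (rule alternating_sum_cancel)
    fix i j assume ij: "j < i" "i < ?n"
    have "drop_nth i vs ! j = vs ! j" "drop_nth j vs ! (i - 1) = vs ! i"
      using ij by (auto simp: nth_drop_nth)
    then show "?B i j = ?B j (i - 1)"
      using drop_nth_drop_nth[OF ij] derivative_D_symmetric[OF x D', of "vs ! i" "vs ! j"] by simp
  qed
  finally show ?thesis by simp
qed

end

lemma d_closed_\<psi>M: "d_closed M \<psi>M"
  unfolding d_closed_def using exterior_d_\<psi>M chart_at_f by blast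

lemma differential_form_\<psi>M: "differential_form M \<psi>M"
  unfolding differential_form_def
proof (intro conjI ballI allI)
  fix c assume c: "c \<in> atlas M"
  show "alternating_form (\<psi>M c p)" if p: "p \<in> fst c" for p
    unfolding \<psi>M_eq[OF c chart_at_f(1)[OF c p] p chart_at_f(2)[OF c p]]
    by (rule alternating_pullback[OF alternating_\<psi>[OF chart_at_f[OF c p]]])
  show "smooth_in c UNIV (\<lambda>p. \<psi>M c p vs)" for vs
    by (rule smooth_in_pointI[OF c]) (use smooth_\<psi>M[OF c] overlap_def[OF c] in auto)
next
  fix c c2 p vs assume c: "c \<in> atlas M" "c2 \<in> atlas M" "p \<in> fst c \<inter> fst c2"
  let ?c = "chart_at X (f p)"
  have p: "p \<in> fst c" "p \<in> fst c2" using c by auto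
  note c0 = chart_at_f[OF c(1) p(1)]
  show "\<psi>M c p vs = \<psi>M c2 p (map (\<lambda>v. jacobian c c2 id p *v v) vs)"
    unfolding \<psi>M_eq[OF c(1) c0(1) p(1) c0(2)] \<psi>M_eq[OF c(2) c0(1) p(2) c0(2)]
      jacobian_change_source[OF c(1,2) c0(1) p c0(2)]
    by (simp add: o_def matrix_vector_mul_assoc)
qed

lemma pure_\<psi>M: "pure_spinor M \<psi>M"
  unfolding pure_spinor_def by (simp add: differential_form_\<psi>M reduced_at dim_eigenspace)

end

section \<open>The Courant bracket under reduction\<close>

definition cdot :: "complex ^ 'n::finite \<Rightarrow> complex ^ 'n \<Rightarrow> complex" where
  "cdot x y = (\<Sum>i\<in>UNIV. x $ i * y $ i)"

lemma cdot_simps: "cdot (x + y) z = cdot x z + cdot y z" "cdot z (x + y) = cdot z x + cdot z y"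
  by (simp_all add: cdot_def algebra_simps sum.distrib)

lemma cdot_transpose: "cdot (transpose A *v x) y = cdot x (A *v y)"
  unfolding cdot_def matrix_vector_mult_def transpose_def
  by (simp add: sum_distrib_left sum_distrib_right mult_ac) (subst sum.swap, simp)

lemma cpair_cdot: "cpair E F = cdot (cpart E) (vpart F) + cdot (cpart F) (vpart E)"
  by (simp add: cpair_def cdot_def)

text \<open>Complex-linear extension of a real-linear map.\<close>

definition linear_ext :: "(real ^ 'n::finite \<Rightarrow> complex ^ 'k::finite) \<Rightarrow> complex ^ 'n \<Rightarrow> complex ^ 'k" where
  "linear_ext L a = (\<Sum>i\<in>UNIV. a $ i *s L (axis i 1))"

lemma linear_ext_nth: "linear_ext L a $ k = (\<Sum>i\<in>UNIV. a $ i * L (axis i 1) $ k)"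
  by (simp add: linear_ext_def)

text \<open>Written out in coordinates, only the first derivatives \<open>DE\<close> and \<open>DF\<close> of the sections and their
  values at the point occur.\<close>

lemma courant_pair:
  assumes DE: "((\<lambda>x. E c (chart_inv c x)) has_derivative DE) (at (snd c p))"
    and DF: "((\<lambda>x. F c (chart_inv c x)) has_derivative DF) (at (snd c p))"
  shows "cpair (courant E F c p) H = cpair (linear_ext DF (vpart (E c p))) H - cpair (linear_ext DE (vpart (F c p))) H
    + (cpair (linear_ext DE (vpart H)) (F c p) - cpair (linear_ext DF (vpart H)) (E c p)) / 2"
proof -
  have comp: "frechet_derivative (\<lambda>x. h x $ k) (at z) a = D a $ k" if "(h has_derivative D) (at z)" 
    for h :: "real ^ 'a \<Rightarrow> complex ^ ('a + 'a)" and D z k a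
    using fun_cong[OF frechet_derivative_at[OF bounded_linear.has_derivative[OF bounded_linear_vec_nth that]], of a k] by simp
  have part: "partial c (\<lambda>q. vpart (E c q) $ j) p i = DE (axis i 1) $ Inl j"
    "partial c (\<lambda>q. cpart (E c q) $ j) p i = DE (axis i 1) $ Inr j"
    "partial c (\<lambda>q. vpart (F c q) $ j) p i = DF (axis i 1) $ Inl j"
    "partial c (\<lambda>q. cpart (F c q) $ j) p i = DF (axis i 1) $ Inr j" for i j
    unfolding partial_def cderiv_def o_def vpart_def cpart_def
    using comp[OF DE] comp[OF DF] by simp_all
  define v1 t1 v2 t2 w z where "v1 = vpart (E c p)" and "t1 = cpart (E c p)" and "v2 = vpart (F c p)" and "t2 = cpart (F c p)"
    and "w = vpart H" and "z = cpart H"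
  define av ac bv bc where "av i j = DE (axis i 1) $ Inl j" and "ac i j = DE (axis i 1) $ Inr j"
    and "bv i j = DF (axis i 1) $ Inl j" and "bc i j = DF (axis i 1) $ Inr j" for i j
  have sw: "(\<Sum>j\<in>UNIV. (\<Sum>i\<in>UNIV. w $ i * x i j) * y $ j) = (\<Sum>j\<in>UNIV. \<Sum>i\<in>UNIV. w $ j * (x j i * y $ i))"
    for x :: "'a \<Rightarrow> 'a \<Rightarrow> complex" and y
    by (simp add: sum_distrib_right mult.assoc) (rule sum.swap)
  have sw': "(\<Sum>j\<in>UNIV. y $ j * (\<Sum>i\<in>UNIV. w $ i * x i j)) = (\<Sum>j\<in>UNIV. \<Sum>i\<in>UNIV. w $ j * (x j i * y $ i))"
    for x :: "'a \<Rightarrow> 'a \<Rightarrow> complex" and y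
    using sw[of x y] by (simp add: mult.commute)
  have vp: "vpart (courant E F c p) $ j = (\<Sum>i\<in>UNIV. v1 $ i * bv i j - v2 $ i * av i j)" for j
    unfolding courant_def Let_def lie_bracket_def part
    by (simp add: v1_def v2_def av_def bv_def)
  have cp: "cpart (courant E F c p) $ j = (1/2) * ((\<Sum>i\<in>UNIV. v1 $ i * bc i j + t2 $ i * av j i)
     - (\<Sum>i\<in>UNIV. v2 $ i * ac i j + t1 $ i * bv j i) - (\<Sum>i\<in>UNIV. v2 $ i * (ac i j - ac j i))
     + (\<Sum>i\<in>UNIV. v1 $ i * (bc i j - bc j i)))" for j
    unfolding courant_def Let_def lie_derivative_def interior_d_def part
    by (simp add: v1_def v2_def t1_def t2_def av_def bv_def ac_def bc_def)
  have L: "cpair (courant E F c p) H = 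
      (\<Sum>j\<in>UNIV. \<Sum>i\<in>UNIV. (1/2) * ((v1 $ i * bc i j + t2 $ i * av j i) - (v2 $ i * ac i j + t1 $ i * bv j i)
         - v2 $ i * (ac i j - ac j i) + v1 $ i * (bc i j - bc j i)) * w $ j + z $ j * (v1 $ i * bv i j - v2 $ i * av i j))"
    unfolding cpair_def vp cp w_def[symmetric] z_def[symmetric]
    by (simp only: sum.distrib[symmetric] sum_subtractf[symmetric] sum_distrib_left sum_distrib_right)
  have X: "cpair (linear_ext D a) H' = (\<Sum>j\<in>UNIV. (\<Sum>i\<in>UNIV. a $ i * D (axis i 1) $ Inr j) * vpart H' $ j)
      + (\<Sum>j\<in>UNIV. cpart H' $ j * (\<Sum>i\<in>UNIV. a $ i * D (axis i 1) $ Inl j))" for D a and H' :: "complex ^ ('a + 'a)"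
    by (simp add: cpair_def vpart_def cpart_def linear_ext_nth)
  have R: "cpair (linear_ext DF (vpart (E c p))) H - cpair (linear_ext DE (vpart (F c p))) H
    + (cpair (linear_ext DE (vpart H)) (F c p) - cpair (linear_ext DF (vpart H)) (E c p)) / 2
    = (\<Sum>j\<in>UNIV. \<Sum>i\<in>UNIV. v1 $ i * bc i j * w $ j + z $ j * (v1 $ i * bv i j)
        - (v2 $ i * ac i j * w $ j + z $ j * (v2 $ i * av i j))
        + ((w $ j * (ac j i * v2 $ i) + w $ j * (av j i * t2 $ i)) - (w $ j * (bc j i * v1 $ i) + w $ j * (bv j i * t1 $ i))) / 2)"
    unfolding X v1_def[symmetric] v2_def[symmetric] t1_def[symmetric] t2_def[symmetric] w_def[symmetric] z_def[symmetric]
      av_def[symmetric] ac_def[symmetric] bv_def[symmetric] bc_def[symmetric] sw sw'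
    by (simp only: sum.distrib[symmetric] sum_subtractf[symmetric] sum_distrib_left sum_distrib_right sum_divide_distrib)
  show ?thesis unfolding L R by (intro sum.cong refl) (simp add: field_simps)
qed

text \<open>Complex bilinear extension of \<open>(a, u) \<mapsto> D' a *v u\<close>.\<close>

definition bilinear_ext :: "(real ^ 'm::finite \<Rightarrow> real ^ 'm ^ 'n::finite) \<Rightarrow> complex ^ 'm \<Rightarrow> complex ^ 'm \<Rightarrow> complex ^ 'n" where
  "bilinear_ext D' a u = (\<Sum>i\<in>UNIV. a $ i *s (cmat (D' (axis i 1)) *v u))"

lemma bilinear_ext_commute:
  assumes "\<And>a b. D' a *v b = D' b *v a"
  shows "bilinear_ext D' a u = bilinear_ext D' u a"
proof -
  have e: "D' (axis i 1) $ k $ j = D' (axis j 1) $ k $ i" for i j k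
    using arg_cong[OF assms[of "axis i 1" "axis j 1"], of "\<lambda>v. v $ k"] by (simp add: matrix_vector_mult_basis column_def)
  have "bilinear_ext D' a u $ k = (\<Sum>i\<in>UNIV. \<Sum>j\<in>UNIV. a $ i * complex_of_real (D' (axis i 1) $ k $ j) * u $ j)" for a u k
    by (simp add: bilinear_ext_def matrix_vector_mult_def sum_distrib_left mult.assoc)
  then show ?thesis
    by (simp add: vec_eq_iff) (subst sum.swap, simp add: e mult_ac)
qed

text \<open>\<open>E2\<close> is a lift of \<open>e2\<close> along \<open>D\<close>, and \<open>L\<close>, \<open>l\<close> are the derivatives of such a pair. The assumptions on them are what
  the Leibniz rule gives for \<open>v(E) = D v(e)\<close> and \<open>\<theta>(e) = D\<^sup>T \<theta>(E)\<close>. The pairings with another lifted pair then agree up to two terms in the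
  second derivative.\<close>

lemma cpair_reduction:
  fixes D :: "real ^ 'm::finite ^ 'n::finite" and e2 h :: "complex ^ ('m + 'm)" and E2 H :: "complex ^ ('n + 'n)"
  assumes E: "\<And>a. vpart (L a) = cmat D *v vpart (l a) + cmat (D' a) *v vpart e2"
    "\<And>a. cpart (l a) = transpose (cmat D) *v cpart (L a) + transpose (cmat (D' a)) *v cpart E2"
    and H: "vpart H = cmat D *v vpart h" "cpart h = transpose (cmat D) *v cpart H"
  shows "cpair (linear_ext L a) H = cpair (linear_ext l a) h + cdot (cpart H) (bilinear_ext D' a (vpart e2)) - cdot (cpart E2) (bilinear_ext D' a (vpart h))"
proof -
  have ext: "cpair (linear_ext L a) H = (\<Sum>i\<in>UNIV. a $ i * cpair (L (axis i 1)) H)" 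
    for L :: "real ^ 'm \<Rightarrow> complex ^ ('k::finite + 'k)" and H
    unfolding cpair_def linear_ext_nth vpart_def cpart_def
    by (simp add: sum_distrib_left sum_distrib_right sum.distrib distrib_left mult_ac)
      (subst (1 2) sum.swap, rule refl)
  have cs: "cdot b (bilinear_ext D' a u) = (\<Sum>i\<in>UNIV. a $ i * cdot b (cmat (D' (axis i 1)) *v u))" for b u
    unfolding cdot_def bilinear_ext_def
    by (simp add: sum_distrib_left mult_ac) (subst sum.swap, rule refl)
  have K: "cpair (L a) H = cpair (l a) h + cdot (cpart H) (cmat (D' a) *v vpart e2) - cdot (cpart E2) (cmat (D' a) *v vpart h)" for a
    unfolding cpair_cdot E H by (simp add: cdot_simps cdot_transpose)
  show ?thesis
    unfolding ext cs K by (simp add: distrib_left right_diff_distrib sum.distrib sum_subtractf)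
qed

text \<open>The right-hand side of \<open>courant_pair\<close> takes the same value for lifts along \<open>D\<close> as downstairs. The four
  corrections from \<open>cpair_reduction\<close> cancel by symmetry of the second derivative.\<close>

lemma courant_reduction:
  fixes D :: "real ^ 'm::finite ^ 'n::finite" and e1 e2 h :: "complex ^ ('m + 'm)" and E1 E2 H :: "complex ^ ('n + 'n)"
  assumes sym: "\<And>a b. D' a *v b = D' b *v a"
    and E1: "vpart E1 = cmat D *v vpart e1" "cpart e1 = transpose (cmat D) *v cpart E1"
    "\<And>a. vpart (L1 a) = cmat D *v vpart (l1 a) + cmat (D' a) *v vpart e1"
    "\<And>a. cpart (l1 a) = transpose (cmat D) *v cpart (L1 a) + transpose (cmat (D' a)) *v cpart E1"
    and E2: "vpart E2 = cmat D *v vpart e2" "cpart e2 = transpose (cmat D) *v cpart E2"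
    "\<And>a. vpart (L2 a) = cmat D *v vpart (l2 a) + cmat (D' a) *v vpart e2"
    "\<And>a. cpart (l2 a) = transpose (cmat D) *v cpart (L2 a) + transpose (cmat (D' a)) *v cpart E2"
    and H: "vpart H = cmat D *v vpart h" "cpart h = transpose (cmat D) *v cpart H"
  shows "cpair (linear_ext L2 (vpart e1)) H - cpair (linear_ext L1 (vpart e2)) H
      + (cpair (linear_ext L1 (vpart h)) E2 - cpair (linear_ext L2 (vpart h)) E1) / 2
    = cpair (linear_ext l2 (vpart e1)) h - cpair (linear_ext l1 (vpart e2)) h
      + (cpair (linear_ext l1 (vpart h)) e2 - cpair (linear_ext l2 (vpart h)) e1) / 2"
  unfolding cpair_reduction[OF E2(3,4) H] cpair_reduction[OF E1(3,4) H]
    cpair_reduction[OF E1(3,4) E2(1,2)] cpair_reduction[OF E2(3,4) E1(1,2)]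
    bilinear_ext_commute[OF sym, of "vpart h"] bilinear_ext_commute[OF sym, of "vpart e2" "vpart e1"]
  by (simp add: field_simps)

lemma linear_ext_compose:
  assumes "linear L" 
  shows "linear_ext L (cmat D *v a) = linear_ext (\<lambda>b. L (D *v b)) a"
proof -
  have "L (D *v axis i 1) = (\<Sum>j\<in>UNIV. D $ j $ i *\<^sub>R L (axis j 1))" for i
  proof -
    have "D *v axis i 1 = (\<Sum>j\<in>UNIV. D $ j $ i *\<^sub>R axis j 1)"
    proof (subst vec_eq_iff, rule allI)
      fix k
      have "(\<Sum>j\<in>UNIV. D $ j $ i *\<^sub>R axis j 1) $ k = D $ k $ i"
        by (simp add: axis_def if_distrib cong: if_cong)
      then show "(D *v axis i 1) $ k = (\<Sum>j\<in>UNIV. D $ j $ i *\<^sub>R axis j 1) $ k"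
        by (simp add: matrix_vector_mult_basis column_def)
    qed
    then show ?thesis by (simp add: linear_sum[OF assms] linear_scale[OF assms])
  qed
  note e = this
  show ?thesis
  proof (subst vec_eq_iff, rule allI)
    fix k
    have "linear_ext L (cmat D *v a) $ k = (\<Sum>j\<in>UNIV. \<Sum>i\<in>UNIV. a $ i * (complex_of_real (D $ j $ i) * L (axis j 1) $ k))"
      by (simp add: linear_ext_nth matrix_vector_mult_def sum_distrib_left sum_distrib_right mult_ac)
    also have "\<dots> = linear_ext (\<lambda>b. L (D *v b)) a $ k"
      unfolding linear_ext_nth e by (subst sum.swap) (simp add: sum_distrib_left scaleR_conv_of_real[where 'a = complex])
    finally show "linear_ext L (cmat D *v a) $ k = linear_ext (\<lambda>b. L (D *v b)) a $ k" .
  qed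
qed

section \<open>Integrability of the reduced structures\<close>

lemma cmat_mult: "cmat (A ** B) = cmat A ** cmat B"
  by (simp add: vec_eq_iff matrix_matrix_mult_def map_matrix_def)

lemma gtrans_gtrans: "gtrans A B (gtrans A' B' E) = gtrans (A ** A') (B' ** B) E"
  for A B A' B' :: "'a::comm_ring_1 ^ 'n::finite ^ 'n"
  by (simp add: gtrans_def gvec_eq_iff matrix_vector_mul_assoc matrix_transpose_mul)

lemma cmat_mat_1 [simp]: "cmat (mat 1) = mat 1"
  by (simp add: vec_eq_iff mat_def map_matrix_def)

lemma gtrans_mat_1 [simp]: "gtrans (mat 1) (mat 1) E = (E :: 'a::comm_ring_1 ^ ('n::finite + 'n))"
  by (simp add: gtrans_def gvec_eq_iff)

lemma Re_Im_vec_gjoin [simp]: "Re_vec (gjoin u v) = gjoin (Re_vec u) (Re_vec v)" "Im_vec (gjoin u v) = gjoin (Im_vec u) (Im_vec v)"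
  by (simp_all add: gvec_eq_iff flip: Re_Im_vec_parts)

lemma Re_Im_vec_gtrans:
  "Re_vec (gtrans (cmat A) (cmat B) E) = gtrans A B (Re_vec E)" "Im_vec (gtrans (cmat A) (cmat B) E) = gtrans A B (Im_vec E)"
  by (simp_all add: gtrans_def cmat_transpose[symmetric])

lemma smooth_on_gtrans:
  fixes A B :: "'a::euclidean_space \<Rightarrow> real ^ 'n::finite ^ 'n" and E :: "'a \<Rightarrow> complex ^ ('n + 'n)"
  assumes S: "open S" and "smooth_on S A" "smooth_on S B" "smooth_on S E"
  shows "smooth_on S (\<lambda>x. gtrans (cmat (A x)) (cmat (B x)) (E x))"
  unfolding gtrans_def cmat_transpose[symmetric]
  by (intro smooth_on_gjoin smooth_on_matrix_vector_mult smooth_on_cmat smooth_on_transpose smooth_on_vpart smooth_on_cpart assms)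

text \<open>The section over the domain of \<open>c'\<close> whose component function in the coordinates of \<open>c'\<close> is \<open>N\<close>.\<close>

definition push_section :: "('x, 'n::finite) chart \<Rightarrow> (real ^ 'n \<Rightarrow> complex ^ ('n + 'n)) \<Rightarrow> ('x, 'n) gsec" where
  "push_section c' N = (\<lambda>c p. gtrans (cmat (jacobian c' c id p)) (cmat (jacobian c c' id p)) (N (snd c' p)))"

lemma smooth_push_section:
  assumes X: "smooth_manifold X" and c': "c' \<in> atlas X" and N: "smooth_on (snd c' ` fst c') N"
  shows "smooth_gsec X (fst c') (push_section c' N)"
  unfolding smooth_gsec_def
proof (intro conjI ballI)
  note id = smooth_map_id[OF X]
  fix c assume c: "c \<in> atlas X"
  let ?S = "snd c ` (fst c \<inter> fst c')"
  have oS: "open ?S" using open_preimage[OF X X id c c'] by simp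
  have mem: "chart_inv c x \<in> fst c" "chart_inv c x \<in> fst c'" if "x \<in> ?S" for x
    using that X c by auto
  have J: "smooth_on ?S (\<lambda>x. jacobian c c' id (chart_inv c x))"
    using smooth_on_jacobian[OF X X id c c'] by simp
  have inv: "jacobian c c' id (chart_inv c x) ** jacobian c' c id (chart_inv c x) = mat 1"
    "jacobian c' c id (chart_inv c x) ** jacobian c c' id (chart_inv c x) = mat 1" if "x \<in> ?S" for x
    using jacobian_inverse[OF X] c c' mem[OF that] by auto
  have J': "smooth_on ?S (\<lambda>x. jacobian c' c id (chart_inv c x))"
  proof (rule smooth_on_matrixI[OF oS])
    fix u
    show "smooth_on ?S (\<lambda>x. jacobian c' c id (chart_inv c x) *v u)"
    proof (rule smooth_on_linear_solve[OF oS J smooth_on_const[of _ u]])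
      fix x assume x: "x \<in> ?S"
      show "inj ((*v) (jacobian c c' id (chart_inv c x)))"
        using inv(2)[OF x] matrix_left_invertible_injective by blast
      show "jacobian c c' id (chart_inv c x) *v (jacobian c' c id (chart_inv c x) *v u) = u"
        by (simp add: matrix_vector_mul_assoc inv(1)[OF x])
    qed
  qed
  have oS': "open (snd c' ` fst c')" by (rule open_chart[OF X c'])
  have rep: "smooth_on ?S (snd c' \<circ> id \<circ> chart_inv c)" using smooth_on_rep[OF id c c'] by simp
  have "smooth_on ?S (\<lambda>x. N ((snd c' \<circ> id \<circ> chart_inv c) x))"
    by (rule smooth_on_compose[OF oS oS' _ N rep]) (use mem in auto)
  then show "smooth_in c (fst c') (push_section c' N c)"
    unfolding smooth_in_def push_section_def o_def id_def
    by (intro smooth_on_gtrans[OF oS] J[unfolded id_def] J'[unfolded id_def])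
next
  note id = smooth_map_id[OF X]
  fix c c2 p assume c: "c \<in> atlas X" "c2 \<in> atlas X" "p \<in> fst c \<inter> fst c2 \<inter> fst c'"
  have j: "jacobian d d2 id p = jacobian d1 d2 id p ** jacobian d d1 id p"
    if "d \<in> atlas X" "d1 \<in> atlas X" "d2 \<in> atlas X" "p \<in> fst d" "p \<in> fst d1" "p \<in> fst d2" for d d1 d2
    using jacobian_compose[OF X X id id that(1-3)] that by simp
  show "push_section c' N c2 p = gtrans (cmat (jacobian c c2 id p)) (cmat (jacobian c2 c id p)) (push_section c' N c p)"
    unfolding push_section_def gtrans_gtrans cmat_mult[symmetric]
    using j[of c' c c2] j[of c2 c c'] c c' by simp
qed

lemma push_section_own_chart:
  "smooth_manifold X \<Longrightarrow> c' \<in> atlas X \<Longrightarrow> p \<in> fst c' \<Longrightarrow> push_section c' N c' p = N (snd c' p)"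
  by (simp add: push_section_def jacobian_id)

lemma section_of_push_section:
  assumes J: "smooth_SO_section X J" and c': "c' \<in> atlas X"
    and N: "\<And>p. p \<in> fst c' \<Longrightarrow> N (snd c' p) \<in> eigenspace_minus_i (J c' p)"
  shows "section_of X (fst c') (\<lambda>c p. eigenspace_minus_i (J c p)) (push_section c' N)"
  unfolding section_of_def
proof (intro ballI)
  fix c p assume c: "c \<in> atlas X" and p: "p \<in> fst c \<inter> fst c'"
  let ?t = "gtrans (jacobian c' c id p) (jacobian c c' id p)"
  have t: "J c p *v ?t E = ?t (J c' p *v E)" for E
    using J c c' p unfolding smooth_SO_section_def by blast
  have neg: "?t (- E) = - ?t E" for E by (simp add: gtrans_def gvec_eq_iff)
  show "push_section c' N c p \<in> eigenspace_minus_i (J c p)"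
    using N[of p] p unfolding push_section_def mem_eigenspace_minus_i Re_Im_vec_gtrans t by (simp add: neg)
qed

text \<open>The projection onto the eigenspace along its conjugate.\<close>

definition eigenspace_proj :: "real ^ 'k::finite ^ 'k \<Rightarrow> complex ^ 'k \<Rightarrow> complex ^ 'k" where
  "eigenspace_proj J E = (1/2) *s (E + \<i> *s (cmat J *v E))"

lemma eigenspace_proj_mem: "J ** J = - mat 1 \<Longrightarrow> eigenspace_proj J E \<in> eigenspace_minus_i J"
  unfolding mem_eigenspace_minus_i eigenspace_proj_def
  by (simp add: complex_structure_vector matrix_vector_mult_scaleR matrix_vector_right_distrib matrix_vector_mult_diff_distrib)

lemma eigenspace_proj_id: "E \<in> eigenspace_minus_i J \<Longrightarrow> eigenspace_proj J E = E"
  unfolding eigenspace_minus_i_def eigenspace_proj_def by (simp add: vec_eq_iff)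

lemma bounded_linear_cmult: "bounded_linear (\<lambda>E :: complex ^ 'k::finite. c *s E)"
  by (rule linear_conv_bounded_linear[THEN iffD1], rule linearI) (simp_all add: vec_eq_iff algebra_simps)

lemma bounded_bilinear_cmat: "bounded_bilinear (\<lambda>(A :: real ^ 'k::finite ^ 'l::finite) E. cmat A *v E)"
proof -
  have "bilinear (\<lambda>(A :: real ^ 'k::finite ^ 'l::finite) E. cmat A *v E)"
    unfolding bilinear_def
    by (intro conjI allI; rule linearI;
        simp add: vec_eq_iff matrix_vector_mult_def algebra_simps sum.distrib sum_distrib_left scaleR_conv_of_real[where 'a = complex])
  then show ?thesis by (simp add: bilinear_conv_bounded_bilinear)
qed

lemma eigenspace_proj_has_derivative:
  assumes "(J has_derivative J') (at x)" "(r has_derivative r') (at x)"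
  shows "((\<lambda>x. eigenspace_proj (J x) (r x)) has_derivative
     (\<lambda>a. (1/2) *s (r' a + \<i> *s (cmat (J x) *v r' a + cmat (J' a) *v r x)))) (at x)"
  unfolding eigenspace_proj_def
  by (intro bounded_linear.has_derivative[OF bounded_linear_cmult] has_derivative_add assms
      bounded_bilinear.FDERIV[OF bounded_bilinear_cmat])

lemma smooth_on_eigenspace_proj:
  "open S \<Longrightarrow> smooth_on S J \<Longrightarrow> smooth_on S r \<Longrightarrow> smooth_on S (\<lambda>x. eigenspace_proj (J x) (r x))"
  unfolding eigenspace_proj_def
  by (intro smooth_on_linear[OF _ bounded_linear_cmult] smooth_on_add smooth_on_bilinear[OF _ bounded_bilinear_cmat])

lemma bounded_linear_transpose: "bounded_linear (transpose :: real ^ 'k::finite ^ 'l::finite \<Rightarrow> _)"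
  by (rule linear_conv_bounded_linear[THEN iffD1], rule linearI) (simp_all add: vec_eq_iff transpose_def)

context kaehler_submanifold
begin

text \<open>\<open>N\<close> is a section of the eigenbundle of \<open>J\<close> in the coordinates of \<open>c'\<close>. Its value at \<open>f p\<close> is the lift of that of \<open>E\<close>, and
  its derivative \<open>DN\<close> along \<open>M\<close> is related to the derivative \<open>l\<close> of \<open>E\<close> as in \<open>cpair_reduction\<close>.\<close>

definition first_order_lift ::
  "('x, 'n) gend \<Rightarrow> ('y, 'm) chart \<Rightarrow> ('x, 'n) chart \<Rightarrow> 'y \<Rightarrow> (real ^ 'm \<Rightarrow> real ^ 'm ^ 'n) \<Rightarrow> ('y, 'm) gsec \<Rightarrow>
     (real ^ 'n \<Rightarrow> complex ^ ('n + 'n)) \<Rightarrow> (real ^ 'n \<Rightarrow> complex ^ ('n + 'n)) \<Rightarrow> (real ^ 'm \<Rightarrow> complex ^ ('m + 'm)) \<Rightarrow> bool" where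
  "first_order_lift J c c' p D' E N DN l \<longleftrightarrow> (let D = jacobian c c' f p in
     smooth_on (snd c' ` fst c') N \<and> (\<forall>q\<in>fst c'. N (snd c' q) \<in> eigenspace_minus_i (J c' q)) \<and>
     N (snd c' (f p)) = cmat (\<Lambda> c c' p) *v E c p \<and>
     ((\<lambda>x. E c (chart_inv c x)) has_derivative l) (at (snd c p)) \<and> (N has_derivative DN) (at (snd c' (f p))) \<and>
     (\<forall>a. vpart (DN (D *v a)) = cmat D *v vpart (l a) + cmat (D' a) *v vpart (E c p)) \<and>
     (\<forall>a. cpart (l a) = transpose (cmat D) *v cpart (DN (D *v a)) + transpose (cmat (D' a)) *v cpart (cmat (\<Lambda> c c' p) *v E c p)))"

lemma first_order_liftD:
  assumes "first_order_lift J c c' p D' E N DN l"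
  shows "smooth_on (snd c' ` fst c') N" "\<And>q. q \<in> fst c' \<Longrightarrow> N (snd c' q) \<in> eigenspace_minus_i (J c' q)"
    "N (snd c' (f p)) = cmat (\<Lambda> c c' p) *v E c p"
    "((\<lambda>x. E c (chart_inv c x)) has_derivative l) (at (snd c p))" "(N has_derivative DN) (at (snd c' (f p)))"
    "\<And>a. vpart (DN (jacobian c c' f p *v a)) = cmat (jacobian c c' f p) *v vpart (l a) + cmat (D' a) *v vpart (E c p)"
    "\<And>a. cpart (l a) = transpose (cmat (jacobian c c' f p)) *v cpart (DN (jacobian c c' f p *v a))
        + transpose (cmat (D' a)) *v cpart (cmat (\<Lambda> c c' p) *v E c p)"
  using assms unfolding first_order_lift_def Let_def by blast+

text \<open>A section of the eigenbundle of \<open>J\<close> near \<open>f p\<close> that agrees along \<open>M\<close> to first order at \<open>p\<close> with the lift \<open>eh\<close> of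
  the section \<open>E\<close>. First order contact with a non-linear lift is easy to achieve in coordinates: take the
  affine function \<open>q\<close> in coordinates that has first order contact with \<open>eh\<close>, and project it to the eigenbundle.
  The projection of \<open>eh\<close> is \<open>eh\<close> itself, and by the product rule the first order jet of a projection
  depends only on that of its argument.\<close>

lemma section_extension:
  fixes J :: "('x, 'n) gend" and K :: "('y, 'm) gend" and E :: "('y, 'm) gsec"
  assumes J: "smooth_SO_section X J" "\<And>c p. c \<in> atlas X \<Longrightarrow> p \<in> fst c \<Longrightarrow> J c p ** J c p = - mat 1"
    and lift: "\<And>c c' q x. c \<in> atlas M \<Longrightarrow> c' \<in> atlas X \<Longrightarrow> q \<in> fst c \<Longrightarrow> f q \<in> fst c' \<Longrightarrow> J c' (f q) *v (\<Lambda> c c' q *v x) = \<Lambda> c c' q *v (K c q *v x)"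
    and c: "c \<in> atlas M" "c' \<in> atlas X" and W: "openin (topo M) W" and p: "p \<in> fst c" "p \<in> W" "f p \<in> fst c'"
    and E: "smooth_gsec M W E" "section_of M W (\<lambda>c p. eigenspace_minus_i (K c p)) E"
    and D': "((\<lambda>x. jacobian c c' f (chart_inv c x)) has_derivative D') (at (snd c p))"
  shows "\<exists>N DN l. first_order_lift J c c' p D' E N DN l"
proof -
  let ?x = "snd c p" and ?y = "snd c' (f p)" and ?g = "snd c' \<circ> f \<circ> chart_inv c"
  let ?D = "\<lambda>x. jacobian c c' f (chart_inv c x)" and ?L = "\<lambda>x. \<Lambda> c c' (chart_inv c x)"
  let ?J = "\<lambda>x. J c' (f (chart_inv c x))"
  define e where "e x = E c (chart_inv c x)" for x
  define eh where "eh x = cmat (?L x) *v e x" for x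
  define U where "U = overlap c c' \<inter> snd c ` (fst c \<inter> W)"
  have oU: "open U" unfolding U_def by (intro open_Int open_overlap[OF c] open_chart_image[OF M c(1) W])
  have x: "?x \<in> U" unfolding U_def overlap_def[OF c] using p by auto
  have xd: "?x \<in> overlap c c'" using x by (simp add: U_def)
  have [simp]: "chart_inv c ?x = p" by (rule chart_inv[OF M c(1) p(1)])
  have [simp]: "chart_inv c' ?y = f p" by (rule chart_inv[OF X c(2) p(3)])
  have sub: "U \<subseteq> overlap c c'" by (simp add: U_def)
  have se: "smooth_on U e"
  proof -
    have "smooth_in c W (E c)" using E(1) c unfolding smooth_gsec_def by blast
    then have "smooth_on (snd c ` (fst c \<inter> W)) e" unfolding smooth_in_def e_def[abs_def] by (simp add: o_def)
    then show ?thesis by (rule smooth_on_subset) (simp add: U_def)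
  qed
  have sL: "smooth_on U ?L" by (rule smooth_on_subset[OF smooth_\<Lambda>[OF c] sub])
  have seh: "smooth_on U eh"
    unfolding eh_def[abs_def] by (rule smooth_on_bilinear[OF oU bounded_bilinear_cmat sL se])
  define l where "l = frechet_derivative e (at ?x)"
  define eh' where "eh' = frechet_derivative eh (at ?x)"
  have De: "(e has_derivative l) (at ?x)" unfolding l_def by (rule smooth_on_has_derivative[OF se x])
  have Deh: "(eh has_derivative eh') (at ?x)" unfolding eh'_def by (rule smooth_on_has_derivative[OF seh x])
  have parts: "vpart (eh x) = cmat (?D x) *v vpart (e x)" "cpart (e x) = cmat (transpose (?D x)) *v cpart (eh x)" if "x \<in> U" for x
  proof -
    have "x \<in> overlap c c'" using that sub by blast
    note d = chart_inv_overlap[OF c this]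
    interpret P: kaehler_point "?D x" "J0 c' (f (chart_inv c x))" "J1 c' (f (chart_inv c x))" "G c' (f (chart_inv c x))"
      by (rule kaehler_point[OF c d])
    show "vpart (eh x) = cmat (?D x) *v vpart (e x)" "cpart (e x) = cmat (transpose (?D x)) *v cpart (eh x)"
      using P.is_lift_\<Lambda> unfolding is_lift_def eh_def by (simp_all add: complex_vec_eq_iff)
  qed
  have v: "vpart (eh' a) = cmat (?D ?x) *v vpart (l a) + cmat (D' a) *v vpart (e ?x)" for a
  proof -
    have "((\<lambda>x. cmat (?D x) *v vpart (e x)) has_derivative (\<lambda>a. cmat (?D ?x) *v vpart (l a) + cmat (D' a) *v vpart (e ?x))) (at ?x)"
      by (rule bounded_bilinear.FDERIV[OF bounded_bilinear_cmat D' bounded_linear.has_derivative[OF bounded_linear_vpart De]])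
    then have "((\<lambda>x. vpart (eh x)) has_derivative (\<lambda>a. cmat (?D ?x) *v vpart (l a) + cmat (D' a) *v vpart (e ?x))) (at ?x)"
      by (rule has_derivative_transform_within_open[OF _ oU x]) (simp add: parts)
    from has_derivative_unique[OF bounded_linear.has_derivative[OF bounded_linear_vpart Deh] this]
    show ?thesis by (rule fun_cong)
  qed
  have w: "cpart (l a) = cmat (transpose (?D ?x)) *v cpart (eh' a) + cmat (transpose (D' a)) *v cpart (eh ?x)" for a
  proof -
    have "((\<lambda>x. cmat (transpose (?D x)) *v cpart (eh x)) has_derivative
        (\<lambda>a. cmat (transpose (?D ?x)) *v cpart (eh' a) + cmat (transpose (D' a)) *v cpart (eh ?x))) (at ?x)"
      by (rule bounded_bilinear.FDERIV[OF bounded_bilinear_cmat bounded_linear.has_derivative[OF bounded_linear_transpose D']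
            bounded_linear.has_derivative[OF bounded_linear_cpart Deh]])
    then have "((\<lambda>x. cpart (e x)) has_derivative
        (\<lambda>a. cmat (transpose (?D ?x)) *v cpart (eh' a) + cmat (transpose (D' a)) *v cpart (eh ?x))) (at ?x)"
      by (rule has_derivative_transform_within_open[OF _ oU x]) (simp add: parts(2))
    from has_derivative_unique[OF bounded_linear.has_derivative[OF bounded_linear_cpart De] this]
    show ?thesis by (rule fun_cong)
  qed
  have eh_mem: "eh x \<in> eigenspace_minus_i (?J x)" if "x \<in> U" for x
  proof -
    have "x \<in> overlap c c'" using that sub by blast
    note d = chart_inv_overlap[OF c this]
    have "chart_inv c x \<in> W" using that M c by (auto simp: U_def)
    then have "e x \<in> eigenspace_minus_i (K c (chart_inv c x))"
      using E(2) c d unfolding section_of_def e_def by blast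
    then show ?thesis
      unfolding mem_eigenspace_minus_i eh_def by (simp add: lift[OF c d])
  qed
  \<comment> \<open>a first order replacement for a retraction onto the submanifold\<close>
  obtain P where P: "P ** ?D ?x = mat 1"
    using kaehler_point.D_inj[OF kaehler_point[OF c p(1,3)]] by (auto simp: matrix_left_invertible_injective[symmetric])
  define q where "q y = eh ?x + eh' (P *v (y - ?y))" for y
  define N where "N y = eigenspace_proj (J c' (chart_inv c' y)) (q y)" for y
  have leh': "bounded_linear eh'" by (rule has_derivative_bounded_linear[OF Deh])
  have sq: "smooth_on (snd c' ` fst c') q"
  proof -
    have o: "open (snd c' ` fst c')" by (rule open_chart[OF X c(2)])
    show ?thesis unfolding q_def[abs_def] diff_conv_add_uminus
      by (intro smooth_on_add[OF o] smooth_on_const smooth_on_linear[OF o leh'] smooth_on_linear[OF o matrix_vector_mul_bounded_linear] smooth_on_ident)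
  qed
  have sN: "smooth_on (snd c' ` fst c') N"
  proof -
    have o: "open (snd c' ` fst c')" by (rule open_chart[OF X c(2)])
    have "smooth_in c' UNIV (J c')" using J(1) c unfolding smooth_SO_section_def by blast
    then have "smooth_on (snd c' ` fst c') (\<lambda>y. J c' (chart_inv c' y))" unfolding smooth_in_def by (simp add: o_def)
    then show ?thesis unfolding N_def[abs_def] by (rule smooth_on_eigenspace_proj[OF o _ sq])
  qed
  have Nmem: "N (snd c' r) \<in> eigenspace_minus_i (J c' r)" if "r \<in> fst c'" for r
    unfolding N_def chart_inv[OF X c(2) that] by (rule eigenspace_proj_mem[OF J(2)[OF c(2) that]])
  have q0: "q ?y = eh ?x" unfolding q_def using linear_0[OF bounded_linear.linear[OF leh']] by simp
  have N0: "N ?y = eh ?x" unfolding N_def q0 using eigenspace_proj_id[OF eh_mem[OF x]] by simp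
  define DN where "DN = frechet_derivative N (at ?y)"
  have DN: "(N has_derivative DN) (at ?y)" unfolding DN_def by (rule smooth_on_has_derivative[OF sN]) (use p in auto)
  have g0: "?g ?x = ?y" by simp
  have Dg: "(?g has_derivative (*v) (?D ?x)) (at ?x)"
    using has_derivative_rep[OF f_smooth c p(1,3)] by simp
  obtain J' where J': "(?J has_derivative J') (at ?x)"
    using smooth_on_has_derivative[OF smooth_J[OF c J(1)] xd] by blast
  have Dqg: "((\<lambda>x. q (?g x)) has_derivative eh') (at ?x)"
  proof -
    have "(q has_derivative (\<lambda>b. eh' (P *v b))) (at (?g ?x))"
    proof -
      have "((\<lambda>y. P *v (y - ?y)) has_derivative (\<lambda>b. P *v b)) (at (?g ?x))"
        by (rule bounded_linear.has_derivative[OF matrix_vector_mul_bounded_linear]) (auto intro!: derivative_eq_intros)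
      from has_derivative_add[OF has_derivative_const bounded_linear.has_derivative[OF leh' this]]
      show ?thesis unfolding q_def[abs_def] by simp
    qed
    from diff_chain_at[OF Dg this] show ?thesis
      unfolding o_def matrix_vector_mul_assoc P by simp
  qed
  let ?A = "\<lambda>a. (1/2) *s (eh' a + \<i> *s (cmat (?J ?x) *v eh' a + cmat (J' a) *v eh ?x))"
  have "((\<lambda>x. eigenspace_proj (?J x) (q (?g x))) has_derivative ?A) (at ?x)"
    using eigenspace_proj_has_derivative[OF J' Dqg] unfolding g0 q0 .
  then have "((\<lambda>x. N (?g x)) has_derivative ?A) (at ?x)"
  proof (rule has_derivative_transform_within_open[OF _ open_overlap[OF c] xd])
    fix x assume "x \<in> overlap c c'"
    then have "chart_inv c' (?g x) = f (chart_inv c x)"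
      using chart_inv[OF X c(2) chart_inv_overlap(2)[OF c]] by simp
    then show "eigenspace_proj (?J x) (q (?g x)) = N (?g x)" by (simp only: N_def)
  qed
  moreover have "((\<lambda>x. N (?g x)) has_derivative (\<lambda>a. DN (?D ?x *v a))) (at ?x)"
    using diff_chain_at[OF Dg] DN unfolding g0[symmetric] by (simp add: o_def)
  ultimately have A1: "?A = (\<lambda>a. DN (?D ?x *v a))" by (rule has_derivative_unique)
  have "(eh has_derivative ?A) (at ?x)"
    by (rule has_derivative_transform_within_open[OF eigenspace_proj_has_derivative[OF J' Deh] oU x])
      (rule eigenspace_proj_id[OF eh_mem])
  from has_derivative_unique[OF Deh this] have A2: "eh' a = DN (?D ?x *v a)" for a
    unfolding A1 by (rule fun_cong)
  have "first_order_lift J c c' p D' E N DN l"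
    unfolding first_order_lift_def Let_def
    using sN Nmem N0 De DN v w by (simp add: A2 e_def[abs_def] eh_def cmat_transpose)
  then show ?thesis by blast
qed

text \<open>By duality it suffices that the bracket on \<open>M\<close> pairs to zero with the eigenspace. This pairing equals the one
  upstairs of the extensions, which vanishes as \<open>J\<close> is integrable and its eigenspace isotropic.\<close>

lemma involutive_reduced:
  fixes J :: "('x, 'n) gend" and K :: "('y, 'm) gend"
  assumes J: "gc_structure X J" and K: "almost_gc_structure M K"
    and lift: "\<And>c c' q x. c \<in> atlas M \<Longrightarrow> c' \<in> atlas X \<Longrightarrow> q \<in> fst c \<Longrightarrow> f q \<in> fst c' \<Longrightarrow> J c' (f q) *v (\<Lambda> c c' q *v x) = \<Lambda> c c' q *v (K c q *v x)"
  shows "involutive M (\<lambda>c p. eigenspace_minus_i (K c p))"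
  unfolding involutive_def
proof (intro allI impI)
  fix W and E F :: "('y, 'm) gsec"
  let ?LX = "\<lambda>c p. eigenspace_minus_i (J c p)" and ?LM = "\<lambda>c p. eigenspace_minus_i (K c p)"
  assume W: "openin (topo M) W" and E: "smooth_gsec M W E" "section_of M W ?LM E"
    and F: "smooth_gsec M W F" "section_of M W ?LM F"
  have J1: "smooth_SO_section X J" and J2: "\<And>c p. c \<in> atlas X \<Longrightarrow> p \<in> fst c \<Longrightarrow> J c p ** J c p = - mat 1"
    and Jinv: "involutive X ?LX"
    using J unfolding gc_structure_def almost_gc_structure_def by blast+
  show "section_of M W ?LM (courant E F)"
    unfolding section_of_def
  proof (intro ballI)
    fix c p assume c: "c \<in> atlas M" and p: "p \<in> fst c \<inter> W"
    define c' where "c' = chart_at X (f p)"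
    have pc: "p \<in> fst c" "p \<in> W" using p by auto
    have c': "c' \<in> atlas X" "f p \<in> fst c'" unfolding c'_def using chart_at_f[OF c pc(1)] by auto
    let ?x = "snd c p" and ?y = "snd c' (f p)" and ?D = "jacobian c c' f p" and ?L = "\<Lambda> c c' p"
    have xd: "?x \<in> overlap c c'" unfolding overlap_def[OF c c'(1)] using pc c' by auto
    obtain D' where D': "((\<lambda>x. jacobian c c' f (chart_inv c x)) has_derivative D') (at ?x)"
      using smooth_on_has_derivative[OF smooth_D[OF c c'(1)] xd] by blast
    have ext: "\<exists>N DN l. first_order_lift J c c' p D' E N DN l"
      if "smooth_gsec M W E" "section_of M W ?LM E" for E
      by (rule section_extension[where J = J and K = K and W = W])
        (rule J1 c c' W pc that D' | erule (1) J2 | erule (3) lift)+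
    obtain N1 DN1 l1 where N1: "first_order_lift J c c' p D' E N1 DN1 l1" using ext[OF E] by blast
    obtain N2 DN2 l2 where N2: "first_order_lift J c c' p D' F N2 DN2 l2" using ext[OF F] by blast
    note N1 = first_order_liftD[OF N1] and N2 = first_order_liftD[OF N2]
    interpret P: kaehler_point ?D "J0 c' (f p)" "J1 c' (f p)" "G c' (f p)"
      by (rule kaehler_point[OF c c'(1) pc(1) c'(2)])
    have parts: "vpart (cmat ?L *v e) = cmat ?D *v vpart e" "cpart e = transpose (cmat ?D) *v cpart (cmat ?L *v e)" for e
      using P.is_lift_\<Lambda> unfolding is_lift_def cmat_transpose[symmetric] by (simp_all add: complex_vec_eq_iff)
    let ?E = "push_section c' N1" and ?F = "push_section c' N2"
    have own: "?E c' (chart_inv c' y) = N1 y" "?F c' (chart_inv c' y) = N2 y" if "y \<in> snd c' ` fst c'" for y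
      using that push_section_own_chart[OF X c'(1)] chart_inv[OF X c'(1)] by auto
    have own0: "?E c' (f p) = N1 ?y" "?F c' (f p) = N2 ?y"
      by (rule push_section_own_chart[OF X c'])+
    have o: "open (snd c' ` fst c')" by (rule open_chart[OF X c'(1)])
    have y: "?y \<in> snd c' ` fst c'" using c' by auto
    have DE: "((\<lambda>y. ?E c' (chart_inv c' y)) has_derivative DN1) (at ?y)" 
      by (rule has_derivative_transform_within_open[OF N1(5) o y]) (simp add: own)
    have DF: "((\<lambda>y. ?F c' (chart_inv c' y)) has_derivative DN2) (at ?y)"
      by (rule has_derivative_transform_within_open[OF N2(5) o y]) (simp add: own)
    have "section_of X (fst c') ?LX (courant ?E ?F)"
      using Jinv[unfolded involutive_def] chart_props(2)[OF X c'(1)] smooth_push_section[OF X c'(1) N1(1)]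
        smooth_push_section[OF X c'(1) N2(1)] section_of_push_section[where N = N1, OF J1 c'(1) N1(2)]
        section_of_push_section[where N = N2, OF J1 c'(1) N2(2)] by blast
    then have mem: "courant ?E ?F c' (f p) \<in> eigenspace_minus_i (J c' (f p))"
      using c' unfolding section_of_def by blast
    have SO: "J c' (f p) \<in> SO_gen" using J1 c' unfolding smooth_SO_section_def by blast
    show "courant E F c p \<in> eigenspace_minus_i (K c p)"
    proof (rule eigenspace_maximal)
      show "K c p \<in> SO_gen" "K c p ** K c p = - mat 1"
        using K c pc unfolding almost_gc_structure_def smooth_SO_section_def by blast+
      fix h assume h: "h \<in> eigenspace_minus_i (K c p)"
      let ?H = "cmat ?L *v h"
      have "?H \<in> eigenspace_minus_i (J c' (f p))"
        using h unfolding mem_eigenspace_minus_i by (simp add: lift[OF c c'(1) pc(1) c'(2)])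
      then have "cpair (courant ?E ?F c' (f p)) ?H = 0"
        by (rule eigenspace_isotropic[OF SO J2[OF c'] mem])
      then have "cpair (linear_ext DN2 (cmat ?D *v vpart (E c p))) ?H - cpair (linear_ext DN1 (cmat ?D *v vpart (F c p))) ?H
        + (cpair (linear_ext DN1 (cmat ?D *v vpart h)) (cmat ?L *v F c p) - cpair (linear_ext DN2 (cmat ?D *v vpart h)) (cmat ?L *v E c p)) / 2 = 0"
        unfolding courant_pair[where E = ?E and F = ?F and c = c' and p = "f p", OF DE DF] own0 N1(3) N2(3) parts(1) .
      then have "cpair (linear_ext (\<lambda>a. DN2 (?D *v a)) (vpart (E c p))) ?H - cpair (linear_ext (\<lambda>a. DN1 (?D *v a)) (vpart (F c p))) ?H
        + (cpair (linear_ext (\<lambda>a. DN1 (?D *v a)) (vpart h)) (cmat ?L *v F c p) - cpair (linear_ext (\<lambda>a. DN2 (?D *v a)) (vpart h)) (cmat ?L *v E c p)) / 2 = 0"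
        unfolding linear_ext_compose[OF has_derivative_linear[OF N1(5)]] linear_ext_compose[OF has_derivative_linear[OF N2(5)]] .
      then show "cpair (courant E F c p) h = 0"
        unfolding courant_pair[where E = E and F = F and c = c and p = p, OF N1(4) N2(4)]
          courant_reduction[OF derivative_D_symmetric[OF c c'(1) xd D'] parts N1(6,7) parts N2(6,7) parts] .
    qed
  qed
qed

theorem reduced_kaehler_one_spinor:
  "generalized_kaehler_one_spinor M K0 \<psi>M"
proof -
  have "gc_structure M K0" "gc_structure M K1"
    using involutive_reduced[OF ambient_structures(2) almost_gc_K0 reduced_at_in_charts(1)] involutive_reduced[OF ambient_structures(3) almost_gc_K1 reduced_at_in_charts(2)]
      almost_gc_K0 almost_gc_K1 unfolding gc_structure_def by blast+
  then show ?thesis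
    unfolding generalized_kaehler_one_spinor_def generalized_kaehler_def K1_def[symmetric]
    using pure_\<psi>M nondegenerate_\<psi>M d_closed_\<psi>M generalized_metric_M reduced_at(5) by blast
qed

end

theorem theorem1p14:
  fixes X :: "('x, 'n::finite) manifold" and M :: "('y, 'm::finite) manifold"
    and f :: "'y \<Rightarrow> 'x" and J0 :: "('x, 'n) gend" and \<psi> :: "('x, 'n) cform_field"
    and n m :: nat
  assumes "smooth_manifold X" and "compact_space (topo X)" and "CARD('n) = 2 * n"
    and "generalized_kaehler_one_spinor X J0 \<psi>"
    and "smooth_manifold M" and "CARD('m) = 2 * m"
    and "smooth_embedding M X f"
    and "conormal_invariant M X f J0"
  shows "(d_closed M (form_pullback X f \<psi>) \<and> nondegenerate_spinor M (form_pullback X f \<psi>) \<and>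
      pure_spinor M (form_pullback X f \<psi>)) \<and>
    generalized_kaehler_one_spinor M (induced_structure X f J0) (form_pullback X f \<psi>)"
proof -
  interpret kaehler_submanifold X M f J0 \<psi>
    by unfold_locales (fact assms)+
  show ?thesis
    using d_closed_\<psi>M nondegenerate_\<psi>M pure_\<psi>M reduced_kaehler_one_spinor unfolding \<psi>M_def K0_def by blast
qed

end
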